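(* Let $\alpha\in(1/2,1)$ and let $F$ satisfy the tail conditions (i) and (ii) below with this $\alpha$. Then $$\lim_{x\to\infty}x\bar F(x)\,U(x+I)=\alpha h\int_0^\infty x^{-\alpha}g(x)\,dx .$$
   Context: $F$ is a probability measure on $\mathbb{R}$, $F(x)=F((-\infty,x])$, $\bar F(x)=1-F(x)$. $\mathcal{R}_\alpha$ denotes the class of functions strictly positive on $(0,\infty)$ and regularly varying at $\infty$ with exponent $\alpha$. Tail conditions: (i) for some $r\in\mathcal{R}_\alpha$, $\bar F(x)\sim 1/r(x)$ as $x\to\infty$; (ii) $\lim_{x\to\infty}F(-x)/\bar F(x)$ exists and is finite. $F$ is arithmetic if concentrated on $h\mathbb{Z}$ for some $h>0$; its span is the largest such $h$. Fix $h>0$: if $F$ is arithmetic, $h$ is its span; otherwise $h>0$ is arbitrary. $I=(0,h]$, $U=\sum_{n\ge0}F^{*n}$ is the renewal measure ($F^{*0}$ = unit mass at 0). $r^-(x)=\inf\{t\ge1:r(t)>x\}$, $a_n=r^-(n)$; under (i),(ii), $(X_1+\dots+X_n)/a_n$ with $X_i$ i.i.d. $\sim F$ converges in distribution to a stable random variable $\zeta$ of exponent $\alpha$, and $g$ is the density of $\zeta$. *)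

theory Defs
  imports "HOL-Probability.Probability" "HOL-Probability.Convolution" "HOL-Library.Landau_Symbols"
begin

text \<open>Tail function  Fbar(x) = 1 - F((-inf,x]).\<close>
definition Fbar :: "real measure \<Rightarrow> real \<Rightarrow> real" where
  "Fbar F x = 1 - measure F {..x}"

text \<open>Class R_alpha: measurable, strictly positive on (0,inf), regularly varying at inf
  with exponent alpha.\<close>
definition regvar :: "real \<Rightarrow> (real \<Rightarrow> real) \<Rightarrow> bool" where
  "regvar \<alpha> r \<longleftrightarrow> r \<in> borel_measurable borel \<and> (\<forall>x>0. r x > 0) \<and>
     (\<forall>c>0. ((\<lambda>x. r (c * x) / r x) \<longlongrightarrow> c powr \<alpha>) at_top)"

text \<open>F concentrated on the lattice h*Z.\<close>
definition lattice_on :: "real measure \<Rightarrow> real \<Rightarrow> bool" where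
  "lattice_on F h \<longleftrightarrow> h > 0 \<and> measure F (range (\<lambda>k::int. h * of_int k)) = 1"

definition arithmetic :: "real measure \<Rightarrow> bool" where
  "arithmetic F \<longleftrightarrow> (\<exists>h. lattice_on F h)"

definition span :: "real measure \<Rightarrow> real" where
  "span F = (GREATEST h. lattice_on F h)"

text \<open>n-fold convolution power; F^{*0} is the unit mass at 0.\<close>
fun conv_pow :: "real measure \<Rightarrow> nat \<Rightarrow> real measure" where
  "conv_pow F 0 = return borel 0"
| "conv_pow F (Suc n) = convolution F (conv_pow F n)"

text \<open>Renewal measure U(A) = sum_n F^{*n}(A) (possibly infinite).\<close>
definition renewal :: "real measure \<Rightarrow> real set \<Rightarrow> ennreal" where
  "renewal F A = (\<Sum>n. emeasure (conv_pow F n) A)"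

text \<open>Generalised inverse r^-(x) = inf{t >= 1 : r t > x}.\<close>
definition rinv :: "(real \<Rightarrow> real) \<Rightarrow> real \<Rightarrow> real" where
  "rinv r x = Inf {t. t \<ge> 1 \<and> r t > x}"

end

theory Submission
  imports Defs
begin

text \<open>
  Write \<open>A = 1 / Fbar F\<close> and \<open>\<phi>\<close> for the characteristic function of \<open>F\<close>. The sum
  \<open>U (x + I) = \<Sum>n. P (S\<^sub>n \<in> x + I)\<close> is split at \<open>n = \<delta> * A x\<close> and \<open>n = K * A x\<close>.

  Regular variation gives \<open>\<bar>\<phi> t\<bar> \<le> exp (- c * Fbar F (1 / \<bar>t\<bar>))\<close> near \<open>0\<close>, hence the concentration bound
  \<open>P (S\<^sub>n \<in> z + I) \<le> C / a\<^sub>n\<close>, which controls the large \<open>n\<close>. For small \<open>n\<close>, one half of the walk has to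
  exceed \<open>x / 2\<close>, which yields an extra factor \<open>n * Fbar F x\<close>; the resulting contribution has order
  \<open>\<delta> powr (2 - 1 / \<alpha>)\<close>, and it is here that \<open>\<alpha> > 1/2\<close> is needed.

  For the middle block, Fourier inversion is used after summation over \<open>n\<close>. The frequencies near \<open>0\<close> give a
  Riemann sum for the integral of \<open>u powr (- 1 / \<alpha>) * g (u powr (- 1 / \<alpha>))\<close> over \<open>{\<delta>..K}\<close>, the remaining ones only a geometric
  sum which is negligible where \<open>\<phi> \<noteq> 1\<close>. No local limit theorem for a single \<open>n\<close> is needed; it would fail
  for periodic walks.
\<close>

section \<open>Fourier analysis of probability measures\<close>

text \<open>Two obstacles shape the proof. The function \<open>r\<close> need not be monotone,
  whereas \<open>A\<close> is. All estimates are therefore made for \<open>A\<close>, and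
  \<open>r\<close> enters only through \<open>r / A\<close> tending to 1, which turns the definition
  of \<open>rinv r n\<close> into \<open>A (a n) / n\<close> tending to 1. The second obstacle is
  that the indicator of an interval has a Fourier transform that is not integrable. On a lattice the
  interval contains one atom, whose mass is an integral over one period. Otherwise the interval is
  replaced by the kernel \<open>fejer\<close>, whose transform \<open>tri\<close> has compact
  support, and is recovered at the end from weak convergence.

  The factor \<alpha> and the power \<open>x powr (- \<alpha>)\<close> in the limit come from the
  substitution \<open>v = u powr (-1 / \<alpha>)\<close> in the block integral. Finiteness of that
  integral is not presupposed: the truncated integrals are limits of approximants that differ by
  small errors, so they form a Cauchy sequence.\<close>

lemma real_distribution_convolution:
  assumes "real_distribution M" "real_distribution N"
  shows "real_distribution (M \<star> N)"
proof -
  interpret M: real_distribution M by fact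
  interpret N: real_distribution N by fact
  interpret P: pair_prob_space M N ..
  show ?thesis
    unfolding convolution_def
    by (intro P.real_distribution_distr) simp
qed

lemma char_convolution:
  assumes "real_distribution M" "real_distribution N"
  shows "char (M \<star> N) t = char M t * char N t"
proof -
  interpret M: real_distribution M by fact
  interpret N: real_distribution N by fact
  interpret P: pair_prob_space M N ..
  have int: "integrable (M \<Otimes>\<^sub>M N) (\<lambda>(x, y). iexp (t * (x + y)))"
    by (intro P.P.integrable_const_bound[of _ 1]) (auto simp: split_beta')
  have "char (M \<star> N) t = (\<integral>z. (case z of (x, y) \<Rightarrow> iexp (t * (x + y))) \<partial>(M \<Otimes>\<^sub>M N))"
    unfolding char_def convolution_def by (subst integral_distr) (auto simp: split_beta')
  also have "\<dots> = (\<integral>x. (\<integral>y. iexp (t * (x + y)) \<partial>N) \<partial>M)"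
    using P.integral_fst'[OF int] by simp
  also have "\<dots> = (\<integral>x. (\<integral>y. iexp (t * x) * iexp (t * y) \<partial>N) \<partial>M)"
    by (simp add: ring_distribs exp_add)
  also have "\<dots> = char M t * char N t"
    by (simp add: char_def)
  finally show ?thesis .
qed

lemma real_distribution_conv_pow:
  assumes "real_distribution F"
  shows "real_distribution (conv_pow F n)"
proof (induction n)
  case 0
  show ?case
    by (auto simp: real_distribution_def real_distribution_axioms_def intro!: prob_space_return)
qed (auto intro!: real_distribution_convolution assms)

lemma char_conv_pow:
  assumes "real_distribution F"
  shows "char (conv_pow F n) t = char F t ^ n"
proof (induction n)
  case 0
  show ?case by (simp add: char_def integral_return)
qed (auto simp: char_convolution real_distribution_conv_pow assms)

lemma conv_pow_add:
  assumes "real_distribution F"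
  shows "conv_pow F (m + n) = (conv_pow F m \<star> conv_pow F n)"
  by (intro Levy_uniqueness real_distribution_conv_pow real_distribution_convolution assms ext)
     (simp add: char_convolution real_distribution_conv_pow assms char_conv_pow power_add)

text \<open>Fubini, in the form by which information passes between \<open>M\<close> and
  \<open>char M\<close>. Later \<open>w\<close> is a modulated triangle or the modulated indicator
  of one period.\<close>

lemma integral_fourier_swap:
  fixes w :: "real \<Rightarrow> complex"
  assumes "real_distribution M" and w: "integrable lborel w"
  shows "(\<integral>y. (CLBINT t. w t * iexp (t * y)) \<partial>M) = (CLBINT t. w t * char M t)"
proof -
  interpret M: real_distribution M by fact
  interpret P: pair_sigma_finite M lborel ..
  have [measurable]: "w \<in> borel_measurable borel"
    using w by auto
  have "integrable (M \<Otimes>\<^sub>M lborel) (\<lambda>(y, t). w t * iexp (t * y))"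
  proof (rule P.Fubini_integrable)
    have "integrable lborel (\<lambda>t. w t * iexp (t * y))" for y
      by (rule Bochner_Integration.integrable_bound[OF w]) (auto simp: norm_mult)
    then show "AE y in M. integrable lborel (\<lambda>t. case (y, t) of (y, t) \<Rightarrow> w t * iexp (t * y))"
      by simp
  qed (auto simp: norm_mult)
  from P.Fubini_integral[OF this] show ?thesis
    by (simp add: char_def)
qed

lemma char_uminus:
  assumes "real_distribution M" shows "char M (- t) = cnj (char M t)"
proof -
  have "cnj (char M t) = (CLINT x|M. cnj (iexp (t * x)))"
    by (simp add: char_def)
  also have "\<dots> = char M (- t)"
    by (simp add: char_def exp_cnj)
  finally show ?thesis ..
qed

section \<open>The triangle and the Fejer kernel\<close>

lemma has_vector_derivative_iexp_mult:
  "((\<lambda>t. iexp (t * y)) has_vector_derivative (\<i> * y * iexp (t * y))) (at t within S)"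
proof -
  have "((\<lambda>z. exp (\<i> * (z * complex_of_real y))) has_field_derivative (\<i> * y * iexp (t * y)))
     (at (complex_of_real t) within of_real ` S)"
    by (auto intro!: derivative_eq_intros)
  moreover have "(complex_of_real has_vector_derivative 1) (at t within S)"
    using has_vector_derivative_of_real[OF DERIV_ident, of "at t within S"] by simp
  ultimately show ?thesis
    using field_vector_diff_chain_within[of complex_of_real 1 t S "\<lambda>z. exp (\<i> * (z * complex_of_real y))"]
    by (simp add: o_def)
qed

text \<open>A weight with compact support in frequency whose transform is nonnegative and
  integrable.\<close>

definition tri :: "real \<Rightarrow> real \<Rightarrow> real" where
  "tri \<eta> t = max 0 (1 - \<bar>t\<bar> / \<eta>)"

text \<open>The unnormalised Fejer kernel, with integral \<open>2 * pi\<close> over the line. The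
  value at 0 is the limit of the quotient and also the area of the triangle.\<close>

definition fejer :: "real \<Rightarrow> real \<Rightarrow> real" where
  "fejer \<eta> y = (if y = 0 then \<eta> else 2 * (1 - cos (\<eta> * y)) / (\<eta> * y\<^sup>2))"

lemma tri_measurable [measurable]: "tri \<eta> \<in> borel_measurable borel"
  unfolding tri_def by measurable

lemma tri_nonneg: "0 \<le> tri \<eta> t"
  by (simp add: tri_def)

lemma tri_le_1: "\<eta> > 0 \<Longrightarrow> tri \<eta> t \<le> 1"
  by (simp add: tri_def)

lemma tri_0 [simp]: "tri \<eta> 0 = 1"
  by (simp add: tri_def)

lemma tri_eq_0: "\<eta> > 0 \<Longrightarrow> \<eta> \<le> \<bar>t\<bar> \<Longrightarrow> tri \<eta> t = 0"
  by (simp add: tri_def)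

lemma isCont_tri: "\<eta> > 0 \<Longrightarrow> isCont (tri \<eta>) t"
  unfolding tri_def[abs_def] by (intro continuous_intros) auto

lemma fejer_measurable [measurable]: "fejer \<eta> \<in> borel_measurable borel"
  unfolding fejer_def[abs_def] by measurable

lemma fejer_nonneg: "\<eta> > 0 \<Longrightarrow> 0 \<le> fejer \<eta> y"
  by (auto simp: fejer_def intro!: divide_nonneg_nonneg mult_nonneg_nonneg)

lemma has_bochner_integral_tri_iexp:
  assumes \<eta>: "\<eta> > 0"
  shows "has_bochner_integral lborel (\<lambda>t. complex_of_real (tri \<eta> t) * iexp (t * y)) (complex_of_real (fejer \<eta> y))"
proof -
  define f where "f = (\<lambda>y t. complex_of_real (1 - t / \<eta>) * iexp (t * y))"
  \<comment> \<open>An antiderivative of \<open>f y\<close>, obtained by parts when \<open>y\<close>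
    is nonzero.\<close>
  define P where "P = (\<lambda>y t. if y = 0 then complex_of_real (t - t\<^sup>2 / (2 * \<eta>)) else
     complex_of_real (1 - t / \<eta>) * iexp (t * y) / (\<i> * y) + iexp (t * y) / (\<eta> * (\<i> * y)^2))"
  have p: "has_bochner_integral lborel (\<lambda>t. indicator {0..\<eta>} t *\<^sub>R f y t) (P y \<eta> - P y 0)" for y :: real
  proof (rule has_bochner_integral_FTC_Icc)
    fix t assume t: "0 \<le> t" "t \<le> \<eta>"
    show "(P y has_vector_derivative f y t) (at t within {0..\<eta>})"
    proof (cases "y = 0")
      case True
      have "((\<lambda>t. t - t\<^sup>2 / (2 * \<eta>)) has_real_derivative (1 - t / \<eta>)) (at t within {0..\<eta>})"
        using \<eta> by (auto intro!: derivative_eq_intros simp: field_simps)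
      then have "((\<lambda>t. complex_of_real (t - t\<^sup>2 / (2 * \<eta>))) has_vector_derivative complex_of_real (1 - t / \<eta>)) (at t within {0..\<eta>})"
        by (rule has_vector_derivative_of_real)
      then show ?thesis using True by (simp add: P_def f_def)
    next
      case False
      have "((\<lambda>t. 1 - t / \<eta>) has_real_derivative (- 1 / \<eta>)) (at t within {0..\<eta>})"
        using \<eta> by (auto intro!: derivative_eq_intros simp: field_simps)
      note 1 = has_vector_derivative_of_real[OF this]
      note 2 = has_vector_derivative_iexp_mult[of y t "{0..\<eta>}"]
      have "((\<lambda>t. complex_of_real (1 - t / \<eta>) * iexp (t * y) * (1 / (\<i> * y)) + iexp (t * y) * (1 / (\<eta> * (\<i> * y)^2)))
          has_vector_derivative f y t) (at t within {0..\<eta>})"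
        by (rule has_vector_derivative_eq_rhs[OF has_vector_derivative_add[OF
              has_vector_derivative_mult_left[OF has_vector_derivative_mult[OF 1 2]]
              has_vector_derivative_mult_left[OF 2]]])
           (use False \<eta> in \<open>simp add: f_def field_simps power2_eq_square\<close>)
      then show ?thesis using False by (simp add: P_def)
    qed
  qed (use \<eta> in \<open>auto simp: f_def intro!: continuous_intros\<close>)
  \<comment> \<open>The left half of the triangle is the mirror image of the right half with
    \<open>- y\<close> for \<open>y\<close>; the two halves overlap only at 0.\<close>
  have m: "has_bochner_integral lborel (\<lambda>t. indicator {0..\<eta>} (- t) *\<^sub>R f (- y) (- t)) (P (- y) \<eta> - P (- y) 0)"
    using lborel_has_bochner_integral_real_affine_iff[of "- 1" "\<lambda>t. indicator {0..\<eta>} t *\<^sub>R f (- y) t" _ 0] p[of "- y"] by simp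
  have "AE t in lborel. t \<noteq> (0::real)"
    by (rule AE_lborel_singleton)
  then have ae: "AE t in lborel. indicator {0..\<eta>} t *\<^sub>R f y t + indicator {0..\<eta>} (- t) *\<^sub>R f (- y) (- t)
     = complex_of_real (tri \<eta> t) * iexp (t * y)"
    by eventually_elim (use \<eta> in \<open>auto simp: f_def tri_def indicator_def max_def field_simps\<close>)
  have val: "P y \<eta> - P y 0 + (P (- y) \<eta> - P (- y) 0) = complex_of_real (fejer \<eta> y)"
  proof (cases "y = 0")
    case False
    have "P y \<eta> - P y 0 + (P (- y) \<eta> - P (- y) 0) = (iexp (\<eta> * y) + iexp (- (\<eta> * y)) - 2) / (\<eta> * (\<i> * y)^2)"
      using False \<eta> by (simp add: P_def field_simps)
    also have "iexp (\<eta> * y) + iexp (- (\<eta> * y)) = 2 * complex_of_real (cos (\<eta> * y))"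
      by (simp add: complex_eq_iff Re_exp Im_exp)
    finally show ?thesis using False \<eta>
      by (simp add: fejer_def field_simps power2_eq_square)
  qed (use \<eta> in \<open>simp add: P_def fejer_def field_simps power2_eq_square\<close>)
  have meas: "(\<lambda>t. indicator {0..\<eta>} t *\<^sub>R f y t + indicator {0..\<eta>} (- t) *\<^sub>R f (- y) (- t)) \<in> borel_measurable lborel"
    unfolding f_def by measurable
  show ?thesis
    using has_bochner_integral_add[OF p[of y] m] unfolding val
    by (subst (asm) has_bochner_integral_cong_AE[OF meas _ ae]) auto
qed

text \<open>Expansion to fourth order gives at least \<open>u^2 / 2 - u^4 / 24\<close>, which leaves
  ample room for \<open>u^2 / 4\<close> when \<bar>u\<bar> \<le> 1.\<close>

lemma one_minus_cos_ge:
  fixes u :: real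
  assumes "\<bar>u\<bar> \<le> 1"
  shows "u\<^sup>2 / 4 \<le> 1 - cos u"
proof -
  obtain t where t: "cos u = (\<Sum>m<4. cos_coeff m * u ^ m) + (cos (t + 1/2 * real 4 * pi) / fact 4) * u ^ 4"
    using Maclaurin_cos_expansion[of u 4] by blast
  have "u ^ 4 \<le> u\<^sup>2 * 1"
    using assms mult_left_mono[of "u\<^sup>2" 1 "u\<^sup>2"] abs_square_le_1[of u] by (simp add: power2_eq_square power4_eq_xxxx)
  moreover have "cos (t + 1/2 * real 4 * pi) / fact 4 * u ^ 4 \<le> 1 / fact 4 * u ^ 4"
    by (intro mult_right_mono divide_right_mono) auto
  moreover have "(\<Sum>m<4. cos_coeff m * u ^ m) = 1 - u\<^sup>2 / 2"
  proof -
    have "{..<4} = {0, 1, 2, 3::nat}" by auto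
    then show ?thesis by (simp add: cos_coeff_def)
  qed
  ultimately show ?thesis
    unfolding t by (simp add: fact_numeral) (smt (verit) zero_le_power2)
qed

text \<open>Serves twice: a multiple of the kernel majorises the indicator of an interval of length
  at most \<open>1 / \<eta>\<close>, and on such an interval the kernel may be divided out.\<close>

lemma fejer_ge:
  assumes "\<eta> > 0" "\<bar>\<eta> * y\<bar> \<le> 1"
  shows "\<eta> / 2 \<le> fejer \<eta> y"
proof (cases "y = 0")
  case False
  then have "\<eta> / 2 = 2 * ((\<eta> * y)\<^sup>2 / 4) / (\<eta> * y\<^sup>2)"
    using assms by (simp add: power2_eq_square field_simps)
  also have "\<dots> \<le> 2 * (1 - cos (\<eta> * y)) / (\<eta> * y\<^sup>2)"
    using assms one_minus_cos_ge by (intro divide_right_mono mult_left_mono) auto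
  finally show ?thesis using False by (simp add: fejer_def)
qed (use assms in \<open>simp add: fejer_def\<close>)

lemma integrable_tri: "\<eta> > 0 \<Longrightarrow> integrable lborel (tri \<eta>)"
  using has_bochner_integral_tri_iexp[of \<eta> 0]
  by (simp add: has_bochner_integral_iff complex_of_real_integrable_eq)

lemma integral_tri: "\<eta> > 0 \<Longrightarrow> integral\<^sup>L lborel (tri \<eta>) = \<eta>"
  using has_bochner_integral_tri_iexp[of \<eta> 0]
  by (simp add: has_bochner_integral_iff fejer_def)

lemma fejer_le:
  assumes "\<eta> > 0"
  shows "fejer \<eta> y \<le> \<eta>"
proof -
  note h = has_bochner_integral_tri_iexp[OF assms]
  have "cmod (complex_of_real (fejer \<eta> y)) \<le> (\<integral>t. norm (complex_of_real (tri \<eta> t) * iexp (t * y)) \<partial>lborel)"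
    unfolding has_bochner_integral_integral_eq[OF h, symmetric] by (rule integral_norm_bound)
  also have "\<dots> = (\<integral>t. norm (complex_of_real (tri \<eta> t) * iexp (t * 0)) \<partial>lborel)"
    by (simp add: norm_mult)
  also have "\<dots> = \<eta>"
    using integral_tri[OF assms] by (simp add: tri_nonneg)
  finally show ?thesis using assms by (simp add: fejer_nonneg)
qed

lemma integrable_tri_mult:
  fixes f :: "real \<Rightarrow> 'a::{real_normed_field, banach, second_countable_topology}"
  assumes "\<eta> > 0" and [measurable]: "f \<in> borel_measurable borel" and "\<And>t. norm (f t) \<le> B"
  shows "integrable lborel (\<lambda>t. of_real (tri \<eta> (t - s)) * f t)"
proof (rule Bochner_Integration.integrable_bound)
  show "integrable lborel (\<lambda>t. B * tri \<eta> (t - s))"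
    using lborel_integrable_real_affine[OF integrable_tri[OF assms(1)], of 1 "-s"] by simp
  have "norm (of_real (tri \<eta> (t - s)) * f t) \<le> \<bar>B * tri \<eta> (t - s)\<bar>" for t
  proof -
    have "tri \<eta> (t - s) * norm (f t) \<le> tri \<eta> (t - s) * B"
      by (intro mult_left_mono assms tri_nonneg)
    then show ?thesis using assms(3)[of t] norm_ge_zero[of "f t"]
      by (simp add: norm_mult abs_mult tri_nonneg mult.commute abs_of_nonneg order_trans[OF norm_ge_zero])
  qed
  then show "AE t in lborel. norm (of_real (tri \<eta> (t - s)) * f t) \<le> norm (B * tri \<eta> (t - s))"
    by simp
qed measurable

section \<open>Smoothed masses and concentration\<close>

lemma integrable_fejer:
  assumes "real_distribution M" "\<eta> > 0"
  shows "integrable M (\<lambda>y. fejer \<eta> (y - z))"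
proof -
  interpret M: real_distribution M by fact
  show ?thesis
    by (rule M.integrable_const_bound[of _ \<eta>]) (use assms fejer_le fejer_nonneg in auto)
qed

text \<open>Modulation and translation exchange their roles: the phase in \<open>z\<close> recentres
  the kernel at \<open>z\<close>, and the shift \<open>s\<close> of the triangle becomes a phase.
  Thus \<open>s = 0\<close> gives the smoothed mass near \<open>z\<close>, while general
  \<open>s\<close> gives the characteristic function of the measure reweighted by the
  kernel.\<close>

lemma integral_tri_char:
  assumes "real_distribution M" "\<eta> > 0"
  shows "(CLBINT t. complex_of_real (tri \<eta> (t - s)) * iexp (- (t * z)) * char M t) =
     (CLINT y|M. complex_of_real (fejer \<eta> (y - z)) * iexp (s * (y - z)))"
proof -
  have [measurable]: "char M \<in> borel_measurable borel"
    using real_distribution.char_measurable[OF assms(1)] .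
  have int: "integrable lborel (\<lambda>t. complex_of_real (tri \<eta> (t - s)) * iexp (- (t * z)))"
    by (rule integrable_tri_mult[where B=1]) (use assms in auto)
  have "(CLBINT t. complex_of_real (tri \<eta> (t - s)) * iexp (- (t * z)) * char M t) =
      (\<integral>y. (CLBINT t. complex_of_real (tri \<eta> (t - s)) * iexp (- (t * z)) * iexp (t * y)) \<partial>M)"
    by (rule integral_fourier_swap[OF assms(1) int, symmetric])
  also have "\<dots> = (\<integral>y. complex_of_real (fejer \<eta> (y - z)) * iexp (s * (y - z)) \<partial>M)"
  proof (rule Bochner_Integration.integral_cong[OF refl])
    fix y
    have "(CLBINT t. complex_of_real (tri \<eta> (t - s)) * iexp (- (t * z)) * iexp (t * y)) =
       (CLBINT t. complex_of_real (tri \<eta> (t - s)) * iexp (t * (y - z)))"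
      by (intro Bochner_Integration.integral_cong refl) (simp add: exp_add[symmetric] ring_distribs mult.assoc)
    also have "\<dots> = (CLBINT t. complex_of_real (tri \<eta> t) * iexp (t * (y - z)) * iexp (s * (y - z)))"
      by (subst lborel_integral_real_affine[where c=1 and t=s])
         (auto simp: exp_add[symmetric] algebra_simps intro!: Bochner_Integration.integral_cong)
    also have "\<dots> = complex_of_real (fejer \<eta> (y - z)) * iexp (s * (y - z))"
      using has_bochner_integral_tri_iexp[OF assms(2), of "y - z"] by (simp add: has_bochner_integral_iff)
    finally show "(CLBINT t. complex_of_real (tri \<eta> (t - s)) * iexp (- (t * z)) * iexp (t * y)) =
      complex_of_real (fejer \<eta> (y - z)) * iexp (s * (y - z))" .
  qed
  finally show ?thesis .
qed

lemma measure_Ioc_le_fejer: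
  assumes "real_distribution M" "\<eta> > 0" "\<eta> * h \<le> 1"
  shows "measure M {z<..z+h} \<le> 2 / \<eta> * (\<integral>y. fejer \<eta> (y - z) \<partial>M)"
proof -
  interpret M: real_distribution M by fact
  have "\<eta> / 2 * measure M {z<..z+h} = (\<integral>y. \<eta> / 2 * indicator {z<..z+h} y \<partial>M)"
    by simp
  also have "\<dots> \<le> (\<integral>y. fejer \<eta> (y - z) \<partial>M)"
  proof (rule integral_mono')
    fix y
    show "\<eta> / 2 * indicator {z<..z+h} y \<le> fejer \<eta> (y - z)"
    proof (cases "y \<in> {z<..z+h}")
      case True
      then have "\<eta> * (y - z) \<le> \<eta> * h" "0 \<le> \<eta> * (y - z)"
        using assms by (auto intro!: mult_left_mono)
      then have "\<bar>\<eta> * (y - z)\<bar> \<le> 1" using assms(3) by linarith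
      then show ?thesis using fejer_ge[OF assms(2)] True by simp
    qed (use fejer_nonneg[OF assms(2)] in auto)
  qed (use integrable_fejer[OF assms(1,2)] fejer_nonneg[OF assms(2)] in auto)
  finally show ?thesis using assms by (simp add: field_simps)
qed

text \<open>A concentration inequality of Esseen type: after absolute values are taken the phase
  disappears, so the bound is uniform in \<open>z\<close> and only frequencies below
  \<open>\<eta>\<close> count.\<close>

lemma measure_Ioc_le_char:
  assumes "real_distribution M" "\<eta> > 0" "\<eta> * h \<le> 1"
  shows "measure M {z<..z+h} \<le> 2 / \<eta> * (LBINT t. tri \<eta> t * cmod (char M t))"
proof -
  have "(\<integral>y. fejer \<eta> (y - z) \<partial>M) = cmod (CLINT y|M. complex_of_real (fejer \<eta> (y - z)) * iexp (0 * (y - z)))"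
    using fejer_nonneg[OF assms(2)] by (simp add: integral_nonneg)
  also have "\<dots> = cmod (CLBINT t. complex_of_real (tri \<eta> (t - 0)) * iexp (- (t * z)) * char M t)"
    by (simp only: integral_tri_char[OF assms(1,2)])
  also have "\<dots> \<le> (LBINT t. tri \<eta> t * cmod (char M t))"
    by (rule order_trans[OF integral_norm_bound]) (simp add: norm_mult tri_nonneg)
  finally have "2 / \<eta> * (\<integral>y. fejer \<eta> (y - z) \<partial>M) \<le> 2 / \<eta> * (LBINT t. tri \<eta> t * cmod (char M t))"
    using assms by (intro mult_left_mono) auto
  with measure_Ioc_le_fejer[OF assms] show ?thesis by (rule order_trans)
qed

text \<open>Translating the triangle by \<open>s\<close> twists its transform by a phase, so for a nonnegative
  transform of \<open>M\<close> the integral against the centred triangle is the largest.\<close>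

lemma integral_tri_shift_le:
  assumes "real_distribution M" "\<eta> > 0"
  shows "(LBINT t. tri \<eta> (t - s) * (cmod (char M t))\<^sup>2) \<le> (LBINT t. tri \<eta> t * (cmod (char M t))\<^sup>2)"
proof -
  interpret M: real_distribution M by fact
  \<comment> \<open>The symmetrisation of \<open>M\<close>, the law of a difference of two
    independent copies; its characteristic function is the squared modulus.\<close>
  define G where "G = (M \<star> distr M borel uminus)"
  have N: "real_distribution (distr M borel uminus)"
    by (intro M.real_distribution_distr) auto
  have G: "real_distribution G"
    unfolding G_def by (intro real_distribution_convolution assms N)
  have "char (distr M borel uminus) t = char M (- t)" for t
    unfolding char_def by (subst integral_distr) auto
  then have charG: "char G t = complex_of_real ((cmod (char M t))\<^sup>2)" for t
    unfolding G_def using char_convolution[OF assms(1) N]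
    by (simp add: char_uminus[OF assms(1)] flip: complex_norm_square)
  interpret G: real_distribution G by fact
  have re: "complex_of_real (LBINT t. tri \<eta> (t - s) * (cmod (char M t))\<^sup>2) =
     (CLINT y|G. complex_of_real (fejer \<eta> y) * iexp (s * y))" for s
    using integral_tri_char[OF G assms(2), of s 0] by (simp add: charG flip: of_real_mult of_real_power)
  have "(LBINT t. tri \<eta> (t - s) * (cmod (char M t))\<^sup>2) \<le> cmod (CLINT y|G. complex_of_real (fejer \<eta> y) * iexp (s * y))"
    unfolding re[symmetric] norm_of_real by simp
  also have "\<dots> \<le> (\<integral>y. fejer \<eta> y \<partial>G)"
    by (rule order_trans[OF integral_norm_bound]) (simp add: norm_mult fejer_nonneg assms)
  also have "\<dots> = (LBINT t. tri \<eta> t * (cmod (char M t))\<^sup>2)"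
    using re[of 0] by (simp flip: of_real_mult of_real_power)
  finally show ?thesis .
qed

text \<open>A grid of shifted triangles covers the window, and no shifted triangle has a larger
  integral than the centred one. In this way an estimate near frequency 0 extends to any compact
  window, where no decay of the characteristic function is available.\<close>

lemma integral_char_sq_le:
  assumes "\<eta> > 0"
  obtains C where "\<And>M. real_distribution M \<Longrightarrow>
    (LBINT t. indicator {-T..T} t * (cmod (char M t))\<^sup>2) \<le> C * (LBINT t. tri \<eta> t * (cmod (char M t))\<^sup>2)"
proof -
  \<comment> \<open>The grid point nearest to \<open>t\<close> has index at most
    \<open>2 * \<bar>T\<bar> / \<eta> + 1/2\<close> in modulus.\<close>
  define N :: int where "N = \<lceil>2 * \<bar>T\<bar> / \<eta>\<rceil> + 1"
  have le: "(LBINT t. indicator {-T..T} t * (cmod (char M t))\<^sup>2)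
      \<le> (2 * card {-N..N}) * (LBINT t. tri \<eta> t * (cmod (char M t))\<^sup>2)" if M: "real_distribution M" for M
  proof -
    interpret M: real_distribution M by fact
    have sq: "(cmod (char M t))\<^sup>2 \<le> 1" for t
      using M.cmod_char_le_1[of t] by (simp add: power_le_one)
    have I: "integrable lborel (\<lambda>t. tri \<eta> (t - s) * (cmod (char M t))\<^sup>2)" for s
      using integrable_tri_mult[OF assms, of "\<lambda>t. (cmod (char M t))\<^sup>2" 1 s] sq by simp
    have "(LBINT t. indicator {-T..T} t * (cmod (char M t))\<^sup>2)
        \<le> (LBINT t. (\<Sum>k\<in>{-N..N}. 2 * (tri \<eta> (t - k * \<eta> / 2) * (cmod (char M t))\<^sup>2)))"
    proof (rule integral_mono')
      fix t
      show "indicator {-T..T} t * (cmod (char M t))\<^sup>2 \<le> (\<Sum>k\<in>{-N..N}. 2 * (tri \<eta> (t - k * \<eta> / 2) * (cmod (char M t))\<^sup>2))"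
      proof (cases "t \<in> {-T..T}")
        case True
        define k where "k = round (2 * t / \<eta>)"
        have k: "\<bar>of_int k - 2 * t / \<eta>\<bar> \<le> 1 / 2"
          unfolding k_def by (rule of_int_round_abs_le)
        have "\<bar>2 * t / \<eta>\<bar> \<le> 2 * \<bar>T\<bar> / \<eta>"
          using True assms by (auto simp: abs_mult intro!: divide_right_mono)
        with k have "k \<in> {-N..N}"
          unfolding N_def by (simp, linarith)
        \<comment> \<open>The nearest centre is at distance at most \<open>\<eta> / 4\<close>, where
          the triangle is still at least 3/4.\<close>
        moreover have "1 \<le> 2 * tri \<eta> (t - k * \<eta> / 2)"
        proof -
          have "\<bar>t - k * \<eta> / 2\<bar> = \<eta> / 2 * \<bar>of_int k - 2 * t / \<eta>\<bar>"
            using assms by (subst abs_of_pos[of "\<eta> / 2", symmetric]) (auto simp: abs_mult[symmetric] field_simps abs_minus_commute)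
          also have "\<dots> \<le> \<eta> / 2 * (1 / 2)"
            using k assms by (intro mult_left_mono) auto
          finally have "\<bar>t - k * \<eta> / 2\<bar> / \<eta> \<le> (\<eta> / 2 * (1 / 2)) / \<eta>"
            using assms by (intro divide_right_mono) auto
          then have "\<bar>t - k * \<eta> / 2\<bar> / \<eta> \<le> 1 / 4"
            using assms by simp
          moreover have "1 - \<bar>t - k * \<eta> / 2\<bar> / \<eta> \<le> tri \<eta> (t - k * \<eta> / 2)"
            by (simp add: tri_def)
          ultimately show ?thesis by linarith
        qed
        ultimately have "1 * (cmod (char M t))\<^sup>2 \<le> 2 * (tri \<eta> (t - k * \<eta> / 2)) * (cmod (char M t))\<^sup>2"
          by (intro mult_right_mono) auto
        also have "\<dots> \<le> (\<Sum>k\<in>{-N..N}. 2 * (tri \<eta> (t - k * \<eta> / 2) * (cmod (char M t))\<^sup>2))"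
          using member_le_sum[of k "{-N..N}" "\<lambda>k. 2 * (tri \<eta> (t - k * \<eta> / 2) * (cmod (char M t))\<^sup>2)"] \<open>k \<in> _\<close>
          by (simp add: tri_nonneg mult.assoc)
        finally show ?thesis using True by simp
      qed (auto intro!: sum_nonneg mult_nonneg_nonneg tri_nonneg)
    qed (auto intro!: I sum_nonneg mult_nonneg_nonneg tri_nonneg)
    also have "\<dots> = (\<Sum>k\<in>{-N..N}. 2 * (LBINT t. tri \<eta> (t - k * \<eta> / 2) * (cmod (char M t))\<^sup>2))"
      using I by (subst Bochner_Integration.integral_sum) auto
    also have "\<dots> \<le> (\<Sum>k\<in>{-N..N}. 2 * (LBINT t. tri \<eta> t * (cmod (char M t))\<^sup>2))"
      by (intro sum_mono mult_left_mono integral_tri_shift_le M assms) auto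
    finally show ?thesis by simp
  qed
  show ?thesis
    by (rule that, rule le)
qed

section \<open>Fourier inversion for integrable characteristic functions\<close>

lemma integrable_indicator_Ioc: "integrable lborel (\<lambda>y. indicator {a<..b::real} y * (c::real))"
  by (cases "a \<le> b") auto

text \<open>Half-open intervals form a generator of the Borel sets that is stable under
  intersection, so both densities define one sigma-finite measure, and its density is unique almost
  everywhere.\<close>

lemma AE_eq_if_nn_integral_Ioc_eq:
  fixes p q :: "real \<Rightarrow> real"
  assumes [measurable]: "p \<in> borel_measurable borel" "q \<in> borel_measurable borel"
    and pos: "\<And>x. 0 \<le> p x" "\<And>x. 0 \<le> q x"
    and eq: "\<And>a b. a \<le> b \<Longrightarrow> (\<integral>\<^sup>+x\<in>{a<..b}. ennreal (p x) \<partial>lborel) = (\<integral>\<^sup>+x\<in>{a<..b}. ennreal (q x) \<partial>lborel)"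
    and fin: "\<And>a b. a \<le> b \<Longrightarrow> (\<integral>\<^sup>+x\<in>{a<..b}. ennreal (p x) \<partial>lborel) \<noteq> \<infinity>"
  shows "AE x in lborel. p x = q x"
proof -
  let ?E = "range (\<lambda>(a, b). {a<..b::real})"
  have "density lborel (\<lambda>x. ennreal (p x)) = density lborel (\<lambda>x. ennreal (q x))"
  proof (rule measure_eqI_generator_eq[where E="?E" and \<Omega>=UNIV and A="\<lambda>i. {- real i <.. real i}"])
    show "Int_stable ?E"
      by (auto simp: Int_stable_def)
    show "sets (density lborel (\<lambda>x. ennreal (p x))) = sigma_sets UNIV ?E"
      "sets (density lborel (\<lambda>x. ennreal (q x))) = sigma_sets UNIV ?E"
      by (simp_all add: borel_sigma_sets_Ioc)
    show "emeasure (density lborel (\<lambda>x. ennreal (p x))) X = emeasure (density lborel (\<lambda>x. ennreal (q x))) X"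
      if "X \<in> ?E" for X
    proof -
      from that obtain ab where "X = (case ab of (a, b) \<Rightarrow> {a<..b})" by (rule imageE)
      then have X: "X = {fst ab<..snd ab}" by (simp add: case_prod_beta)
      show ?thesis
        by (cases "fst ab \<le> snd ab") (auto simp: X emeasure_density eq)
    qed
    show "(\<Union>i. {- real i<..real i}) = UNIV"
    proof (intro set_eqI iffI UNIV_I)
      fix x :: real
      obtain n where "\<bar>x\<bar> < real n" using reals_Archimedean2 by blast
      then have "x \<in> {- real n<..real n}" by auto
      then show "x \<in> (\<Union>i. {- real i<..real i})" by blast
    qed
    show "emeasure (density lborel (\<lambda>x. ennreal (p x))) {- real i<..real i} \<noteq> \<infinity>" for i
      using fin[of "- real i" "real i"] by (simp add: emeasure_density)
  qed auto
  from sigma_finite_measure.density_unique[OF sigma_finite_lborel _ _ this] have "AE x in lborel. ennreal (p x) = ennreal (q x)"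
    by auto
  then show ?thesis
    using pos by (auto elim!: eventually_mono)
qed

text \<open>The factor in Levy's inversion formula is itself the integral \<open>K t\<close> of
  \<open>iexp (- (t * y))\<close> over the interval. As \<open>K\<close> is bounded by
  \<open>b - a\<close>, an integrable \<open>char M\<close> turns the limit of truncated integrals
  into one integral and justifies Fubini.\<close>

lemma fourier_inversion_Ioc:
  assumes "real_distribution M" and int: "integrable lborel (char M)"
    and atom: "measure M {a} = 0" "measure M {b} = 0" and ab: "a \<le> b"
  shows "complex_of_real (measure M {a<..b}) =
    (CLBINT y. indicator {a<..b} y * (1 / (2 * pi) * (CLBINT t. iexp (- (t * y)) * char M t)))"
proof -
  interpret M: real_distribution M by fact
  define K where "K = (\<lambda>t::real. CLBINT y. indicator {a<..b} y * iexp (- (t * y)))"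
  have K: "K t = (iexp (- (t * a)) - iexp (- (t * b))) / (\<i> * t)" if "t \<noteq> 0" for t
  proof -
    have 1: "((\<lambda>y. - iexp (- (t * y)) / (\<i> * t)) has_vector_derivative iexp (- (t * y))) (at y within {a..b})" for y
    proof -
      have *: "((\<lambda>y. iexp (y * (- t)) * (- 1 / (\<i> * t))) has_vector_derivative iexp (- (t * y))) (at y within {a..b})"
        by (rule has_vector_derivative_eq_rhs[OF has_vector_derivative_mult_left[OF has_vector_derivative_iexp_mult]])
           (use that in \<open>simp add: field_simps\<close>)
      from * show ?thesis
        by (simp add: mult.commute)
    qed
    have "(LBINT y. indicator {a..b} y *\<^sub>R iexp (- (t * y))) = - iexp (- (t * b)) / (\<i> * t) - (- iexp (- (t * a)) / (\<i> * t))"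
      by (rule integral_FTC_Icc[OF ab 1]) (auto intro!: continuous_intros)
    moreover have "K t = (LBINT y. indicator {a..b} y *\<^sub>R iexp (- (t * y)))"
      unfolding K_def
      by (rule integral_cong_AE) (use AE_lborel_singleton[of a] in \<open>auto simp: indicator_def scaleR_conv_of_real elim!: eventually_mono\<close>)
    ultimately show ?thesis by (simp add: diff_divide_distrib)
  qed
  have [measurable]: "K \<in> borel_measurable borel"
    unfolding K_def by measurable
  have [simp]: "cmod (indicator A x) = indicator A x" for A and x :: real
    by (simp add: indicator_def)
  have Kbd: "norm (K t) \<le> b - a" for t
  proof -
    have "norm (K t) \<le> (LBINT y. indicator {a<..b} y)"
      unfolding K_def by (rule order_trans[OF integral_norm_bound]) (simp add: norm_mult)
    then show ?thesis using ab by simp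
  qed
  have lim1: "(\<lambda>n. 1 / (2 * pi) * (CLBINT t=-real n..real n. (iexp (-(t * a)) - iexp (-(t * b))) / (\<i> * t) * char M t))
    \<longlonglongrightarrow> measure M {a<..b}"
    using M.Levy_Inversion[OF ab atom] by simp
  have "(\<lambda>n. CLBINT t. indicator {- real n<..<real n} t * (K t * char M t)) \<longlonglongrightarrow> (CLBINT t. K t * char M t)"
  proof (rule integral_dominated_convergence[where w="\<lambda>t. (b - a) * norm (char M t)"])
    show "AE t in lborel. (\<lambda>n. indicator {- real n<..<real n} t * (K t * char M t)) \<longlonglongrightarrow> K t * char M t"
    proof (intro AE_I2 tendsto_eventually)
      fix t :: real
      obtain n0 where n0: "\<bar>t\<bar> < real n0" using reals_Archimedean2 by blast
      show "\<forall>\<^sub>F n in sequentially. indicator {- real n<..<real n} t * (K t * char M t) = K t * char M t"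
        using eventually_ge_at_top[of n0] by eventually_elim (use n0 in \<open>auto simp: indicator_def\<close>)
    qed
    show "AE t in lborel. norm (indicator {- real n<..<real n} t * (K t * char M t)) \<le> (b - a) * norm (char M t)" for n
      using Kbd ab by (auto simp: norm_mult indicator_def intro!: mult_right_mono)
  qed (use int in auto)
  moreover have "(CLBINT t. indicator {- real n<..<real n} t * (K t * char M t)) =
     (CLBINT t=-real n..real n. (iexp (-(t * a)) - iexp (-(t * b))) / (\<i> * t) * char M t)" for n
  proof -
    have ae: "AE t in lborel. indicator {- real n<..<real n} t * (K t * char M t) =
       indicator {- real n<..<real n} t *\<^sub>R ((iexp (-(t * a)) - iexp (-(t * b))) / (\<i> * t) * char M t)"
      using AE_lborel_singleton[of 0] by eventually_elim (auto simp: K indicator_def)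
    show ?thesis
      unfolding interval_lebesgue_integral_def set_lebesgue_integral_def
      by (simp, rule integral_cong_AE) (use ae in auto)
  qed
  ultimately have "(\<lambda>n. 1 / (2 * pi) * (CLBINT t=-real n..real n. (iexp (-(t * a)) - iexp (-(t * b))) / (\<i> * t) * char M t))
    \<longlonglongrightarrow> 1 / (2 * pi) * (CLBINT t. K t * char M t)"
    by (intro tendsto_mult tendsto_const) simp
  from LIMSEQ_unique[OF lim1 this]
  have "complex_of_real (measure M {a<..b}) = 1 / (2 * pi) * (CLBINT t. K t * char M t)" .
  also have "(CLBINT t. K t * char M t) = (CLBINT t. (CLBINT y. indicator {a<..b} y * iexp (- (t * y)) * char M t))"
    unfolding K_def by simp
  also have "\<dots> = (CLBINT y. (CLBINT t. indicator {a<..b} y * iexp (- (t * y)) * char M t))"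
  proof (rule lborel_pair.Fubini_integral[symmetric], rule lborel_pair.Fubini_integrable)
    have "integrable lborel (\<lambda>y. indicator {a<..b} y * iexp (- (t * y)) * char M t)" for t
      by (rule Bochner_Integration.integrable_bound[OF integrable_indicator_Ioc[of a b "norm (char M t)"]])
         (auto simp: norm_mult)
    then show "AE t in lborel. integrable lborel (\<lambda>y. case (t, y) of (t, y) \<Rightarrow> indicator {a<..b} y * iexp (- (t * y)) * char M t)"
      by simp
  qed (use int in \<open>auto simp: norm_mult\<close>)
  finally show ?thesis
    by (simp add: mult.assoc mult.left_commute flip: integral_mult_right_zero)
qed

text \<open>Both sides are shifted by the constant \<open>B\<close> to make them nonnegative.\<close>

lemma AE_eq_fourier_inversion:
  fixes f :: "real \<Rightarrow> real"
  assumes [measurable]: "f \<in> borel_measurable borel" and pos: "\<And>x. 0 \<le> f x"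
    and M: "real_distribution (density lborel (\<lambda>x. ennreal (f x)))"
    and int: "integrable lborel (char (density lborel (\<lambda>x. ennreal (f x))))"
  shows "AE y in lborel. complex_of_real (f y) =
    1 / (2 * pi) * (CLBINT t. iexp (- (t * y)) * char (density lborel (\<lambda>x. ennreal (f x))) t)"
proof -
  define M where "M = density lborel (\<lambda>x. ennreal (f x))"
  interpret M: real_distribution M unfolding M_def by fact
  define G where "G = (\<lambda>y. 1 / (2 * pi) * (CLBINT t. iexp (- (t * y)) * char M t))"
  have [measurable]: "G \<in> borel_measurable borel"
    unfolding G_def by measurable
  define B where "B = 1 / (2 * pi) * (LBINT t. cmod (char M t))"
  have "norm (CLBINT t. iexp (- (t * y)) * char M t) \<le> (LBINT t. cmod (char M t))" for y
    by (rule order_trans[OF integral_norm_bound]) (simp add: norm_mult)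
  then have G_le: "norm (G y) \<le> B" for y
    by (simp add: G_def B_def norm_mult norm_divide divide_right_mono)
  have "B \<ge> 0" using order_trans[OF norm_ge_zero G_le] .
  have fint: "integrable lborel f"
  proof (rule integrableI_nonneg)
    have "(\<integral>\<^sup>+ x. ennreal (f x) \<partial>lborel) = emeasure M UNIV"
      by (simp add: M_def emeasure_density)
    also have "\<dots> = 1" using M.emeasure_space_1 by simp
    finally show "(\<integral>\<^sup>+ x. ennreal (f x) \<partial>lborel) < \<infinity>" by simp
  qed (use pos in auto)
  have "emeasure M {a} = 0" for a
    by (auto simp: M_def emeasure_density intro!: nn_integral_zero' AE_lborel_singleton[THEN eventually_mono])
  then have atom: "measure M {a} = 0" for a by (simp add: measure_def)
  have Iint: "integrable lborel (\<lambda>y. indicator {a<..b} y * B)" for a b :: real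
    by (rule integrable_indicator_Ioc)
  have bint: "integrable lborel (\<lambda>y. indicator {a<..b} y * (k y :: real))"
    if [measurable]: "k \<in> borel_measurable borel" and "\<And>y. \<bar>k y\<bar> \<le> B" for k and a b :: real
    by (rule Bochner_Integration.integrable_bound[OF Iint])
       (use that \<open>B \<ge> 0\<close> in \<open>auto simp: abs_mult indicator_def\<close>)
  have bintc: "integrable lborel (\<lambda>y. indicator {a<..b} y * G y)" for a b :: real
    by (rule Bochner_Integration.integrable_bound[OF Iint])
       (use G_le \<open>B \<ge> 0\<close> in \<open>auto simp: norm_mult indicator_def\<close>)
  have ReG: "\<bar>Re (G y)\<bar> \<le> B" and ImG: "\<bar>Im (G y)\<bar> \<le> B" for y
    using G_le[of y] abs_Re_le_cmod[of "G y"] abs_Im_le_cmod[of "G y"] by linarith+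
  have eq: "complex_of_real (measure M {a<..b}) = (CLBINT y. indicator {a<..b} y * G y)" if "a \<le> b" for a b
    using fourier_inversion_Ioc[OF M.real_distribution_axioms _ atom atom that] int
    by (simp add: G_def M_def)
  have re: "(LBINT y. indicator {a<..b} y * Re (G y)) = (LBINT y. indicator {a<..b} y * f y)"
    and im: "(LBINT y. indicator {a<..b} y * Im (G y)) = 0" if "a \<le> b" for a b
  proof -
    have Re_ind: "Re (indicator {a<..b} y * G y) = indicator {a<..b} y * Re (G y)"
      and Im_ind: "Im (indicator {a<..b} y * G y) = indicator {a<..b} y * Im (G y)" for y
      by (simp_all add: indicator_def)
    have "measure M {a<..b} = (LBINT y. indicator {a<..b} y * f y)"
      unfolding M_def measure_def using pos
      by (subst integral_eq_nn_integral) (auto simp: emeasure_density ennreal_mult' ennreal_indicator mult.commute)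
    also have "measure M {a<..b} = Re (CLBINT y. indicator {a<..b} y * G y)"
      using arg_cong[OF eq[OF that], of Re] by simp
    also have "\<dots> = (LBINT y. indicator {a<..b} y * Re (G y))"
      unfolding Re_ind[symmetric] by (rule integral_Re[OF bintc, symmetric])
    finally show "(LBINT y. indicator {a<..b} y * Re (G y)) = (LBINT y. indicator {a<..b} y * f y)" .
    have "0 = Im (CLBINT y. indicator {a<..b} y * G y)"
      using arg_cong[OF eq[OF that], of Im] by simp
    also have "\<dots> = (LBINT y. indicator {a<..b} y * Im (G y))"
      unfolding Im_ind[symmetric] by (rule integral_Im[OF bintc, symmetric])
    finally show "(LBINT y. indicator {a<..b} y * Im (G y)) = 0" ..
  qed
  have shift: "(\<integral>\<^sup>+y\<in>{a<..b}. ennreal (k y + B) \<partial>lborel) = ennreal ((LBINT y. indicator {a<..b} y * k y) + B * (b - a))"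
    if "integrable lborel (\<lambda>y. indicator {a<..b} y * k y)" "\<And>y. 0 \<le> k y + B" "a \<le> b" for k and a b :: real
  proof -
    have 1: "integrable lborel (\<lambda>y. indicator {a<..b} y * B)"
      by (rule integrable_indicator_Ioc)
    have "(\<integral>\<^sup>+y\<in>{a<..b}. ennreal (k y + B) \<partial>lborel) = (\<integral>\<^sup>+y. ennreal (indicator {a<..b} y * k y + indicator {a<..b} y * B) \<partial>lborel)"
      by (intro nn_integral_cong) (auto simp: indicator_def)
    also have "\<dots> = ennreal (LBINT y. indicator {a<..b} y * k y + indicator {a<..b} y * B)"
      by (intro nn_integral_eq_integral Bochner_Integration.integrable_add that 1 AE_I2) (use that in \<open>auto simp: indicator_def\<close>)
    also have "(LBINT y. indicator {a<..b} y * k y + indicator {a<..b} y * B) = (LBINT y. indicator {a<..b} y * k y) + B * (b - a)"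
      using that 1 by (subst Bochner_Integration.integral_add) auto
    finally show ?thesis .
  qed
  have fI: "integrable lborel (\<lambda>y. indicator {a<..b} y * f y)" for a b
    using integrable_real_mult_indicator[OF _ fint, of "{a<..b}"] by (simp add: mult.commute)
  have nonneg: "0 \<le> Re (G y) + B" "0 \<le> Im (G y) + B" for y
    using ReG[of y] ImG[of y] by linarith+
  have "AE y in lborel. Re (G y) + B = f y + B"
    by (rule AE_eq_if_nn_integral_Ioc_eq)
       (use pos \<open>B \<ge> 0\<close> nonneg in \<open>auto simp: shift bint fI ReG re simp del: ennreal_plus\<close>)
  moreover have "AE y in lborel. Im (G y) + B = 0 + B"
    by (rule AE_eq_if_nn_integral_Ioc_eq)
       (use \<open>B \<ge> 0\<close> nonneg shift[of _ _ "\<lambda>_. 0"] in \<open>auto simp: shift bint ImG im simp del: ennreal_plus\<close>)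
  ultimately have "AE y in lborel. complex_of_real (f y) = G y"
    by eventually_elim (simp add: complex_eq_iff)
  then show ?thesis
    by (simp add: G_def M_def)
qed

section \<open>Regularly varying tails\<close>

text \<open>Of two summands with sum above \<open>x\<close> at least one exceeds \<open>x/2\<close>.
  Given its value, the other summand must lie in an interval of length \<open>h\<close>, which has
  mass at most \<open>q\<close>.\<close>

lemma measure_convolution_Ioc_le:
  assumes "real_distribution M" "real_distribution N" and h: "h \<ge> 0"
    and q: "\<And>z. measure M {z<..z+h} \<le> q" "\<And>z. measure N {z<..z+h} \<le> q"
  shows "measure (M \<star> N) {x<..x+h} \<le> q * (measure M {x/2<..} + measure N {x/2<..})"
proof -
  interpret M: real_distribution M by fact
  interpret N: real_distribution N by fact
  interpret P: pair_sigma_finite M N ..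
  interpret C: real_distribution "M \<star> N" by (intro real_distribution_convolution assms)
  have q0: "q \<ge> 0" using order_trans[OF measure_nonneg q(1)] .
  let ?A = "{x<..x+h}"
  have meas: "(\<lambda>(y, z). indicator {x/2<..} y * indicator ?A (y + z) :: ennreal) \<in> borel_measurable (M \<Otimes>\<^sub>M N)"
    "(\<lambda>(y, z). indicator {x/2<..} z * indicator ?A (y + z) :: ennreal) \<in> borel_measurable (M \<Otimes>\<^sub>M N)"
    by measurable
  have N_int: "(\<integral>\<^sup>+z. indicator ?A (y + z) \<partial>N) \<le> ennreal q" for y
  proof -
    have "(\<integral>\<^sup>+z. indicator ?A (y + z) \<partial>N) = (\<integral>\<^sup>+z. indicator {x - y<..(x - y) + h} z \<partial>N)"
      by (intro nn_integral_cong) (auto simp: indicator_def)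
    also have "\<dots> \<le> ennreal q"
      using q(2)[of "x - y"] by (simp add: N.emeasure_eq_measure ennreal_leI)
    finally show ?thesis .
  qed
  have M_int: "(\<integral>\<^sup>+y. indicator ?A (y + z) \<partial>M) \<le> ennreal q" for z
  proof -
    have "(\<integral>\<^sup>+y. indicator ?A (y + z) \<partial>M) = (\<integral>\<^sup>+y. indicator {x - z<..(x - z) + h} y \<partial>M)"
      by (intro nn_integral_cong) (auto simp: indicator_def)
    also have "\<dots> \<le> ennreal q"
      using q(1)[of "x - z"] by (simp add: M.emeasure_eq_measure ennreal_leI)
    finally show ?thesis .
  qed
  have "emeasure (M \<star> N) ?A = (\<integral>\<^sup>+y. \<integral>\<^sup>+z. indicator ?A (y + z) \<partial>N \<partial>M)"
    by (rule convolution_emeasure') (auto intro: M.finite_measure_axioms N.finite_measure_axioms)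
  also have "\<dots> \<le> (\<integral>\<^sup>+y. \<integral>\<^sup>+z. indicator {x/2<..} y * indicator ?A (y + z) +
      indicator {x/2<..} z * indicator ?A (y + z) \<partial>N \<partial>M)"
    by (intro nn_integral_mono) (auto simp: indicator_def)
  also have "\<dots> = (\<integral>\<^sup>+y. \<integral>\<^sup>+z. indicator {x/2<..} y * indicator ?A (y + z) \<partial>N \<partial>M) +
      (\<integral>\<^sup>+y. \<integral>\<^sup>+z. indicator {x/2<..} z * indicator ?A (y + z) \<partial>N \<partial>M)"
    by (simp add: nn_integral_add)
  also have "(\<integral>\<^sup>+y. \<integral>\<^sup>+z. indicator {x/2<..} z * indicator ?A (y + z) \<partial>N \<partial>M) =
      (\<integral>\<^sup>+z. \<integral>\<^sup>+y. indicator {x/2<..} z * indicator ?A (y + z) \<partial>M \<partial>N)"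
    using P.Fubini'[OF meas(2)] by simp
  also have "\<dots> = (\<integral>\<^sup>+z. indicator {x/2<..} z * (\<integral>\<^sup>+y. indicator ?A (y + z) \<partial>M) \<partial>N)"
    by (intro nn_integral_cong nn_integral_cmult) measurable
  also have "\<dots> \<le> (\<integral>\<^sup>+z. indicator {x/2<..} z * ennreal q \<partial>N)"
    by (intro nn_integral_mono mult_left_mono M_int) auto
  also have "\<dots> = ennreal (q * measure N {x/2<..})"
    using q0 by (simp add: nn_integral_cmult_indicator N.emeasure_eq_measure ennreal_mult mult.commute)
  also have "(\<integral>\<^sup>+y. \<integral>\<^sup>+z. indicator {x/2<..} y * indicator ?A (y + z) \<partial>N \<partial>M) =
      (\<integral>\<^sup>+y. indicator {x/2<..} y * (\<integral>\<^sup>+z. indicator ?A (y + z) \<partial>N) \<partial>M)"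
    by (intro nn_integral_cong nn_integral_cmult) measurable
  also have "\<dots> \<le> (\<integral>\<^sup>+y. indicator {x/2<..} y * ennreal q \<partial>M)"
    by (intro nn_integral_mono mult_left_mono N_int) auto
  also have "\<dots> = ennreal (q * measure M {x/2<..})"
    using q0 by (simp add: nn_integral_cmult_indicator M.emeasure_eq_measure ennreal_mult mult.commute)
  finally show ?thesis
    using q0 by (simp add: C.emeasure_eq_measure ring_distribs flip: ennreal_plus)
qed

text \<open>The right tail condition expressed by \<open>F\<close> alone, with no auxiliary
  function: \<open>Fbar F\<close> is monotone automatically, and monotonicity does the work of
  uniform convergence below.\<close>

locale heavy_tail = real_distribution F for F :: "real measure" +
  fixes \<alpha> :: real
  assumes \<alpha>: "1/2 < \<alpha>" "\<alpha> < 1"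
    and Fbar_pos: "\<And>x. 0 < Fbar F x"
    and Fbar_ratio: "\<And>c. 0 < c \<Longrightarrow> ((\<lambda>x. Fbar F (c * x) / Fbar F x) \<longlongrightarrow> c powr -\<alpha>) at_top"
begin

text \<open>A monotone substitute for \<open>r\<close>, to which it is asymptotically equivalent in
  the application.\<close>

definition A :: "real \<Rightarrow> real" where "A x = 1 / Fbar F x"

lemma Fbar_eq: "Fbar F x = prob {x<..}"
proof -
  have "prob (space F - {..x}) = 1 - prob {..x}"
    by (rule prob_compl) simp
  moreover have "space F - {..x} = {x<..}" by auto
  ultimately show ?thesis by (simp add: Fbar_def)
qed

lemma Fbar_mono: "x \<le> y \<Longrightarrow> Fbar F y \<le> Fbar F x"
  unfolding Fbar_eq by (intro finite_measure_mono) auto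

lemma Fbar_le_1: "Fbar F x \<le> 1"
  unfolding Fbar_eq by simp

lemma A_pos: "0 < A x"
  using Fbar_pos by (simp add: A_def)

lemma A_mono: "x \<le> y \<Longrightarrow> A x \<le> A y"
  using Fbar_pos Fbar_mono by (auto simp: A_def intro!: divide_left_mono)

lemma A_less_imp: "A x < A y \<Longrightarrow> x < y"
  using A_mono[of y x] by linarith

lemma A_at_top: "filterlim A at_top at_top"
proof -
  have "((\<lambda>x. 1 - cdf F x) \<longlongrightarrow> 1 - 1) at_top"
    by (intro tendsto_intros cdf_lim_at_top_prob)
  then have "(Fbar F \<longlongrightarrow> 0) at_top"
    by (simp add: Fbar_def[abs_def] cdf_def)
  then have "filterlim (\<lambda>x. inverse (Fbar F x)) at_top at_top"
    by (intro filterlim_inverse_at_top) (simp_all add: Fbar_pos)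
  then show ?thesis by (simp add: A_def[abs_def] inverse_eq_divide)
qed

lemma A_ratio: "0 < c \<Longrightarrow> ((\<lambda>x. A (c * x) / A x) \<longlongrightarrow> c powr \<alpha>) at_top"
  using tendsto_inverse[OF Fbar_ratio[of c]] by (simp add: A_def powr_minus)

text \<open>By monotonicity \<open>A (b * x) < A y\<close> forces \<open>b * x < y\<close>. Hence
  the limits of \<open>A (b * x) / A x\<close> for fixed \<open>b\<close> suffice to locate
  \<open>y / x\<close>.\<close>

lemma ratio_inverse:
  assumes x: "filterlim x at_top G" and lim: "((\<lambda>i. A (y i) / A (x i)) \<longlongrightarrow> \<rho>) G" and \<rho>: "0 < \<rho>"
  shows "((\<lambda>i. y i / x i) \<longlongrightarrow> \<rho> powr (1 / \<alpha>)) G"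
proof (rule order_tendstoI)
  define L where "L = \<rho> powr (1 / \<alpha>)"
  have L: "0 < L" "L powr \<alpha> = \<rho>"
    using \<rho> \<alpha> by (simp_all add: L_def powr_powr)
  have ratio: "((\<lambda>i. A (c * x i) / A (x i)) \<longlongrightarrow> c powr \<alpha>) G" if "0 < c" for c
    by (rule filterlim_compose[OF A_ratio[OF that] x])
  have xpos: "\<forall>\<^sub>F i in G. 0 < x i"
    using x by (auto simp: filterlim_at_top_dense)
  fix a assume "a < \<rho> powr (1 / \<alpha>)"
  \<comment> \<open>Since \<open>a\<close> may be negative, it is raised to a positive number that
    is still below \<open>L\<close>.\<close>
  define b where "b = max a (L / 2)"
  have b: "0 < b" "b < L" "a \<le> b" using L \<open>a < _\<close> by (auto simp: b_def L_def[symmetric])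
  have "b powr \<alpha> < \<rho>"
    using powr_less_mono2[of \<alpha> b L] b L \<alpha> by simp
  then obtain m where m: "b powr \<alpha> < m" "m < \<rho>" using dense by blast
  from order_tendstoD(2)[OF ratio[OF b(1)] m(1)] order_tendstoD(1)[OF lim m(2)] xpos
  show "\<forall>\<^sub>F i in G. a < y i / x i"
  proof eventually_elim
    case (elim i)
    then have "A (b * x i) < A (y i)"
      using A_pos[of "x i"] by (smt (verit) divide_right_mono)
    then show ?case using A_less_imp[of "b * x i" "y i"] elim(3) b(3)
      by (smt (verit) pos_less_divide_eq)
  qed
next
  define L where "L = \<rho> powr (1 / \<alpha>)"
  have L: "0 < L" "L powr \<alpha> = \<rho>"
    using \<rho> \<alpha> by (simp_all add: L_def powr_powr)
  have xpos: "\<forall>\<^sub>F i in G. 0 < x i"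
    using x by (auto simp: filterlim_at_top_dense)
  fix a assume "\<rho> powr (1 / \<alpha>) < a"
  then have "L < a" by (simp add: L_def)
  with L have a: "L < a" "0 < a" by linarith+
  have "\<rho> < a powr \<alpha>"
    using powr_less_mono2[of \<alpha> L a] a L \<alpha> by simp
  then obtain m where m: "m < a powr \<alpha>" "\<rho> < m" using dense by blast
  from order_tendstoD(1)[OF filterlim_compose[OF A_ratio[OF a(2)] x] m(1)] order_tendstoD(2)[OF lim m(2)] xpos
  show "\<forall>\<^sub>F i in G. y i / x i < a"
  proof eventually_elim
    case (elim i)
    then have "A (y i) < A (a * x i)"
      using A_pos[of "x i"] by (smt (verit) divide_right_mono)
    then show ?case using A_less_imp[of "y i" "a * x i"] elim(3)
      by (simp add: pos_divide_less_eq)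
  qed
qed

text \<open>A Potter bound with the exponent 1/2, which is below \<alpha>. As
  \<open>4 powr \<alpha>\<close> exceeds 2, passing from \<open>x\<close> to \<open>4 * x\<close>
  eventually at least doubles \<open>A\<close>, which is what the square root does. The factor 2 on
  the right pays for a remaining ratio below 4.\<close>

lemma A_sqrt_growth:
  obtains x0 where "x0 > 0" "\<And>x y. x0 \<le> x \<Longrightarrow> x \<le> y \<Longrightarrow> sqrt (y / x) * A x \<le> 2 * A y"
proof -
  have "2 < (4::real) powr \<alpha>"
    using powr_less_mono[of "1/2" \<alpha> 4] \<alpha> by (simp add: powr_half_sqrt)
  from order_tendstoD(1)[OF A_ratio[of 4] this]
  obtain x1 where x1: "\<And>x. x1 \<le> x \<Longrightarrow> 2 < A (4 * x) / A x"
    by (auto simp: eventually_at_top_linorder)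
  define x0 where "x0 = max x1 1"
  have 4: "2 * A x \<le> A (4 * x)" if "x0 \<le> x" for x
    using x1[of x] that A_pos[of x] by (simp add: x0_def field_simps)
  have "sqrt (y / x) * A x \<le> 2 * A y" if "x0 \<le> x" "x \<le> y" "y < 4 ^ k * x" for k x y
    using that
  proof (induction k arbitrary: y)
    case (Suc k)
    have x: "x > 0" using Suc.prems by (simp add: x0_def)
    show ?case
    proof (cases "y < 4 * x")
      case True
      have "sqrt (y / x) \<le> sqrt 4"
        using True x by (intro real_sqrt_le_mono) (simp add: field_simps)
      then have "sqrt (y / x) * A x \<le> 2 * A x"
        using A_pos[of x] by (intro mult_right_mono) auto
      with A_mono[OF Suc.prems(2)] show ?thesis by linarith
    next
      case False
      have "sqrt (y / 4 / x) * A x \<le> 2 * A (y / 4)"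
        using False Suc.prems by (intro Suc.IH) auto
      moreover have "sqrt (y / 4 / x) = sqrt (y / x) / 2"
        by (simp add: real_sqrt_divide real_sqrt_mult)
      moreover have "2 * A (y / 4) \<le> A y"
        using 4[of "y / 4"] False Suc.prems by simp
      ultimately have "sqrt (y / x) / 2 * A x \<le> A y" by (metis order_trans)
      then show ?thesis by simp
    qed
  qed auto
  moreover have "\<exists>k. y < 4 ^ k * x" if "x > 0" for x y :: real
    using real_arch_pow[of 4 "y / x"] that by (auto simp: field_simps)
  ultimately have "sqrt (y / x) * A x \<le> 2 * A y" if "x0 \<le> x" "x \<le> y" for x y
    using that by (metis x0_def less_le_trans max.cobounded2 zero_less_one)
  moreover have "x0 > 0" by (simp add: x0_def)
  ultimately show ?thesis using that by blast
qed

section \<open>Truncated means and the tail of the walk\<close>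

definition trunc_mean :: "real \<Rightarrow> ennreal" where
  "trunc_mean x = (\<integral>\<^sup>+y. ennreal (min (max y 0) x) \<partial>F)"

lemma trunc_mean_le: "0 \<le> x \<Longrightarrow> trunc_mean x \<le> ennreal x"
proof -
  assume "0 \<le> x"
  have "trunc_mean x \<le> (\<integral>\<^sup>+y. ennreal x \<partial>F)"
    unfolding trunc_mean_def by (intro nn_integral_mono ennreal_leI) auto
  then show ?thesis using emeasure_space_1 by simp
qed

lemma trunc_mean_double:
  assumes "0 \<le> x"
  shows "trunc_mean (2 * x) \<le> trunc_mean x + ennreal (x * Fbar F x)"
proof -
  have "trunc_mean (2 * x) \<le> (\<integral>\<^sup>+y. ennreal (min (max y 0) x) + ennreal x * indicator {x<..} y \<partial>F)"
    unfolding trunc_mean_def using assms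
    by (intro nn_integral_mono) (auto simp: indicator_def min_def max_def ennreal_leI simp flip: ennreal_plus)
  also have "\<dots> = trunc_mean x + ennreal x * ennreal (Fbar F x)"
    by (simp add: nn_integral_add trunc_mean_def nn_integral_cmult emeasure_eq_measure Fbar_eq)
  finally show ?thesis using assms Fbar_pos[of x] by (simp add: ennreal_mult)
qed

text \<open>The upper half of Karamata's theorem. Doubling \<open>x\<close> adds at most
  \<open>x * Fbar F x\<close> to the mean, while the target \<open>x * Fbar F x\<close> itself grows
  by a factor close to \<open>2 powr (1 - \<alpha>)\<close>, which exceeds 1 because \<alpha> < 1;
  so the induction over doublings closes.\<close>

lemma trunc_mean_bound:
  obtains C x0 where "C > 0" "x0 > 0" "\<And>x. x0 \<le> x \<Longrightarrow> trunc_mean x \<le> ennreal (C * (x * Fbar F x))"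
proof -
  \<comment> \<open>The midpoint between \<open>2 powr \<alpha>\<close> and 2, which leaves room on
    both sides.\<close>
  define \<kappa> where "\<kappa> = (2 powr \<alpha> + 2) / 2"
  have "2 powr \<alpha> < (2::real)"
    using powr_less_mono[of \<alpha> 1 2] \<alpha> by simp
  then have \<kappa>: "2 powr \<alpha> < \<kappa>" "\<kappa> < 2" "\<kappa> > 0" by (auto simp: \<kappa>_def intro: add_pos_pos)
  have "((\<lambda>x. Fbar F x / Fbar F (2 * x)) \<longlongrightarrow> 2 powr \<alpha>) at_top"
    using A_ratio[of 2] by (simp add: A_def)
  from order_tendstoD(2)[OF this \<kappa>(1)]
  obtain x1 where x1: "\<And>x. x1 \<le> x \<Longrightarrow> Fbar F x / Fbar F (2 * x) < \<kappa>"
    by (auto simp: eventually_at_top_linorder)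
  define x0 where "x0 = max x1 1"
  have dbl: "Fbar F x \<le> \<kappa> * Fbar F (2 * x)" if "x0 \<le> x" for x
    using x1[of x] that Fbar_pos[of "2 * x"] by (simp add: x0_def field_simps)
  \<comment> \<open>The first entry covers the initial range below \<open>2 * x0\<close>; the second
    is the value for which \<open>(C + 1) * \<kappa> \<le> 2 * C\<close>, as the doubling step
    requires.\<close>
  define C where "C = max (2 / Fbar F (2 * x0)) (\<kappa> / (2 - \<kappa>))"
  have C: "2 / Fbar F (2 * x0) \<le> C" "\<kappa> / (2 - \<kappa>) \<le> C" by (auto simp: C_def)
  have Cpos: "C > 0" using \<kappa> C(2) by (smt (verit) divide_pos_pos)
  have C2: "(C + 1) * \<kappa> \<le> 2 * C"
    using C(2) \<kappa> by (simp add: field_simps)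
  have "trunc_mean x \<le> ennreal (C * (x * Fbar F x))" if "x0 \<le> x" "x < 2 ^ k * x0" for k x
    using that
  proof (induction k arbitrary: x)
    case (Suc k)
    have x: "x > 0" "x0 > 0" using Suc.prems by (simp_all add: x0_def)
    show ?case
    proof (cases "x < 2 * x0")
      case True
      have "x \<le> 2 * x0 * 1" using True by simp
      also have "\<dots> \<le> 2 * x * 1" using Suc.prems by simp
      also have "\<dots> = (2 / Fbar F (2 * x0)) * (x * Fbar F (2 * x0))"
        using Fbar_pos[of "2 * x0"] by simp
      also have "\<dots> \<le> C * (x * Fbar F x)"
        using True x C Cpos Fbar_pos[of "2 * x0"] by (intro mult_mono Fbar_mono) auto
        finally have "x \<le> C * (x * Fbar F x)" .
        from ennreal_leI[OF this] show ?thesis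
          by (rule order_trans[OF trunc_mean_le, rotated]) (use x in simp)
    next
      case False
      let ?z = "x / 2"
      have z: "x0 \<le> ?z" "?z < 2 ^ k * x0" using False Suc.prems by auto
      have "trunc_mean x \<le> trunc_mean ?z + ennreal (?z * Fbar F ?z)"
        using trunc_mean_double[of ?z] x by simp
      also have "\<dots> \<le> ennreal (C * (?z * Fbar F ?z)) + ennreal (?z * Fbar F ?z)"
        by (intro add_right_mono Suc.IH z)
      also have "\<dots> = ennreal ((C + 1) * (?z * Fbar F ?z))"
        using Cpos x Fbar_pos[of ?z] by (simp add: ring_distribs flip: ennreal_plus)
      also have "\<dots> \<le> ennreal (C * (x * Fbar F x))"
      proof (rule ennreal_leI)
        have "(C + 1) * (?z * Fbar F ?z) \<le> (C + 1) * (?z * (\<kappa> * Fbar F x))"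
          using dbl[OF z(1)] x Cpos by (intro mult_left_mono) auto
        also have "\<dots> = ((C + 1) * \<kappa>) * (?z * Fbar F x)" by simp
        also have "\<dots> \<le> (2 * C) * (?z * Fbar F x)"
          using C2 x Fbar_pos[of x] by (intro mult_right_mono) auto
        finally show "(C + 1) * (?z * Fbar F ?z) \<le> C * (x * Fbar F x)" by simp
      qed
      finally show ?thesis .
    qed
  qed auto
  moreover have "x0 > 0" by (simp add: x0_def)
  moreover have "\<exists>k. x < 2 ^ k * x0" for x
    using real_arch_pow[of 2 "x / x0"] \<open>x0 > 0\<close> by (auto simp: field_simps)
  ultimately show ?thesis using that[of C x0] Cpos by metis
qed

lemma real_distribution_walk: "real_distribution (conv_pow F n)"
  by (rule real_distribution_conv_pow) (rule real_distribution_axioms)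

lemma char_walk: "char (conv_pow F n) t = char F t ^ n"
  by (rule char_conv_pow) (rule real_distribution_axioms)

text \<open>The map from \<open>y\<close> to \<open>min (max y 0) x\<close> is subadditive. This is
  the reason to truncate by \<open>min\<close> instead of discarding the values above
  \<open>x\<close>.\<close>

lemma conv_pow_trunc_mean:
  assumes "0 \<le> x"
  shows "(\<integral>\<^sup>+y. ennreal (min (max y 0) x) \<partial>conv_pow F n) \<le> of_nat n * trunc_mean x"
proof (induction n)
  case 0
  show ?case using assms by (simp add: nn_integral_return)
next
  case (Suc n)
  interpret N: real_distribution "conv_pow F n"
    by (rule real_distribution_walk)
  have "(\<integral>\<^sup>+y. ennreal (min (max y 0) x) \<partial>conv_pow F (Suc n)) =
     (\<integral>\<^sup>+y. \<integral>\<^sup>+z. ennreal (min (max (y + z) 0) x) \<partial>conv_pow F n \<partial>F)"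
    by (simp add: nn_integral_convolution finite_measure_axioms N.finite_measure_axioms)
  also have "\<dots> \<le> (\<integral>\<^sup>+y. \<integral>\<^sup>+z. ennreal (min (max y 0) x) + ennreal (min (max z 0) x) \<partial>conv_pow F n \<partial>F)"
    using assms by (intro nn_integral_mono) (auto simp: min_def max_def simp flip: ennreal_plus intro!: ennreal_leI)
  also have "\<dots> = (\<integral>\<^sup>+y. ennreal (min (max y 0) x) + (\<integral>\<^sup>+z. ennreal (min (max z 0) x) \<partial>conv_pow F n) \<partial>F)"
    using N.emeasure_space_1 by (simp add: nn_integral_add)
  also have "\<dots> = trunc_mean x + (\<integral>\<^sup>+z. ennreal (min (max z 0) x) \<partial>conv_pow F n)"
    using emeasure_space_1 by (simp add: nn_integral_add trunc_mean_def)
  also have "\<dots> \<le> trunc_mean x + of_nat n * trunc_mean x"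
    by (intro add_left_mono Suc.IH)
  finally show ?case by (simp add: ring_distribs)
qed

text \<open>Markov's inequality for the truncated positive part. The order
  \<open>n * Fbar F x\<close> is that of a single large jump, and the constant is uniform in
  \<open>n\<close>.\<close>

lemma conv_pow_tail_bound:
  obtains C x0 where "C > 0" "x0 > 0"
    "\<And>n x. x0 \<le> x \<Longrightarrow> measure (conv_pow F n) {x<..} \<le> C * n * Fbar F x"
proof -
  obtain C x0 where C: "C > 0" "x0 > 0" "\<And>x. x0 \<le> x \<Longrightarrow> trunc_mean x \<le> ennreal (C * (x * Fbar F x))"
    by (rule trunc_mean_bound) blast
  have "measure (conv_pow F n) {x<..} \<le> C * n * Fbar F x" if "x0 \<le> x" for n x
  proof -
    interpret N: real_distribution "conv_pow F n"
      by (rule real_distribution_walk)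
    have x: "x > 0" using that C by linarith
    have "ennreal (x * measure (conv_pow F n) {x<..}) = (\<integral>\<^sup>+y. ennreal x * indicator {x<..} y \<partial>conv_pow F n)"
      using x by (simp add: nn_integral_cmult N.emeasure_eq_measure ennreal_mult)
    also have "\<dots> \<le> (\<integral>\<^sup>+y. ennreal (min (max y 0) x) \<partial>conv_pow F n)"
      using x by (intro nn_integral_mono) (auto simp: indicator_def)
    also have "\<dots> \<le> of_nat n * trunc_mean x"
      using x by (intro conv_pow_trunc_mean) auto
    also have "\<dots> \<le> of_nat n * ennreal (C * (x * Fbar F x))"
      by (intro mult_left_mono C that) auto
    also have "\<dots> = ennreal (x * (C * n * Fbar F x))"
      using C x Fbar_pos[of x] by (simp add: ennreal_of_nat_eq_real_of_nat mult_ac flip: ennreal_mult)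
    finally show ?thesis
      using x C Fbar_pos[of x] by (simp add: ennreal_le_iff)
  qed
  then show ?thesis using that C by blast
qed

end

section \<open>Decay of the characteristic function\<close>

lemma integrable_inverse_1_plus_sq: "integrable lborel (\<lambda>s::real. 1 / (1 + s\<^sup>2))"
  using integrable_inverse_1_plus_square
  by (simp add: set_integrable_def einterval_def inverse_eq_divide)

lemma eventually_le_imp_all_le:
  fixes f g :: "nat \<Rightarrow> real"
  assumes "\<forall>\<^sub>F n in sequentially. f n \<le> C * g n" and "\<And>n. 0 < g n"
  obtains C' where "0 < C'" "\<And>n. f n \<le> C' * g n"
proof -
  obtain N where N: "\<And>n. N \<le> n \<Longrightarrow> f n \<le> C * g n"
    using assms(1) by (auto simp: eventually_sequentially)
  define C' where "C' = Max (insert \<bar>C\<bar> (insert 1 ((\<lambda>n. f n / g n) ` {..<N})))"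
  have C': "\<bar>C\<bar> \<le> C'" "1 \<le> C'" "\<And>n. n < N \<Longrightarrow> f n / g n \<le> C'"
    unfolding C'_def by (intro Max_ge; auto)+
  have "f n \<le> C' * g n" for n
  proof (cases "n < N")
    case True
    then show ?thesis using C'(3)[of n] assms(2)[of n] by (simp add: field_simps)
  next
    case False
    have "C * g n \<le> C' * g n"
      using C'(1) assms(2)[of n] by (intro mult_right_mono) auto
    with N[of n] False show ?thesis by linarith
  qed
  with C'(2) show ?thesis by (intro that[of C']) auto
qed

text \<open>One term of the exponential series. The fourth is taken because the argument will be a
  multiple of \<open>sqrt \<bar>s\<bar>\<close>, and the bound has to decay like
  \<open>1 / s^2\<close>.\<close>

lemma exp_minus_le:
  fixes u :: real
  assumes "0 < u"
  shows "exp (- u) \<le> 24 / u ^ 4"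
proof -
  have "u ^ 4 / fact 4 \<le> (\<Sum>n. u ^ n /\<^sub>R fact n)"
    using sum_le_suminf[OF summable_exp_generic[of u], of "{4}"] assms by (simp add: divide_inverse mult.commute)
  then have "u ^ 4 / 24 \<le> exp u"
    by (simp add: exp_def fact_numeral)
  then show ?thesis
    using assms by (simp add: exp_minus field_simps)
qed

text \<open>In this range \<open>v\<close> keeps distance 1/4 from every multiple of
  \<open>2 * pi\<close>; 1/64 is the value of \<open>u^2 / 4\<close> at
  \<open>u = 1/4\<close>.\<close>

lemma one_minus_cos_ge':
  fixes v :: real
  assumes "1/4 \<le> \<bar>v\<bar>" "\<bar>v\<bar> \<le> 2 * pi - 1/4"
  shows "1/64 \<le> 1 - cos v"
proof -
  have "cos v \<le> cos (1/4)"
  proof (cases "\<bar>v\<bar> \<le> pi")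
    case True
    then have "cos \<bar>v\<bar> \<le> cos (1/4)"
      using assms by (intro cos_monotone_0_pi_le) auto
    then show ?thesis by simp
  next
    case False
    then have "cos (2 * pi - \<bar>v\<bar>) \<le> cos (1/4)"
      using assms by (intro cos_monotone_0_pi_le) auto
    moreover have "cos (2 * pi - \<bar>v\<bar>) = cos v"
      by (simp add: cos_diff)
    ultimately show ?thesis by simp
  qed
  then show ?thesis
    using one_minus_cos_ge[of "1/4"] by (simp add: power2_eq_square)
qed

context heavy_tail
begin

text \<open>Write \<open>\<phi> t = \<bar>\<phi> t\<bar> * exp (\<i> \<theta>)\<close>, so that \<open>1 - \<bar>\<phi> t\<bar> = E (1 - cos (t X - \<theta>))\<close>. If \<open>\<theta>\<close> is close to \<open>0\<close>, the
  event \<open>1 < t X \<le> 2\<close> keeps \<open>t X\<close> away from \<open>\<theta>\<close>, otherwise the event \<open>\<bar>t X\<bar> \<le> 1/4\<close> does.\<close>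

lemma char_decay:
  obtains c \<eta> where "c > 0" "\<eta> > 0"
    "\<And>t. t \<noteq> 0 \<Longrightarrow> \<bar>t\<bar> \<le> \<eta> \<Longrightarrow> cmod (char F t) \<le> exp (- (c * Fbar F (1 / \<bar>t\<bar>)))"
proof -
  \<comment> \<open>Asymptotically the fraction \<open>1 - 2 powr - \<alpha>\<close> of the mass
    beyond \<open>x\<close> lies in \<open>(x, 2 * x]\<close>; half of it is kept.\<close>
  define c0 where "c0 = (1 - 2 powr - \<alpha>) / 2"
  have "2 powr - \<alpha> < (1::real)"
    using \<alpha> by (simp add: powr_less_one)
  then have c0: "0 < c0" "2 powr - \<alpha> < 1 - c0"
    by (auto simp: c0_def field_simps)
  obtain x1 where x1: "\<And>x. x1 \<le> x \<Longrightarrow> Fbar F (2 * x) / Fbar F x < 1 - c0"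
    using order_tendstoD(2)[OF Fbar_ratio[of 2] c0(2)] by (auto simp: eventually_at_top_linorder)
  have "((\<lambda>x. cdf F x - cdf F (- x)) \<longlongrightarrow> 1 - 0) at_top"
    by (intro tendsto_diff cdf_lim_at_top_prob filterlim_compose[OF cdf_lim_at_bot filterlim_uminus_at_bot_at_top])
  then have "\<forall>\<^sub>F x in at_top. 1 / 2 < cdf F x - cdf F (- x)"
    by (intro order_tendstoD(1)) auto
  then obtain x2 where x2: "\<And>x. x2 \<le> x \<Longrightarrow> 1 / 2 < cdf F x - cdf F (- x)"
    by (auto simp: eventually_at_top_linorder)
  \<comment> \<open>The factor 4 is due to the event \<bar>t X\<bar> \<le> 1/4, which concerns the
    radius \<open>1 / (4 * t)\<close>.\<close>
  define x0 where "x0 = max (max x1 (4 * x2)) 1"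
  define c where "c = min c0 (1/2) / 64"
  have c: "c > 0" "64 * c \<le> c0" "64 * c \<le> 1/2" using c0 by (auto simp: c_def)
  have pos: "cmod (char F t) \<le> 1 - c * Fbar F (1 / t)" if t: "0 < t" "t \<le> 1 / x0" for t
  proof -
    have "x0 > 0" by (simp add: x0_def)
    then have tx: "x0 \<le> 1 / t" using t by (simp add: field_simps)
    define \<theta> where "\<theta> = Arg (char F t)"
    have \<theta>: "- pi < \<theta>" "\<theta> \<le> pi" using Arg_bounded by (auto simp: \<theta>_def)
    have int: "integrable F (\<lambda>x. iexp (t * x - \<theta>))"
      by (intro integrable_const_bound[of _ 1]) auto
    have "complex_of_real (cmod (char F t)) = cis (- \<theta>) * char F t"
      by (subst (2) rcis_cmod_Arg[symmetric]) (simp add: rcis_def \<theta>_def cis_mult)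
    also have "\<dots> = (CLINT x|F. cis (- \<theta>) * iexp (t * x))"
      by (simp add: char_def)
    also have "\<dots> = (CLINT x|F. iexp (t * x - \<theta>))"
      by (intro Bochner_Integration.integral_cong refl) (simp add: cis_conv_exp exp_add[symmetric] algebra_simps)
    finally have "cmod (char F t) = Re (CLINT x|F. iexp (t * x - \<theta>))"
      by (metis Re_complex_of_real)
    also have "\<dots> = (\<integral>x. cos (t * x - \<theta>) \<partial>F)"
      by (subst integral_Re[OF int, symmetric]) (simp add: Re_exp del: of_real_diff of_real_mult)
    finally have *: "1 - cmod (char F t) = (\<integral>x. 1 - cos (t * x - \<theta>) \<partial>F)"
      using integrable_const_bound[of "\<lambda>x. cos (t * x - \<theta>)" 1] prob_space by simp
    have lower: "1 / 64 * prob S \<le> 1 - cmod (char F t)"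
      if S: "S \<in> sets borel" "\<And>x. x \<in> S \<Longrightarrow> 1/4 \<le> \<bar>t * x - \<theta>\<bar> \<and> \<bar>t * x - \<theta>\<bar> \<le> 2 * pi - 1/4" for S
    proof -
      have "1 / 64 * prob S = (\<integral>x. 1 / 64 * indicator S x \<partial>F)"
        using S by simp
      also have "\<dots> \<le> (\<integral>x. 1 - cos (t * x - \<theta>) \<partial>F)"
      proof (rule integral_mono)
        show "integrable F (\<lambda>x. 1 / 64 * indicat_real S x)"
          using S by (intro integrable_const_bound[of _ 1]) (auto simp: indicator_def)
        show "integrable F (\<lambda>x. 1 - cos (t * x - \<theta>))"
          by (intro Bochner_Integration.integrable_diff integrable_const integrable_const_bound[where B=1]) auto
        show "1 / 64 * indicator S x \<le> 1 - cos (t * x - \<theta>)" for x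
          using one_minus_cos_ge'[of "t * x - \<theta>"] S(2)[of x] by (auto simp: indicator_def)
      qed
      finally show ?thesis unfolding * .
    qed
    have F1: "Fbar F (1 / t) \<le> 1" by (rule Fbar_le_1)
    show ?thesis
    proof (cases "\<bar>\<theta>\<bar> \<le> 1/2")
      case True
      have "1 / 64 * prob {1 / t<..2 / t} \<le> 1 - cmod (char F t)"
      proof (rule lower)
        fix x assume "x \<in> {1 / t<..2 / t}"
        then have "1 < t * x" "t * x \<le> 2" using t by (auto simp: field_simps)
        then show "1/4 \<le> \<bar>t * x - \<theta>\<bar> \<and> \<bar>t * x - \<theta>\<bar> \<le> 2 * pi - 1/4"
          using True pi_gt3 by linarith
      qed simp
      moreover have "prob {1 / t<..2 / t} = Fbar F (1 / t) - Fbar F (2 * (1 / t))"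
      proof -
        have "prob ({1 / t<..} - {2 / t<..}) = prob {1 / t<..} - prob {2 / t<..}"
          using t by (intro finite_measure_Diff) (auto intro: order.strict_trans1[of _ "2 / t"] simp: divide_right_mono)
        moreover have "{1 / t<..} - {2 / t<..} = {1 / t<..2 / t}" by auto
        ultimately show ?thesis by (simp add: Fbar_eq)
      qed
      moreover have "Fbar F (2 * (1 / t)) \<le> (1 - c0) * Fbar F (1 / t)"
        using x1[of "1 / t"] tx Fbar_pos[of "1 / t"] by (simp add: x0_def pos_divide_less_eq)
      moreover have "(64 * c) * Fbar F (1 / t) \<le> c0 * Fbar F (1 / t)"
        using c Fbar_pos[of "1 / t"] by (intro mult_right_mono) auto
      ultimately show ?thesis by (simp add: algebra_simps)
    next
      \<comment> \<open>Here \<bar>t X - \<theta>\<bar> lies between 1/4 and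
        \<open>pi + 1/4\<close>. The gain is a constant and is weakened to a multiple of
        \<open>Fbar F (1 / t)\<close>, which is at most 1.\<close>
      case False
      let ?x = "1 / (4 * t)"
      have "1 / 64 * prob {- ?x<..?x} \<le> 1 - cmod (char F t)"
      proof (rule lower)
        fix x assume "x \<in> {- ?x<..?x}"
        then have "- 1/4 \<le> t * x" "t * x \<le> 1/4" using t by (auto simp: field_simps)
        then show "1/4 \<le> \<bar>t * x - \<theta>\<bar> \<and> \<bar>t * x - \<theta>\<bar> \<le> 2 * pi - 1/4"
          using False \<theta> pi_gt3 by linarith
      qed simp
      moreover have "prob {- ?x<..?x} = cdf F ?x - cdf F (- ?x)"
        using t cdf_diff_eq[of "- ?x" ?x] by simp
      moreover have "1 / 2 < cdf F ?x - cdf F (- ?x)"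
        using tx by (intro x2) (auto simp: x0_def field_simps)
      moreover have "c * Fbar F (1 / t) \<le> c * 1"
        using c F1 by (intro mult_left_mono) auto
      ultimately show ?thesis using c(3) by linarith
    qed
  qed
  have "cmod (char F t) \<le> exp (- (c * Fbar F (1 / \<bar>t\<bar>)))" if "t \<noteq> 0" "\<bar>t\<bar> \<le> 1 / x0" for t
  proof -
    have "cmod (char F t) = cmod (char F \<bar>t\<bar>)"
      using char_uminus[OF real_distribution_axioms, of t] by (cases "t \<ge> 0") auto
    also have "\<dots> \<le> 1 - c * Fbar F (1 / \<bar>t\<bar>)"
      using that by (intro pos) auto
    also have "\<dots> \<le> exp (- (c * Fbar F (1 / \<bar>t\<bar>)))"
      using exp_ge_add_one_self[of "- (c * Fbar F (1 / \<bar>t\<bar>))"] by simp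
    finally show ?thesis .
  qed
  moreover have "1 / x0 > 0" by (simp add: x0_def)
  ultimately show ?thesis using that c by blast
qed

end

text \<open>Convergence in law is recorded through characteristic functions, the norming through
  \<open>A (a n)\<close> being asymptotic to \<open>n\<close>. The bound \<open>1 \<le> a n\<close>
  holds for \<open>n = 0\<close> as well, so division by \<open>a n\<close> is always
  legitimate.\<close>

locale stable_domain = heavy_tail +
  fixes a :: "nat \<Rightarrow> real" and G :: "real measure"
  assumes a_mono: "\<And>m n. m \<le> n \<Longrightarrow> a m \<le> a n" and a_ge_1: "\<And>n. 1 \<le> a n"
    and a_at_top: "filterlim a at_top sequentially"
    and A_a: "(\<lambda>n. A (a n) / real n) \<longlonglongrightarrow> 1"
    and G: "real_distribution G"
    and char_lim: "\<And>s. (\<lambda>n. char F (s / a n) ^ n) \<longlonglongrightarrow> char G s"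
begin

lemma a_pos: "0 < a n"
  using a_ge_1[of n] by linarith

lemma norm_char_le_1: "cmod (char F t) \<le> 1"
  by (rule cmod_char_le_1)

text \<open>An integrable majorant uniform in \<open>n\<close>. Decay gives
  \<open>exp (- c * n * Fbar F (a n / \<bar>s\<bar>))\<close>, and the square root growth of
  \<open>A\<close> between \<open>a n / \<bar>s\<bar>\<close> and \<open>a n\<close>, together with
  \<open>A (a n) \<le> 2 * n\<close>, bounds the exponent by a multiple of
  \<open>- sqrt \<bar>s\<bar>\<close>.\<close>

lemma norm_char_power_bound:
  obtains \<eta> D n0 where "\<eta> > 0" "D > 0" "n0 > 0"
    "\<And>n s. n0 \<le> n \<Longrightarrow> \<bar>s\<bar> \<le> \<eta> * a n \<Longrightarrow> cmod (char F (s / a n)) ^ n \<le> D / (1 + s\<^sup>2)"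
proof -
  obtain c \<eta>0 where c: "c > 0" "\<eta>0 > 0"
    "\<And>t. t \<noteq> 0 \<Longrightarrow> \<bar>t\<bar> \<le> \<eta>0 \<Longrightarrow> cmod (char F t) \<le> exp (- (c * Fbar F (1 / \<bar>t\<bar>)))"
    by (rule char_decay) blast
  obtain x0 where x0: "x0 > 0" "\<And>x y. x0 \<le> x \<Longrightarrow> x \<le> y \<Longrightarrow> sqrt (y / x) * A x \<le> 2 * A y"
    by (rule A_sqrt_growth) blast
  \<comment> \<open>The second bound guarantees \<open>a n / \<bar>s\<bar> \<ge> x0\<close>, as the
    growth lemma demands.\<close>
  define \<eta> where "\<eta> = min \<eta>0 (1 / x0)"
  \<comment> \<open>The 4 combines the factor 2 of \<open>A_sqrt_growth\<close> with
    \<open>A (a n) \<le> 2 * n\<close>. In \<open>D\<close>, 2 settles \<bar>s\<bar> \<le> 1, and 48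
    is 24 from \<open>exp_minus_le\<close> times 2 from
    \<open>1 + s^2 \<le> 2 * s^2\<close>.\<close>
  define k where "k = c / 4"
  define D where "D = max 2 (48 / k ^ 4)"
  have k: "k > 0" using c by (simp add: k_def)
  have \<eta>: "\<eta> > 0" "\<eta> \<le> \<eta>0" "\<eta> \<le> 1 / x0" using c x0 by (auto simp: \<eta>_def)
  have "\<forall>\<^sub>F n in sequentially. A (a n) / real n < 2"
    using order_tendstoD(2)[OF A_a, of 2] by simp
  then obtain n0 where n0: "\<And>n. n0 \<le> n \<Longrightarrow> A (a n) / real n < 2"
    by (auto simp: eventually_sequentially)
  have "cmod (char F (s / a n)) ^ n \<le> D / (1 + s\<^sup>2)" if n: "max n0 1 \<le> n" and s: "\<bar>s\<bar> \<le> \<eta> * a n" for n s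
  proof (cases "\<bar>s\<bar> \<le> 1")
    case True
    then have "1 + s\<^sup>2 \<le> D" using abs_square_le_1[of s] by (auto simp: D_def)
    then have "1 \<le> D / (1 + s\<^sup>2)" by (simp add: field_simps add_pos_nonneg)
    then show ?thesis
      using power_le_one[OF norm_ge_zero norm_char_le_1, of "s / a n" n] by linarith
  next
    case False
    then have s1: "\<bar>s\<bar> > 1" by simp
    let ?x = "a n / \<bar>s\<bar>"
    have x: "x0 \<le> ?x"
    proof -
      have "\<bar>s\<bar> \<le> (1 / x0) * a n"
        using s \<eta>(3) a_pos[of n] by (intro order_trans[OF s] mult_right_mono) auto
      then show ?thesis using x0(1) s1 by (simp add: field_simps)
    qed
    have "?x \<le> a n" using s1 a_pos[of n] by (simp add: field_simps)
    from x0(2)[OF x this] have "sqrt \<bar>s\<bar> * A ?x \<le> 2 * A (a n)"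
      using s1 a_pos[of n] by simp
    also have "\<dots> \<le> 4 * real n"
      using n0[of n] n by (simp add: field_simps)
    finally have "sqrt \<bar>s\<bar> / 4 \<le> real n * Fbar F ?x"
      using Fbar_pos[of ?x] by (simp add: A_def field_simps)
    then have "k * sqrt \<bar>s\<bar> \<le> real n * (c * Fbar F ?x)"
      using mult_left_mono[of _ _ c] c(1) by (fastforce simp: k_def mult_ac)
    have "cmod (char F (s / a n)) \<le> exp (- (c * Fbar F (1 / \<bar>s / a n\<bar>)))"
    proof (rule c(3))
      have "\<bar>s\<bar> \<le> \<eta>0 * a n"
        using \<eta>(2) a_pos[of n] by (intro order_trans[OF s] mult_right_mono) auto
      then show "\<bar>s / a n\<bar> \<le> \<eta>0" using a_pos[of n] by (simp add: abs_divide field_simps)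
    qed (use s1 a_pos[of n] in auto)
    also have "1 / \<bar>s / a n\<bar> = ?x" using a_pos[of n] by (simp add: abs_divide)
    finally have "cmod (char F (s / a n)) ^ n \<le> exp (- (c * Fbar F ?x)) ^ n"
      by (intro power_mono) auto
    also have "\<dots> = exp (- (real n * (c * Fbar F ?x)))"
      by (simp add: exp_of_nat_mult[symmetric])
    also have "\<dots> \<le> exp (- (k * sqrt \<bar>s\<bar>))"
      using \<open>k * sqrt \<bar>s\<bar> \<le> _\<close> by simp
    also have "\<dots> \<le> 24 / (k * sqrt \<bar>s\<bar>) ^ 4"
      using k s1 by (intro exp_minus_le) auto
    also have "(k * sqrt \<bar>s\<bar>) ^ 4 = k ^ 4 * s\<^sup>2"
    proof -
      have "sqrt \<bar>s\<bar> ^ 4 = ((sqrt \<bar>s\<bar>)\<^sup>2)\<^sup>2" by (simp only: power_mult[symmetric]) simp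
      also have "\<dots> = s\<^sup>2" by simp
      finally show ?thesis by (simp add: power_mult_distrib)
    qed
    also have "24 / (k ^ 4 * s\<^sup>2) \<le> (48 / k ^ 4) / (1 + s\<^sup>2)"
    proof -
      have "1 \<le> s\<^sup>2" using s1 one_le_power[of "\<bar>s\<bar>" 2] by simp
      then have "k ^ 4 * (1 + s\<^sup>2) \<le> k ^ 4 * (2 * s\<^sup>2)"
        using k by (intro mult_left_mono) auto
      then have "48 / (k ^ 4 * (2 * s\<^sup>2)) \<le> 48 / (k ^ 4 * (1 + s\<^sup>2))"
        using k \<open>1 \<le> s\<^sup>2\<close> by (intro divide_left_mono) (auto intro!: mult_pos_pos add_pos_nonneg)
      then show ?thesis by (simp add: mult.commute)
    qed
    also have "\<dots> \<le> D / (1 + s\<^sup>2)"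
      by (intro divide_right_mono) (auto simp: D_def)
    finally show ?thesis .
  qed
  moreover have "D > 0" by (simp add: D_def)
  ultimately show ?thesis using that[of \<eta> D "max n0 1"] \<eta> by auto
qed

text \<open>The majorant passes to the limit, because every fixed \<open>s\<close> lies in the
  window \<open>\<bar>s\<bar> \<le> \<eta> * a n\<close> for large \<open>n\<close>.\<close>

lemma integrable_char_G: "integrable lborel (char G)"
proof -
  interpret G: real_distribution G by (rule G)
  obtain \<eta> D n0 where D: "\<eta> > 0" "D > 0" "n0 > 0"
    "\<And>n s. n0 \<le> n \<Longrightarrow> \<bar>s\<bar> \<le> \<eta> * a n \<Longrightarrow> cmod (char F (s / a n)) ^ n \<le> D / (1 + s\<^sup>2)"
    by (rule norm_char_power_bound) blast
  have "cmod (char G s) \<le> D / (1 + s\<^sup>2)" for s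
  proof (rule tendsto_le[OF sequentially_bot tendsto_const tendsto_norm[OF char_lim]])
    have "\<forall>\<^sub>F n in sequentially. \<bar>s\<bar> / \<eta> \<le> a n"
      using a_at_top by (simp add: filterlim_at_top)
    then show "\<forall>\<^sub>F n in sequentially. cmod (char F (s / a n) ^ n) \<le> D / (1 + s\<^sup>2)"
      using eventually_ge_at_top[of n0]
      by eventually_elim (use D in \<open>auto simp: norm_power field_simps\<close>)
  qed
  then show ?thesis
    by (intro Bochner_Integration.integrable_bound[OF integrable_mult_right[OF integrable_inverse_1_plus_sq, of D]])
      (use D in \<open>auto simp: abs_mult\<close>)
qed

end

section \<open>Concentration and sums along the norming sequence\<close>

lemma tri_mono: "0 < \<eta> \<Longrightarrow> \<eta> \<le> \<eta>' \<Longrightarrow> tri \<eta> t \<le> tri \<eta>' t"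
  unfolding tri_def by (intro max.mono diff_mono divide_left_mono) auto

lemma eventually_pos_nat: "filterlim n sequentially H \<Longrightarrow> \<forall>\<^sub>F i in H. 0 < (n i :: nat)"
  unfolding filterlim_at_top by (auto elim!: allE[of _ 1] eventually_mono)

lemma integrable_indicator_Icc: "integrable lborel (\<lambda>y. indicator {a..b::real} y * (c::real))"
  by (cases "a \<le> b") auto

section \<open>Asymptotic inversion along the norming sequence\<close>

context heavy_tail
begin

text \<open>The index at the rescaled time \<open>u\<close>; \<open>A x\<close> is the number of
  steps on which the walk reaches the scale \<open>x\<close>.\<close>

abbreviation idx :: "real \<Rightarrow> real \<Rightarrow> nat" where
  "idx u x \<equiv> nat \<lfloor>u * A x\<rfloor>"

lemma nat_floor_ratio:
  assumes "0 \<le> u"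
  shows "((\<lambda>x. real (idx u x) / A x) \<longlongrightarrow> u) at_top"
proof (rule tendsto_sandwich[of "\<lambda>x. u - 1 / A x" _ _ "\<lambda>x. u"])
  have eq: "real (idx u x) = of_int \<lfloor>u * A x\<rfloor>" for x
    using assms A_pos[of x] by (simp add: of_nat_nat)
  show "\<forall>\<^sub>F x in at_top. u - 1 / A x \<le> real (idx u x) / A x"
  proof (intro always_eventually allI)
    fix x
    have "u * A x - 1 \<le> real_of_int \<lfloor>u * A x\<rfloor>" by linarith
    then show "u - 1 / A x \<le> real (idx u x) / A x"
      unfolding eq using A_pos[of x] divide_right_mono[of "u * A x - 1" _ "A x"]
      by (simp add: diff_divide_distrib)
  qed
  show "\<forall>\<^sub>F x in at_top. real (idx u x) / A x \<le> u"
    using A_pos by (intro always_eventually allI) (simp add: eq pos_divide_le_eq)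
  have "((\<lambda>x. u - 1 / A x) \<longlongrightarrow> u - 0) at_top"
    by (intro tendsto_intros tendsto_divide_0[OF tendsto_const] filterlim_at_top_imp_at_infinity A_at_top)
  then show "((\<lambda>x. u - 1 / A x) \<longlongrightarrow> u) at_top" by simp
qed simp

lemma nat_floor_at_top:
  assumes "0 < u"
  shows "filterlim (\<lambda>x. idx u x) sequentially at_top"
proof -
  have "filterlim (\<lambda>x. u * A x) at_top at_top"
    by (rule filterlim_tendsto_pos_mult_at_top[OF tendsto_const assms A_at_top])
  then show ?thesis
    by (intro filterlim_compose[OF filterlim_nat_sequentially] filterlim_compose[OF filterlim_floor_sequentially])
qed

end

context stable_domain
begin

text \<open>The sequence \<open>a\<close> inverts \<open>A\<close> asymptotically. The filter is
  arbitrary so that the same lemma serves \<open>x\<close> tending to infinity and, with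
  \<open>x = a n\<close>, the ratios of norming constants.\<close>

lemma a_over_x:
  assumes x: "filterlim x at_top H" and n: "filterlim n sequentially H"
    and lim: "((\<lambda>i. real (n i) / A (x i)) \<longlongrightarrow> u) H" and u: "0 < u"
  shows "((\<lambda>i. a (n i) / x i) \<longlongrightarrow> u powr (1 / \<alpha>)) H"
proof (rule ratio_inverse[OF x _ u])
  have "((\<lambda>i. (A (a (n i)) / real (n i)) * (real (n i) / A (x i))) \<longlongrightarrow> 1 * u) H"
    by (intro tendsto_mult filterlim_compose[OF A_a n] lim)
  moreover have "\<forall>\<^sub>F i in H. (A (a (n i)) / real (n i)) * (real (n i) / A (x i)) = A (a (n i)) / A (x i)"
    using eventually_pos_nat[OF n] by eventually_elim simp
  ultimately show "((\<lambda>i. A (a (n i)) / A (x i)) \<longlongrightarrow> u) H"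
    by (simp add: Lim_transform_eventually)
qed

lemma x_over_a: "0 < u \<Longrightarrow> ((\<lambda>x. x / a (idx u x)) \<longlongrightarrow> u powr (-1 / \<alpha>)) at_top"
proof -
  assume "0 < u"
  then have "((\<lambda>x. inverse (a (idx u x) / x)) \<longlongrightarrow> inverse (u powr (1 / \<alpha>))) at_top"
    by (intro tendsto_inverse a_over_x[OF filterlim_ident nat_floor_at_top nat_floor_ratio]) auto
  then show ?thesis by (simp add: powr_minus_divide inverse_eq_divide)
qed

lemma a_ratio:
  assumes m: "filterlim m sequentially H" and n: "filterlim n sequentially H"
    and lim: "((\<lambda>i. real (m i) / real (n i)) \<longlongrightarrow> \<rho>) H" and \<rho>: "0 < \<rho>"
  shows "((\<lambda>i. a (m i) / a (n i)) \<longlongrightarrow> \<rho> powr (1 / \<alpha>)) H"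
proof (rule a_over_x[OF filterlim_compose[OF a_at_top n] m _ \<rho>])
  have "((\<lambda>i. (real (m i) / real (n i)) / (A (a (n i)) / real (n i))) \<longlongrightarrow> \<rho> / 1) H"
    by (intro tendsto_divide filterlim_compose[OF A_a n] lim) auto
  moreover have "\<forall>\<^sub>F i in H. (real (m i) / real (n i)) / (A (a (n i)) / real (n i)) = real (m i) / A (a (n i))"
    using eventually_pos_nat[OF n] by eventually_elim simp
  ultimately show "((\<lambda>i. real (m i) / A (a (n i))) \<longlongrightarrow> \<rho>) H"
    by (simp add: Lim_transform_eventually)
qed

lemma a_half:
  obtains K where "0 < K" "\<And>n. a n \<le> K * a (n div 2)"
proof -
  have half: "filterlim (\<lambda>n::nat. n div 2) sequentially sequentially"
    unfolding filterlim_at_top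
  proof
    fix Z :: nat
    show "\<forall>\<^sub>F n in sequentially. Z \<le> n div 2"
      using eventually_ge_at_top[of "2 * Z"] by eventually_elim auto
  qed
  have "(\<lambda>n. real n / real (n div 2)) \<longlonglongrightarrow> 2"
  proof (rule tendsto_sandwich[of "\<lambda>n. 2" _ _ "\<lambda>n. 2 + 1 / real (n div 2)"])
    have pos: "\<forall>\<^sub>F n in sequentially. 0 < n div (2::nat)"
      by (rule eventually_pos_nat[OF half])
    show "\<forall>\<^sub>F n in sequentially. 2 \<le> real n / real (n div 2)"
      using pos
    proof eventually_elim
      case (elim n)
      have "real (2 * (n div 2)) \<le> real n" by (intro of_nat_mono) auto
      then show ?case using elim by (simp add: field_simps)
    qed
    show "\<forall>\<^sub>F n in sequentially. real n / real (n div 2) \<le> 2 + 1 / real (n div 2)"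
      using pos
    proof eventually_elim
      case (elim n)
      have "real n \<le> real (2 * (n div 2) + 1)" by (intro of_nat_mono) auto
      then show ?case using elim by (simp add: field_simps)
    qed
    have "(\<lambda>n. 2 + 1 / real (n div 2)) \<longlonglongrightarrow> 2 + 0"
      by (intro tendsto_intros filterlim_compose[OF lim_1_over_n half])
    then show "(\<lambda>n. 2 + 1 / real (n div 2)) \<longlonglongrightarrow> 2" by simp
  qed simp
  from a_ratio[OF filterlim_ident half this]
  have "(\<lambda>n. a n / a (n div 2)) \<longlonglongrightarrow> 2 powr (1 / \<alpha>)" by simp
  from order_tendstoD(2)[OF this, of "2 powr (1 / \<alpha>) + 1"]
  have "\<forall>\<^sub>F n in sequentially. a n / a (n div 2) < 2 powr (1 / \<alpha>) + 1" by simp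
  then have "\<forall>\<^sub>F n in sequentially. a n \<le> (2 powr (1 / \<alpha>) + 1) * a (n div 2)"
    by eventually_elim (use a_pos in \<open>simp add: pos_divide_less_eq less_imp_le\<close>)
  then show ?thesis
    by (rule eventually_le_imp_all_le) (use a_pos that in auto)
qed

text \<open>The substitution \<open>t = s / a n\<close> produces the factor \<open>1 / a n\<close>
  and leaves an integrand below the majorant; finitely many small \<open>n\<close> are absorbed in
  the constant.\<close>

lemma integral_tri_char_power_le:
  obtains C \<eta>0 where "0 < C" "0 < \<eta>0"
    "\<And>\<eta> n. 0 < \<eta> \<Longrightarrow> \<eta> \<le> \<eta>0 \<Longrightarrow> (LBINT t. tri \<eta> t * cmod (char F t) ^ n) \<le> C / a n"
proof -
  obtain \<eta>0 D n0 where D: "\<eta>0 > 0" "D > 0" "n0 > 0"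
    "\<And>n s. n0 \<le> n \<Longrightarrow> \<bar>s\<bar> \<le> \<eta>0 * a n \<Longrightarrow> cmod (char F (s / a n)) ^ n \<le> D / (1 + s\<^sup>2)"
    by (rule norm_char_power_bound) blast
  define J where "J = (LBINT s. D * (1 / (1 + s\<^sup>2)))"
  have int: "integrable lborel (\<lambda>t. tri \<eta> t * cmod (char F t) ^ n)" if "0 < \<eta>" for \<eta> n
    using integrable_tri_mult[OF that, of "\<lambda>t. cmod (char F t) ^ n" 1 0]
    by (simp add: power_le_one norm_char_le_1)
  have "(LBINT t. tri \<eta>0 t * cmod (char F t) ^ n) \<le> J * (1 / a n)" if n: "n0 \<le> n" for n
  proof -
    have "(LBINT t. tri \<eta>0 t * cmod (char F t) ^ n) =
        1 / a n * (LBINT s. tri \<eta>0 (s / a n) * cmod (char F (s / a n)) ^ n)"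
      using lborel_integral_real_affine[of "1 / a n" "\<lambda>t. tri \<eta>0 t * cmod (char F t) ^ n" 0] a_pos[of n]
      by simp
    also have "\<dots> \<le> 1 / a n * (LBINT s. D * (1 / (1 + s\<^sup>2)))"
    proof (intro mult_left_mono integral_mono')
      show "tri \<eta>0 (s / a n) * cmod (char F (s / a n)) ^ n \<le> D * (1 / (1 + s\<^sup>2))" for s
      proof (cases "\<bar>s\<bar> \<le> \<eta>0 * a n")
        case True
        have "tri \<eta>0 (s / a n) * cmod (char F (s / a n)) ^ n \<le> 1 * cmod (char F (s / a n)) ^ n"
          using D by (intro mult_right_mono tri_le_1) auto
        also have "\<dots> \<le> D / (1 + s\<^sup>2)"
          using D(4)[OF n True] by simp
        finally show ?thesis by simp
      next
        case False
        then have "\<eta>0 \<le> \<bar>s / a n\<bar>" using a_pos[of n] by (simp add: abs_divide field_simps)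
        then show ?thesis using D by (simp add: tri_eq_0)
      qed
    qed (use a_pos[of n] D integrable_mult_right[OF integrable_inverse_1_plus_sq, of D] in auto)
    finally show ?thesis by (simp add: J_def)
  qed
  then have "\<forall>\<^sub>F n in sequentially. (LBINT t. tri \<eta>0 t * cmod (char F t) ^ n) \<le> J * (1 / a n)"
    by (auto simp: eventually_sequentially)
  then obtain C where C: "0 < C" "\<And>n. (LBINT t. tri \<eta>0 t * cmod (char F t) ^ n) \<le> C * (1 / a n)"
    by (rule eventually_le_imp_all_le) (use a_pos in auto)
  have "(LBINT t. tri \<eta> t * cmod (char F t) ^ n) \<le> C / a n" if "0 < \<eta>" "\<eta> \<le> \<eta>0" for \<eta> n
  proof -
    have "(LBINT t. tri \<eta> t * cmod (char F t) ^ n) \<le> (LBINT t. tri \<eta>0 t * cmod (char F t) ^ n)"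
      using that D by (intro integral_mono int mult_right_mono tri_mono) auto
    with C(2)[of n] show ?thesis by simp
  qed
  with C D that show ?thesis by blast
qed

section \<open>Concentration of the walk\<close>

lemma conv_pow_Ioc_le:
  assumes "0 < h"
  obtains C where "0 < C" "\<And>n z. measure (conv_pow F n) {z<..z+h} \<le> C / a n"
proof -
  obtain C \<eta>0 where C: "0 < C" "0 < \<eta>0"
    "\<And>\<eta> n. 0 < \<eta> \<Longrightarrow> \<eta> \<le> \<eta>0 \<Longrightarrow> (LBINT t. tri \<eta> t * cmod (char F t) ^ n) \<le> C / a n"
    by (rule integral_tri_char_power_le) blast
  define \<eta> where "\<eta> = min \<eta>0 (1 / h)"
  have \<eta>: "0 < \<eta>" "\<eta> \<le> \<eta>0" "\<eta> * h \<le> 1"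
    using assms C by (auto simp: \<eta>_def min_def field_simps)
  have "measure (conv_pow F n) {z<..z+h} \<le> (2 / \<eta> * C) / a n" for n z
  proof -
    have "measure (conv_pow F n) {z<..z+h} \<le> 2 / \<eta> * (LBINT t. tri \<eta> t * cmod (char F t) ^ n)"
      using measure_Ioc_le_char[OF real_distribution_walk \<eta>(1,3)]
      by (simp add: char_walk norm_power)
    also have "\<dots> \<le> 2 / \<eta> * (C / a n)"
      using \<eta> C by (intro mult_left_mono) auto
    finally show ?thesis by simp
  qed
  moreover have "0 < 2 / \<eta> * C" using \<eta> C by simp
  ultimately show ?thesis using that by blast
qed

text \<open>With \<open>m = n div 2\<close> the power is at most the squared modulus of the
  characteristic function of \<open>conv_pow F m\<close>, to which the comparison of windows
  applies. Halving costs a constant by \<open>a_half\<close>.\<close>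

lemma integral_char_power_le:
  obtains C where "0 < C" "\<And>n. (LBINT t. indicator {-T..T} t * cmod (char F t) ^ n) \<le> C / a n"
proof -
  obtain C \<eta> where C: "0 < C" "0 < \<eta>"
    "\<And>\<eta>' n. 0 < \<eta>' \<Longrightarrow> \<eta>' \<le> \<eta> \<Longrightarrow> (LBINT t. tri \<eta>' t * cmod (char F t) ^ n) \<le> C / a n"
    by (rule integral_tri_char_power_le) blast
  obtain C1 where C1: "\<And>M. real_distribution M \<Longrightarrow>
    (LBINT t. indicator {-T..T} t * (cmod (char M t))\<^sup>2) \<le> C1 * (LBINT t. tri \<eta> t * (cmod (char M t))\<^sup>2)"
    by (rule integral_char_sq_le[OF C(2)]) blast
  obtain K where K: "0 < K" "\<And>n. a n \<le> K * a (n div 2)"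
    by (rule a_half) blast
  define C' where "C' = \<bar>C1\<bar> * C * K + 1"
  have int: "integrable lborel (\<lambda>t. indicator {-T..T} t * cmod (char F t) ^ n)" for n
    by (rule Bochner_Integration.integrable_bound[OF integrable_indicator_Icc[of "-T" T 1]])
       (auto simp: abs_mult power_le_one norm_char_le_1 indicator_def)
  have "(LBINT t. indicator {-T..T} t * cmod (char F t) ^ n) \<le> C' / a n" for n
  proof -
    let ?m = "n div 2"
    let ?I = "LBINT t. tri \<eta> t * cmod (char F t) ^ (?m * 2)"
    have I: "0 \<le> ?I" by (intro integral_nonneg_AE AE_I2 mult_nonneg_nonneg tri_nonneg) auto
    have "(LBINT t. indicator {-T..T} t * cmod (char F t) ^ n) \<le> (LBINT t. indicator {-T..T} t * cmod (char F t) ^ (?m * 2))"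
      by (intro integral_mono int mult_left_mono power_decreasing norm_char_le_1) auto
    also have "\<dots> \<le> C1 * ?I"
      using C1[OF real_distribution_walk, of ?m]
      by (simp add: char_walk norm_power flip: power_mult)
    also have "\<dots> \<le> \<bar>C1\<bar> * (C / a (?m * 2))"
      using C I by (intro mult_mono) auto
    also have "C / a (?m * 2) \<le> C / a ?m"
      using C a_pos by (intro divide_left_mono a_mono mult_pos_pos) auto
    also have "C / a ?m \<le> C * (K / a n)"
      using K(2)[of n] a_pos[of n] a_pos[of ?m] C by (simp add: field_simps)
    finally have "(LBINT t. indicator {-T..T} t * cmod (char F t) ^ n) \<le> (\<bar>C1\<bar> * C * K) / a n"
      by (simp add: mult_left_mono)
    also have "\<dots> \<le> C' / a n"
      using a_pos[of n] by (intro divide_right_mono) (auto simp: C'_def)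
    finally show ?thesis .
  qed
  moreover have "0 < C'" using C K by (simp add: C'_def add_nonneg_pos)
  ultimately show ?thesis using that by blast
qed

text \<open>If \<open>S\<^sub>n\<close> lands near \<open>x\<close>, then one of the two halves of the walk exceeds \<open>x/2\<close>, and the other one
  must hit an interval of length \<open>h\<close>.\<close>

lemma conv_pow_Ioc_small:
  assumes "0 < h"
  obtains C x0 where "0 < C" "\<And>n x. x0 \<le> x \<Longrightarrow> measure (conv_pow F n) {x<..x+h} \<le> C * Fbar F x * (n / a n)"
proof -
  obtain C1 where C1: "0 < C1" "\<And>n z. measure (conv_pow F n) {z<..z+h} \<le> C1 / a n"
    by (rule conv_pow_Ioc_le[OF assms]) blast
  obtain C2 x1 where C2: "0 < C2" "0 < x1" "\<And>n x. x1 \<le> x \<Longrightarrow> measure (conv_pow F n) {x<..} \<le> C2 * n * Fbar F x"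
    by (rule conv_pow_tail_bound) blast
  obtain K where K: "0 < K" "\<And>n. a n \<le> K * a (n div 2)"
    by (rule a_half) blast
  define L where "L = (1 / 2) powr - \<alpha> + (1::real)"
  have "0 < L" by (simp add: L_def add_nonneg_pos)
  have "\<forall>\<^sub>F x in at_top. Fbar F (1 / 2 * x) / Fbar F x < L"
    by (rule order_tendstoD(2)[OF Fbar_ratio]) (auto simp: L_def)
  then obtain x2 where x2: "\<And>x. x2 \<le> x \<Longrightarrow> Fbar F (x / 2) / Fbar F x < L"
    by (auto simp: eventually_at_top_linorder)
  define x0 where "x0 = max (2 * x1) x2"
  have "measure (conv_pow F n) {x<..x+h} \<le> (C1 * K * C2 * L) * Fbar F x * (n / a n)" if x: "x0 \<le> x" for n x
  proof -
    \<comment> \<open>The second half is the longer one, so its concentration bound follows from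
      that of the first.\<close>
    define m k where "m = n div 2" and "k = n - n div 2"
    have mk: "m + k = n" "m \<le> k" by (auto simp: m_def k_def)
    have q: "C1 / a k \<le> C1 * (K / a n)" "C1 / a m \<le> C1 * (K / a n)"
    proof -
      show m: "C1 / a m \<le> C1 * (K / a n)"
        using K(2)[of n] a_pos[of n] a_pos[of m] C1 by (simp add: field_simps m_def)
      have "C1 / a k \<le> C1 / a m"
        using C1 mk a_pos by (intro divide_left_mono a_mono mult_pos_pos) auto
      with m show "C1 / a k \<le> C1 * (K / a n)" by linarith
    qed
    have "measure (conv_pow F n) {x<..x+h} = measure (conv_pow F m \<star> conv_pow F k) {x<..x+h}"
      using conv_pow_add[OF real_distribution_axioms, of m k] mk by simp
    also have "\<dots> \<le> C1 * (K / a n) * (measure (conv_pow F m) {x/2<..} + measure (conv_pow F k) {x/2<..})"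
      using assms q C1(2)
      by (intro measure_convolution_Ioc_le real_distribution_conv_pow real_distribution_axioms) (auto intro: order_trans)
    also have "\<dots> \<le> C1 * (K / a n) * (C2 * m * Fbar F (x/2) + C2 * k * Fbar F (x/2))"
      using C1 K a_pos[of n] x by (intro mult_left_mono add_mono C2) (auto simp: x0_def)
    also have "\<dots> = C1 * (K / a n) * (C2 * n * Fbar F (x/2))"
      using mk by (simp add: ring_distribs flip: mk(1))
    also have "\<dots> \<le> C1 * (K / a n) * (C2 * n * (L * Fbar F x))"
      using C1 K C2 a_pos[of n] x2[of x] x Fbar_pos[of x]
      by (intro mult_left_mono) (auto simp: x0_def pos_divide_less_eq less_imp_le)
    finally show ?thesis by (simp add: mult_ac)
  qed
  moreover have "0 < C1 * K * C2 * L" using C1 K C2 \<open>0 < L\<close> by simp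
  ultimately show ?thesis using that by blast
qed

section \<open>Sums along the norming sequence\<close>

lemma a_double_limits:
  shows "(\<lambda>n. a (2 * n + 1) / a n) \<longlonglongrightarrow> 2 powr (1 / \<alpha>)" "(\<lambda>n. a (2 * n) / a n) \<longlonglongrightarrow> 2 powr (1 / \<alpha>)"
proof -
  have "filterlim (\<lambda>n::nat. 2 * n + 1) sequentially sequentially"
    by (rule filterlim_subseq) (auto simp: strict_mono_def)
  moreover have "(\<lambda>n. real (2 * n + 1) / real n) \<longlonglongrightarrow> 2"
  proof -
    have "(\<lambda>n. 2 + 1 / real n) \<longlonglongrightarrow> 2 + 0"
      by (intro tendsto_intros lim_1_over_n)
    moreover have "\<forall>\<^sub>F n in sequentially. 2 + 1 / real n = real (2 * n + 1) / real n"
      using eventually_gt_at_top[of 0] by eventually_elim (simp add: field_simps)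
    ultimately show ?thesis by (simp add: Lim_transform_eventually)
  qed
  ultimately show "(\<lambda>n. a (2 * n + 1) / a n) \<longlonglongrightarrow> 2 powr (1 / \<alpha>)"
    by (rule a_ratio[OF _ filterlim_ident]) simp
  have "filterlim (\<lambda>n::nat. 2 * n) sequentially sequentially"
    by (rule filterlim_subseq) (auto simp: strict_mono_def)
  moreover have "(\<lambda>n. real (2 * n) / real n) \<longlonglongrightarrow> 2"
    by (rule tendsto_eventually) (use eventually_gt_at_top[of 0] in \<open>auto elim!: eventually_mono\<close>)
  ultimately show "(\<lambda>n. a (2 * n) / a n) \<longlonglongrightarrow> 2 powr (1 / \<alpha>)"
    by (rule a_ratio[OF _ filterlim_ident]) simp
qed

text \<open>Karamata's theorem for a sequence of index \<open>1 - 1 / \<alpha> > -1\<close>; the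
  assumption \<alpha> > 1/2 enters as \<open>2 powr (1 / \<alpha>) < 4\<close>. When
  \<open>m\<close> is doubled, \<open>m^2 / a m\<close> grows by a factor that is eventually bounded
  away from 1, so the upper half of the sum dominates and induction by halving closes.\<close>

lemma sum_small_le:
  obtains C N0 where "0 < C" "0 < N0" "\<And>N. N0 \<le> N \<Longrightarrow> (\<Sum>n\<le>N. real n / a n) \<le> C * (real N)\<^sup>2 / a N"
proof -
  define \<kappa> where "\<kappa> = (2 powr (1 / \<alpha>) + 4) / 2"
  have "2 powr (1 / \<alpha>) < 2 powr (2::real)"
    using \<alpha> by (intro powr_less_mono) (auto simp: field_simps)
  then have \<kappa>: "2 powr (1 / \<alpha>) < \<kappa>" "\<kappa> < 4" "0 < \<kappa>" by (auto simp: \<kappa>_def intro: add_pos_pos)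
  obtain N1 where N1: "\<And>n. N1 \<le> n \<Longrightarrow> a (2 * n + 1) / a n < \<kappa>"
    using order_tendstoD(2)[OF a_double_limits(1) \<kappa>(1)] by (auto simp: eventually_sequentially)
  define N0 where "N0 = max N1 1"
  define V where "V = (\<lambda>N. \<Sum>n\<le>N. real n / a n)"
  have V_mono: "V m \<le> V n" if "m \<le> n" for m n
    unfolding V_def using that a_pos by (intro sum_mono2) (auto simp: less_imp_le)
  have V_nonneg: "0 \<le> V n" for n unfolding V_def using a_pos by (intro sum_nonneg) (auto simp: less_imp_le)
  \<comment> \<open>The first entry covers \<open>N < 2 * N0\<close>, the second solves
    \<open>(C + 6) * \<kappa> / 4 \<le> C\<close>.\<close>
  define C where "C = max (V (2 * N0) * a (2 * N0)) (6 * \<kappa> / (4 - \<kappa>))"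
  have C: "V (2 * N0) * a (2 * N0) \<le> C" "6 * \<kappa> / (4 - \<kappa>) \<le> C" by (auto simp: C_def)
  have Cpos: "0 < C" using \<kappa> C(2) by (smt (verit) divide_pos_pos)
  have C2: "(C + 6) * \<kappa> / 4 \<le> C" using C(2) \<kappa> by (simp add: field_simps)
  have "V N \<le> C * (real N)\<^sup>2 / a N" if "N0 \<le> N" for N
    using that
  proof (induction N rule: less_induct)
    case (less N)
    show ?case
    proof (cases "N < 2 * N0")
      case True
      have "V N * a N \<le> V (2 * N0) * a (2 * N0)"
        using True a_pos V_nonneg by (intro mult_mono V_mono a_mono) (auto simp: less_imp_le)
      also have "\<dots> \<le> C * 1" using C by simp
      also have "\<dots> \<le> C * (real N)\<^sup>2"
        using Cpos less.prems by (intro mult_left_mono) (auto simp: N0_def)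
      finally show ?thesis using a_pos[of N] by (simp add: field_simps)
    next
      case False
      define m where "m = N div 2"
      have m: "N0 \<le> m" "m < N" "N \<le> 2 * m + 1" "2 * m \<le> N" using False by (auto simp: m_def N0_def)
      have m1: "1 \<le> m" using m(1) by (simp add: N0_def)
      have "V N = V m + (\<Sum>n\<in>{m<..N}. real n / a n)"
        unfolding V_def using m by (subst sum.union_disjoint[symmetric]) (auto intro!: sum.cong)
      also have "(\<Sum>n\<in>{m<..N}. real n / a n) \<le> (\<Sum>n\<in>{m<..N}. real N / a m)"
        using a_pos by (intro sum_mono frac_le a_mono) auto
      also have "\<dots> = real (N - m) * (real N / a m)" by simp
      \<comment> \<open>From \<open>N \<le> 2 * m + 1\<close> and \<open>1 \<le> m\<close>: at most
        \<open>m + 1 \<le> 2 * m\<close> terms, with \<open>N \<le> 3 * m\<close>.\<close>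
      also have "\<dots> \<le> (2 * real m) * ((3 * real m) / a m)"
        using m m1 a_pos[of m] by (intro mult_mono divide_right_mono) auto
      also have "\<dots> = 6 * ((real m)\<^sup>2 / a m)" by (simp add: power2_eq_square)
      also have "V m \<le> C * (real m)\<^sup>2 / a m" using m by (intro less.IH) auto
      finally have "V N \<le> (C + 6) * ((real m)\<^sup>2 / a m)" by (simp add: ring_distribs add_divide_distrib)
      also have "(real m)\<^sup>2 / a m \<le> (real m)\<^sup>2 * (\<kappa> / a N)"
      proof -
        have "a N \<le> a (2 * m + 1)" using m by (intro a_mono)
        also have "\<dots> \<le> \<kappa> * a m"
          using N1[of m] m a_pos[of m] by (simp add: N0_def pos_divide_less_eq)
        finally have "1 / a m \<le> \<kappa> / a N"
          using a_pos[of m] a_pos[of N] by (simp add: field_simps)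
        then have "(real m)\<^sup>2 * (1 / a m) \<le> (real m)\<^sup>2 * (\<kappa> / a N)"
          by (intro mult_left_mono) auto
        then show ?thesis by simp
      qed
      also have "(real m)\<^sup>2 * (\<kappa> / a N) \<le> (real N / 2)\<^sup>2 * (\<kappa> / a N)"
        using m \<kappa> a_pos[of N] by (intro mult_right_mono power_mono) auto
      finally have "V N \<le> (C + 6) * ((real N / 2)\<^sup>2 * (\<kappa> / a N))"
        using Cpos by (simp add: mult_left_mono)
      also have "\<dots> = ((C + 6) * \<kappa> / 4) * ((real N)\<^sup>2 / a N)" by (simp add: power_divide)
      also have "\<dots> \<le> C * ((real N)\<^sup>2 / a N)"
        using a_pos[of N] by (intro mult_right_mono C2) auto
      finally show ?thesis by simp
    qed
  qed
  then show ?thesis using that[of C N0] Cpos by (auto simp: V_def N0_def)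
qed

text \<open>The index \<open>-1 / \<alpha>\<close> is below -1 because \<alpha> < 1, so dyadic
  blocks decay geometrically with ratio \<open>2 / \<kappa> < 1\<close>; \<open>C\<close> is the
  fixed point of \<open>C = 1 + 2 * C / \<kappa>\<close>. The bound is free of \<open>L\<close> and
  thus also yields summability.\<close>

lemma sum_large_le:
  obtains C N0 where "0 < C" "0 < N0" "\<And>N L. N0 \<le> N \<Longrightarrow> (\<Sum>n\<in>{N..<L}. 1 / a n) \<le> C * real N / a N"
proof -
  define \<kappa> where "\<kappa> = (2 powr (1 / \<alpha>) + 2) / 2"
  have "2 powr 1 < 2 powr (1 / \<alpha>)"
    using \<alpha> by (intro powr_less_mono) (auto simp: field_simps)
  then have \<kappa>: "\<kappa> < 2 powr (1 / \<alpha>)" "2 < \<kappa>" by (auto simp: \<kappa>_def)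
  obtain N1 where N1: "\<And>n. N1 \<le> n \<Longrightarrow> \<kappa> < a (2 * n) / a n"
    using order_tendstoD(1)[OF a_double_limits(2) \<kappa>(1)] by (auto simp: eventually_sequentially)
  define N0 where "N0 = max N1 1"
  define C where "C = \<kappa> / (\<kappa> - 2)"
  have C: "0 < C" "1 + 2 * C / \<kappa> = C" using \<kappa> by (auto simp: C_def field_simps)
  have "(\<Sum>n\<in>{N..<L}. 1 / a n) \<le> C * real N / a N" if "N0 \<le> N" for N L
    using that
  proof (induction "L - N" arbitrary: N rule: less_induct)
    case less
    show ?case
    proof (cases "L \<le> N")
      case True
      then show ?thesis using C a_pos[of N] by simp
    next
      case False
      have "(\<Sum>n\<in>{N..<L}. 1 / a n) \<le> (\<Sum>n\<in>{N..<2*N} \<union> {2*N..<L}. 1 / a n)"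
        using a_pos by (intro sum_mono2) (auto simp: less_imp_le)
      also have "\<dots> = (\<Sum>n\<in>{N..<2*N}. 1 / a n) + (\<Sum>n\<in>{2*N..<L}. 1 / a n)"
        by (intro sum.union_disjoint) auto
      also have "(\<Sum>n\<in>{N..<2*N}. 1 / a n) \<le> (\<Sum>n\<in>{N..<2*N}. 1 / a N)"
        using a_pos by (intro sum_mono divide_left_mono a_mono mult_pos_pos) auto
      also have "\<dots> = real N / a N" by simp
      also have "(\<Sum>n\<in>{2*N..<L}. 1 / a n) \<le> C * real (2 * N) / a (2 * N)"
        using less.prems False by (intro less.hyps) (auto simp: N0_def)
      also have "\<dots> \<le> C * real (2 * N) / (\<kappa> * a N)"
        using N1[of N] less.prems a_pos[of N] a_pos[of "2 * N"] C \<kappa>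
        by (intro divide_left_mono mult_pos_pos) (auto simp: N0_def pos_less_divide_eq)
      also have "real N / a N + C * real (2 * N) / (\<kappa> * a N) = (1 + 2 * C / \<kappa>) * (real N / a N)"
        using \<kappa> a_pos[of N] by (simp add: field_simps)
      finally show ?thesis using C by simp
    qed
  qed
  then show ?thesis using that[of C N0] C by (auto simp: N0_def)
qed

end

section \<open>The middle block\<close>

text \<open>The geometric sum telescopes after multiplication by \<open>1 - z\<close>. The product
  form includes \<open>z = 1\<close>.\<close>

lemma norm_sum_power_le:
  fixes z :: complex
  assumes "norm z \<le> 1"
  shows "norm (1 - z) * norm (\<Sum>n\<in>{m..<M}. z ^ n) \<le> 2 * norm z ^ m"
proof (cases "m \<le> M")
  case True
  have "(1 - z) * (\<Sum>n\<in>{m..<M}. z ^ n) = (\<Sum>n\<in>{m..<M}. z ^ n - z ^ Suc n)"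
    by (simp add: sum_distrib_left ring_distribs)
  also have "\<dots> = z ^ m - z ^ M"
    using sum_Suc_diff'[OF True, of "\<lambda>n. - (z ^ n)"] by simp
  finally have "norm (1 - z) * norm (\<Sum>n\<in>{m..<M}. z ^ n) = norm (z ^ m - z ^ M)"
    by (simp flip: norm_mult)
  also have "\<dots> \<le> norm z ^ m + norm z ^ M"
    by (metis norm_power norm_triangle_ineq4)
  also have "norm z ^ M \<le> norm z ^ m"
    using True assms by (intro power_decreasing) auto
  finally show ?thesis by simp
qed auto

lemma sum_eq_integral_step:
  fixes f :: "nat \<Rightarrow> complex"
  assumes "0 < A"
  shows "(\<Sum>n\<in>{m..<M}. f n) = A * (CLBINT u. (\<Sum>n\<in>{m..<M}. indicator {real n / A..<(real n + 1) / A} u * f n))"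
proof -
  have len: "real n / A \<le> (real n + 1) / A" for n
    using assms by (simp add: divide_right_mono)
  have int: "integrable lborel (\<lambda>u. indicator {real n / A..<(real n + 1) / A} u * f n)"
    and val: "(CLBINT u. indicator {real n / A..<(real n + 1) / A} u * f n) = f n / A" for n
  proof -
    let ?I = "{real n / A..<(real n + 1) / A}"
    have "integrable lborel (\<lambda>u. indicator ?I u *\<^sub>R f n)"
      using len[of n] by (cases "f n = 0") auto
    moreover have eq: "indicator ?I u *\<^sub>R f n = indicator ?I u * f n" for u
      by (simp add: indicator_def)
    ultimately show "integrable lborel (\<lambda>u. indicator ?I u * f n)" by simp
    have "(CLBINT u. indicator ?I u *\<^sub>R f n) = f n / A"
      using len[of n] assms by (simp add: scaleR_conv_of_real add_divide_distrib)
    then show "(CLBINT u. indicator ?I u * f n) = f n / A" by (simp add: eq)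
  qed
  show ?thesis
    unfolding Bochner_Integration.integral_sum[OF int] val
    using assms by (simp flip: sum_divide_distrib)
qed

lemma sum_indicator_step:
  fixes f :: "nat \<Rightarrow> complex"
  assumes "0 < A"
  shows "(\<Sum>n\<in>{m..<M}. indicator {real n / A..<(real n + 1) / A} u * f n) =
    (if real m / A \<le> u \<and> u < real M / A then f (nat \<lfloor>u * A\<rfloor>) else 0)"
proof -
  have iff: "u \<in> {real n / A..<(real n + 1) / A} \<longleftrightarrow> 0 \<le> u \<and> n = nat \<lfloor>u * A\<rfloor>" for n
  proof
    assume "u \<in> {real n / A..<(real n + 1) / A}"
    then have *: "real n \<le> u * A" "u * A < real n + 1" using assms by (auto simp: field_simps)
    then have "\<lfloor>u * A\<rfloor> = int n" by linarith
    moreover have "0 \<le> u" using *(1) assms by (metis of_nat_0_le_iff order_trans zero_le_mult_iff linorder_not_le)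
    ultimately show "0 \<le> u \<and> n = nat \<lfloor>u * A\<rfloor>" by simp
  next
    assume *: "0 \<le> u \<and> n = nat \<lfloor>u * A\<rfloor>"
    then have "real n = of_int \<lfloor>u * A\<rfloor>" using assms by simp
    then have "real n \<le> u * A" "u * A < real n + 1" by linarith+
    then show "u \<in> {real n / A..<(real n + 1) / A}" using assms by (auto simp: field_simps)
  qed
  have iff2: "real m / A \<le> u \<and> u < real M / A \<longleftrightarrow> 0 \<le> u \<and> nat \<lfloor>u * A\<rfloor> \<in> {m..<M}"
  proof (cases "0 \<le> u")
    case True
    then have n: "real (nat \<lfloor>u * A\<rfloor>) = of_int \<lfloor>u * A\<rfloor>" using assms by simp
    have "real m / A \<le> u \<longleftrightarrow> real m \<le> u * A" "u < real M / A \<longleftrightarrow> u * A < real M"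
      using assms by (auto simp: field_simps)
    moreover have "real m \<le> u * A \<longleftrightarrow> m \<le> nat \<lfloor>u * A\<rfloor>" "u * A < real M \<longleftrightarrow> nat \<lfloor>u * A\<rfloor> < M"
      using True assms by (auto simp: le_nat_floor le_nat_iff nat_less_iff le_floor_iff floor_less_iff)
    ultimately show ?thesis using True by simp
  next
    case False
    moreover have "0 \<le> real m / A" using assms by simp
    ultimately show ?thesis by linarith
  qed
  have "(\<Sum>n\<in>{m..<M}. indicator {real n / A..<(real n + 1) / A} u * f n) =
     (\<Sum>n\<in>{m..<M}. if n = nat \<lfloor>u * A\<rfloor> then (if 0 \<le> u then f n else 0) else 0)"
    by (intro sum.cong refl) (auto simp: indicator_def iff simp del: atLeastLessThan_iff)
  then show ?thesis
    unfolding iff2 by simp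
qed

context stable_domain
begin

definition inv_char :: "real \<Rightarrow> complex" where
  "inv_char v = (CLBINT s. iexp (- (s * v)) * char G s)"

text \<open>For \<open>n\<close> near \<open>u * A x\<close> one has \<open>a n / x \<approx> u powr (1 / \<alpha>)\<close>, and \<open>inv_char / (2 * pi)\<close> is the density of \<open>G\<close>.
  Hence \<open>h / (2 * pi) * middle \<delta> K\<close> is the expected contribution of the indices between \<open>\<delta> * A x\<close> and \<open>K * A x\<close>.\<close>

definition middle :: "real \<Rightarrow> real \<Rightarrow> complex" where
  "middle \<delta> K = (CLBINT u. indicator {\<delta>..K} u * (complex_of_real (u powr (-1 / \<alpha>)) * inv_char (u powr (-1 / \<alpha>))))"

text \<open>The part of the inversion integral with frequencies up to \<open>\<eta>\<close>, after
  the substitution \<open>t = s / a n\<close> and without the factor \<open>1 / a n\<close>;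
  \<open>p\<close> stands for \<open>y / a n\<close>.\<close>

definition rescaled :: "real \<Rightarrow> (real \<Rightarrow> complex) \<Rightarrow> nat \<Rightarrow> real \<Rightarrow> complex" where
  "rescaled \<eta> w n p = (CLBINT s. indicator {- (\<eta> * a n)..\<eta> * a n} s * (w (s / a n) * iexp (- (s * p)) * char F (s / a n) ^ n))"

lemma rescaled_eq:
  "(CLBINT t. indicator {-\<eta>..\<eta>} t * (w t * iexp (- (t * y)) * char F t ^ n)) = rescaled \<eta> w n (y / a n) / a n"
proof -
  have ind: "indicator {-\<eta>..\<eta>} (s / a n) = (indicator {- (\<eta> * a n)..\<eta> * a n} s :: complex)" for s
    using a_pos[of n] by (simp add: indicator_def field_simps)
  show ?thesis
    using lborel_integral_real_affine[of "1 / a n" "\<lambda>t. indicator {-\<eta>..\<eta>} t * (w t * iexp (- (t * y)) * char F t ^ n)" 0] a_pos[of n]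
    by (simp add: rescaled_def ind scaleR_conv_of_real)
qed

lemma norm_rescaled_le:
  assumes w: "\<And>t. norm (w t) \<le> B"
    and D: "\<And>s. \<bar>s\<bar> \<le> \<eta> * a n \<Longrightarrow> cmod (char F (s / a n)) ^ n \<le> D / (1 + s\<^sup>2)" and "0 \<le> D"
  shows "norm (rescaled \<eta> w n p) \<le> B * (LBINT s. D / (1 + s\<^sup>2))"
    and "norm (indicator {- (\<eta> * a n)..\<eta> * a n} s * (w (s / a n) * iexp (- (s * p)) * char F (s / a n) ^ n)) \<le> B * (D / (1 + s\<^sup>2))"
proof -
  have B: "0 \<le> B" using order_trans[OF norm_ge_zero w] .
  show *: "norm (indicator {- (\<eta> * a n)..\<eta> * a n} s * (w (s / a n) * iexp (- (s * p)) * char F (s / a n) ^ n)) \<le> B * (D / (1 + s\<^sup>2))" for s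
  proof (cases "s \<in> {- (\<eta> * a n)..\<eta> * a n}")
    case True
    then have "cmod (w (s / a n)) * cmod (char F (s / a n)) ^ n \<le> B * (D / (1 + s\<^sup>2))"
      using B by (intro mult_mono w D) auto
    then show ?thesis using True by (simp add: norm_mult norm_power)
  qed (use B assms in auto)
  have "norm (rescaled \<eta> w n p) \<le> (LBINT s. B * (D / (1 + s\<^sup>2)))"
    unfolding rescaled_def
  proof (rule order_trans[OF integral_norm_bound integral_mono'])
    show "integrable lborel (\<lambda>s. B * (D / (1 + s\<^sup>2)))"
      using integrable_mult_right[OF integrable_inverse_1_plus_sq, of "B * D"] by simp
  qed (use * B assms in auto)
  then show "norm (rescaled \<eta> w n p) \<le> B * (LBINT s. D / (1 + s\<^sup>2))"
    by (simp only: integral_mult_right_zero)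
qed

text \<open>As \<open>s / a n\<close> tends to 0 and the window grows to the whole line, the weight
  survives only through its value at frequency 0. Different weights can therefore be treated at
  once.\<close>

lemma rescaled_tendsto:
  assumes [measurable]: "w \<in> borel_measurable borel" and w: "\<And>t. norm (w t) \<le> B" and cont: "isCont w 0"
    and \<eta>: "0 < \<eta>" and D: "0 \<le> D" "\<And>n s. n0 \<le> n \<Longrightarrow> \<bar>s\<bar> \<le> \<eta> * a n \<Longrightarrow> cmod (char F (s / a n)) ^ n \<le> D / (1 + s\<^sup>2)"
    and n: "filterlim n sequentially (at_top :: real filter)" and p: "(p \<longlongrightarrow> v) at_top"
  shows "((\<lambda>x. rescaled \<eta> w (n x) (p x)) \<longlongrightarrow> w 0 * inv_char v) at_top"
proof -
  interpret G: real_distribution G by (rule G)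
  note [measurable] = G.char_measurable
  have an: "filterlim (\<lambda>x. a (n x)) at_top at_top"
    by (rule filterlim_compose[OF a_at_top n])
  have "((\<lambda>x. rescaled \<eta> w (n x) (p x)) \<longlongrightarrow> (CLBINT s. 1 * (w 0 * iexp (- (s * v)) * char G s))) at_top"
    unfolding rescaled_def
  proof (rule integral_dominated_convergence_at_top[where w = "\<lambda>s. B * (D / (1 + s\<^sup>2))"])
    show "integrable lborel (\<lambda>s. B * (D / (1 + s\<^sup>2)))"
      using integrable_mult_right[OF integrable_inverse_1_plus_sq, of "B * D"] by simp
    have "\<forall>\<^sub>F x in at_top. n0 \<le> n x"
      using n by (simp add: filterlim_at_top)
    then show "\<forall>\<^sub>F x in at_top. AE s in lborel. norm (indicator {- (\<eta> * a (n x))..\<eta> * a (n x)} s *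
        (w (s / a (n x)) * iexp (- (s * p x)) * char F (s / a (n x)) ^ n x)) \<le> B * (D / (1 + s\<^sup>2))"
      by eventually_elim (intro AE_I2 norm_rescaled_le(2) w D; assumption)
    show "AE s in lborel. ((\<lambda>x. indicator {- (\<eta> * a (n x))..\<eta> * a (n x)} s *
        (w (s / a (n x)) * iexp (- (s * p x)) * char F (s / a (n x)) ^ n x)) \<longlongrightarrow> 1 * (w 0 * iexp (- (s * v)) * char G s)) at_top"
    proof (intro AE_I2 tendsto_mult)
      fix s :: real
      have "\<forall>\<^sub>F x in at_top. \<bar>s\<bar> / \<eta> \<le> a (n x)"
        using an by (simp add: filterlim_at_top)
      then have "\<forall>\<^sub>F x in at_top. indicator {- (\<eta> * a (n x))..\<eta> * a (n x)} s = (1 :: complex)"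
        by eventually_elim (use \<eta> in \<open>auto simp: indicator_def field_simps\<close>)
      then show "((\<lambda>x. indicator {- (\<eta> * a (n x))..\<eta> * a (n x)} s :: complex) \<longlongrightarrow> 1) at_top"
        by (rule tendsto_eventually)
      have "((\<lambda>x. s / a (n x)) \<longlongrightarrow> 0) at_top"
        by (intro tendsto_divide_0[OF tendsto_const] filterlim_at_top_imp_at_infinity an)
      then show "((\<lambda>x. w (s / a (n x))) \<longlongrightarrow> w 0) at_top"
        by (rule isCont_tendsto_compose[OF cont])
      show "((\<lambda>x. iexp (- (s * p x))) \<longlongrightarrow> iexp (- (s * v))) at_top"
        by (intro tendsto_intros p)
      show "((\<lambda>x. char F (s / a (n x)) ^ n x) \<longlongrightarrow> char G s) at_top"
        by (rule filterlim_compose[OF char_lim n])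
    qed
  qed measurable
  then show ?thesis by (simp add: inv_char_def mult.assoc)
qed

section \<open>Block sums at high and low frequencies\<close>

lemma integrable_fourier_power:
  assumes [measurable]: "w \<in> borel_measurable borel" and w: "\<And>t. norm (w t) \<le> B" and supp: "\<And>t. T < \<bar>t\<bar> \<Longrightarrow> w t = 0"
  shows "integrable lborel (\<lambda>t. w t * iexp (- (t * z)) * char F t ^ n)"
proof (rule Bochner_Integration.integrable_bound[OF integrable_indicator_Icc[of "-T" T B]])
  have B: "0 \<le> B" using order_trans[OF norm_ge_zero w] .
  have "norm (w t * iexp (- (t * z)) * char F t ^ n) \<le> norm (indicator {-T..T} t * B)" for t
  proof (cases "\<bar>t\<bar> \<le> T")
    case True
    have "norm (w t) * norm (char F t ^ n) \<le> B * 1"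
      using B by (intro mult_mono w) (auto simp: norm_power power_le_one norm_char_le_1)
    moreover have "t \<in> {-T..T}" using True by auto
    ultimately show ?thesis using B by (simp add: norm_mult)
  qed (auto simp: supp)
  then show "AE t in lborel. norm (w t * iexp (- (t * z)) * char F t ^ n) \<le> norm (indicator {-T..T} t * B)" by simp
qed measurable

text \<open>Away from frequency \<open>0\<close> the geometric sum is at most \<open>C * \<bar>\<phi>\<bar> ^ m\<close>, whose integral is of order \<open>1 / a m\<close>.
  This also covers frequencies where \<open>\<bar>\<phi>\<bar> = 1\<close> but \<open>\<phi> \<noteq> 1\<close>, as happens for shifted lattices.\<close>

lemma high_frequencies_negligible:
  assumes [measurable]: "w \<in> borel_measurable borel" and w: "\<And>t. norm (w t) \<le> B" and \<eta>: "0 < \<eta>"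
    and supp: "\<And>t. w t \<noteq> 0 \<Longrightarrow> \<eta> \<le> \<bar>t\<bar> \<and> \<bar>t\<bar> \<le> T"
    and ne: "\<And>t. 0 < \<bar>t\<bar> \<Longrightarrow> \<bar>t\<bar> \<le> T \<Longrightarrow> char F t \<noteq> 1" and \<delta>: "0 < \<delta>"
  shows "((\<lambda>x. complex_of_real (x / A x) * (\<Sum>n\<in>{idx \<delta> x..<M x}.
      (CLBINT t. w t * iexp (- (t * y x)) * char F t ^ n))) \<longlongrightarrow> 0) at_top"
proof -
  have B: "0 \<le> B" using order_trans[OF norm_ge_zero w] .
  obtain c where c: "0 < c" "\<And>t. \<eta> \<le> \<bar>t\<bar> \<Longrightarrow> \<bar>t\<bar> \<le> T \<Longrightarrow> c \<le> norm (1 - char F t)"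
  proof (cases "{t. \<eta> \<le> \<bar>t\<bar> \<and> \<bar>t\<bar> \<le> T} = {}")
    case True
    then show ?thesis using that[of 1] by auto
  next
    case False
    have "{t. \<eta> \<le> \<bar>t\<bar> \<and> \<bar>t\<bar> \<le> T} = {-T..T} \<inter> {t. \<eta> \<le> \<bar>t\<bar>}" by auto
    moreover have "compact ({-T..T} \<inter> {t. \<eta> \<le> \<bar>t\<bar>})"
      by (intro compact_Int_closed compact_Icc closed_Collect_le continuous_intros)
    ultimately have "compact {t. \<eta> \<le> \<bar>t\<bar> \<and> \<bar>t\<bar> \<le> T}" by simp
    moreover have "continuous_on {t. \<eta> \<le> \<bar>t\<bar> \<and> \<bar>t\<bar> \<le> T} (\<lambda>t. norm (1 - char F t))"
      by (intro continuous_intros continuous_at_imp_continuous_on) (simp add: isCont_char)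
    ultimately obtain t0 where t0: "\<eta> \<le> \<bar>t0\<bar>" "\<bar>t0\<bar> \<le> T"
      "\<And>t. \<eta> \<le> \<bar>t\<bar> \<and> \<bar>t\<bar> \<le> T \<Longrightarrow> norm (1 - char F t0) \<le> norm (1 - char F t)"
      using False continuous_attains_inf[of "{t. \<eta> \<le> \<bar>t\<bar> \<and> \<bar>t\<bar> \<le> T}" "\<lambda>t. norm (1 - char F t)"] by blast
    moreover have "0 < norm (1 - char F t0)"
      using ne[of t0] t0 \<eta> by simp
    ultimately show ?thesis using that by blast
  qed
  obtain C where C: "0 < C" "\<And>n. (LBINT t. indicator {-T..T} t * cmod (char F t) ^ n) \<le> C / a n"
    by (rule integral_char_power_le[of T]) blast
  have int: "integrable lborel (\<lambda>t. w t * iexp (- (t * z)) * char F t ^ n)" for z n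
    using w supp by (intro integrable_fourier_power[where B=B and T=T]) force+
  have bound: "norm (\<Sum>n\<in>{m..<M x}. (CLBINT t. w t * iexp (- (t * y x)) * char F t ^ n)) \<le> 2 * B / c * C / a m" for x m
  proof -
    have "(\<Sum>n\<in>{m..<M x}. (CLBINT t. w t * iexp (- (t * y x)) * char F t ^ n)) =
       (CLBINT t. (\<Sum>n\<in>{m..<M x}. w t * iexp (- (t * y x)) * char F t ^ n))"
      by (rule Bochner_Integration.integral_sum[symmetric]) (rule int)
    also have "\<dots> = (CLBINT t. w t * iexp (- (t * y x)) * (\<Sum>n\<in>{m..<M x}. char F t ^ n))"
      by (simp add: sum_distrib_left)
    also have "norm \<dots> \<le> (LBINT t. 2 * B / c * (indicator {-T..T} t * cmod (char F t) ^ m))"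
    proof (rule order_trans[OF integral_norm_bound integral_mono'])
      show "integrable lborel (\<lambda>t. 2 * B / c * (indicator {-T..T} t * cmod (char F t) ^ m))"
        by (intro integrable_mult_right Bochner_Integration.integrable_bound[OF integrable_indicator_Icc[of "-T" T 1]])
           (auto simp: abs_mult power_le_one norm_char_le_1 indicator_def)
      show "norm (w t * iexp (- (t * y x)) * (\<Sum>n\<in>{m..<M x}. char F t ^ n))
          \<le> 2 * B / c * (indicator {-T..T} t * cmod (char F t) ^ m)" for t
      proof (cases "w t = 0")
        case False
        then have t: "\<eta> \<le> \<bar>t\<bar>" "\<bar>t\<bar> \<le> T" using supp by auto
        have "c * norm (\<Sum>n\<in>{m..<M x}. char F t ^ n) \<le> norm (1 - char F t) * norm (\<Sum>n\<in>{m..<M x}. char F t ^ n)"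
          using c(2) t by (intro mult_right_mono) auto
        also have "\<dots> \<le> 2 * cmod (char F t) ^ m"
          by (rule norm_sum_power_le[OF norm_char_le_1])
        finally have "norm (\<Sum>n\<in>{m..<M x}. char F t ^ n) \<le> 2 * cmod (char F t) ^ m / c"
          using c(1) by (simp add: field_simps)
        then have "norm (w t) * norm (\<Sum>n\<in>{m..<M x}. char F t ^ n) \<le> B * (2 * cmod (char F t) ^ m / c)"
          using w B by (intro mult_mono) auto
        moreover have "t \<in> {-T..T}" using t by auto
        ultimately show ?thesis by (simp add: norm_mult mult_ac)
      qed (use B c in simp)
    qed (use B c in auto)
    also have "\<dots> \<le> 2 * B / c * (C / a m)"
      unfolding integral_mult_right_zero using B c by (intro mult_left_mono C(2)) auto
    finally show ?thesis by simp
  qed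
  \<comment> \<open>The lowest index of the block is of order \<open>A x\<close>, so its norming
    constant is of order \<open>x\<close>. Against the prefactor \<open>x / A x\<close> only
    \<open>1 / A x\<close> remains.\<close>
  have le: "\<forall>\<^sub>F x in at_top. norm (complex_of_real (x / A x) * (\<Sum>n\<in>{idx \<delta> x..<M x}. (CLBINT t. w t * iexp (- (t * y x)) * char F t ^ n)))
     \<le> 2 * B / c * C * (x / a (idx \<delta> x)) * (1 / A x)"
    using eventually_gt_at_top[of 0]
  proof eventually_elim
    case (elim x)
    have "x / A x * norm (\<Sum>n\<in>{idx \<delta> x..<M x}. (CLBINT t. w t * iexp (- (t * y x)) * char F t ^ n))
        \<le> x / A x * (2 * B / c * C / a (idx \<delta> x))"
      using elim A_pos[of x] by (intro mult_left_mono bound) auto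
    then show ?case using elim A_pos[of x] by (simp add: norm_mult norm_divide mult_ac)
  qed
  have "((\<lambda>x. 2 * B / c * C * (x / a (idx \<delta> x)) * (1 / A x)) \<longlongrightarrow> 2 * B / c * C * \<delta> powr (-1 / \<alpha>) * 0) at_top"
    by (intro tendsto_mult tendsto_const x_over_a \<delta> tendsto_divide_0[OF tendsto_const] filterlim_at_top_imp_at_infinity A_at_top)
  then have "((\<lambda>x. 2 * B / c * C * (x / a (idx \<delta> x)) * (1 / A x)) \<longlongrightarrow> 0) at_top" by simp
  with le show ?thesis by (rule Lim_null_comparison)
qed

text \<open>The sum over the block is the integral over \<open>u = n / A x\<close> of a step function.\<close>

lemma low_frequencies_tendsto:
  assumes w_meas: "w \<in> borel_measurable borel" and w: "\<And>t. norm (w t) \<le> B" and cont: "isCont w 0"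
    and \<eta>: "0 < \<eta>" and D: "0 \<le> D" "\<And>n s. n0 \<le> n \<Longrightarrow> \<bar>s\<bar> \<le> \<eta> * a n \<Longrightarrow> cmod (char F (s / a n)) ^ n \<le> D / (1 + s\<^sup>2)"
    and y: "((\<lambda>x. y x / x) \<longlongrightarrow> 1) at_top" and \<delta>K: "0 < \<delta>" "\<delta> < K"
  shows "((\<lambda>x. complex_of_real (x / A x) * (\<Sum>n\<in>{idx \<delta> x..<idx K x}. rescaled \<eta> w n (y x / a n) / a n)) \<longlongrightarrow> w 0 * middle \<delta> K) at_top"
proof -
  have B: "0 \<le> B" using order_trans[OF norm_ge_zero w] .
  have K: "0 < K" using \<delta>K by simp
  define f where "f = (\<lambda>x n. complex_of_real (x / a n) * rescaled \<eta> w n (y x / a n))"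
  define S where "S = (\<lambda>x u. \<Sum>n\<in>{idx \<delta> x..<idx K x}. indicator {real n / A x..<(real n + 1) / A x} u * f x n)"
  have S_eq: "S x u = (if real (idx \<delta> x) / A x \<le> u \<and> u < real (idx K x) / A x then f x (idx u x) else 0)" for x u
    unfolding S_def by (rule sum_indicator_step[OF A_pos])
  define E where "E = B * (LBINT s. D / (1 + s\<^sup>2))"
  have E: "0 \<le> E" unfolding E_def using B D by (intro mult_nonneg_nonneg integral_nonneg_AE AE_I2) auto
  have "((\<lambda>x. CLBINT u. S x u) \<longlongrightarrow> (CLBINT u. w 0 * (indicator {\<delta>..K} u * (complex_of_real (u powr (-1 / \<alpha>)) * inv_char (u powr (-1 / \<alpha>)))))) at_top"
  proof (rule integral_dominated_convergence_at_top[where w = "\<lambda>u. indicator {0..K} u * ((\<delta> powr (-1 / \<alpha>) + 1) * E)"])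
    \<comment> \<open>Positivity of \<open>\<delta>\<close> is what yields domination: every index
      of the block is at least \<open>idx \<delta> x\<close>, hence \<open>x / a n\<close> stays
      bounded.\<close>
    have ev1: "\<forall>\<^sub>F x in at_top. x / a (idx \<delta> x) < \<delta> powr (-1 / \<alpha>) + 1"
      by (rule order_tendstoD(2)[OF x_over_a]) (use \<delta>K in auto)
    have ev2: "\<forall>\<^sub>F x in at_top. n0 \<le> idx \<delta> x"
      using nat_floor_at_top[OF \<delta>K(1)] by (simp add: filterlim_at_top)
    show "\<forall>\<^sub>F x in at_top. AE u in lborel. norm (S x u) \<le> indicator {0..K} u * ((\<delta> powr (-1 / \<alpha>) + 1) * E)"
      using ev1 ev2 eventually_gt_at_top[of 0]
    proof eventually_elim
      case (elim x)
      show ?case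
      proof (rule AE_I2)
        fix u
        show "norm (S x u) \<le> indicator {0..K} u * ((\<delta> powr (-1 / \<alpha>) + 1) * E)"
        proof (cases "real (idx \<delta> x) / A x \<le> u \<and> u < real (idx K x) / A x")
          case True
          have "0 \<le> real (idx \<delta> x) / A x" using A_pos[of x] by simp
          moreover have "real (idx K x) / A x \<le> K"
            using K A_pos[of x] by (simp add: pos_divide_le_eq)
          ultimately have u: "0 \<le> u" "u \<le> K" using True by linarith+
          have "real (idx \<delta> x) \<le> u * A x" using True A_pos[of x] by (simp add: field_simps)
          then have mn: "idx \<delta> x \<le> idx u x" by (rule le_nat_floor)
          have "norm (f x (idx u x)) = x / a (idx u x) * norm (rescaled \<eta> w (idx u x) (y x / a (idx u x)))"
            using elim a_pos[of "idx u x"] by (simp add: f_def norm_mult norm_divide)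
          also have "\<dots> \<le> (\<delta> powr (-1 / \<alpha>) + 1) * E"
          proof (rule mult_mono)
            have "x / a (idx u x) \<le> x / a (idx \<delta> x)"
              using elim mn a_pos by (intro divide_left_mono a_mono mult_pos_pos) auto
            then show "x / a (idx u x) \<le> \<delta> powr (-1 / \<alpha>) + 1" using elim by linarith
            show "norm (rescaled \<eta> w (idx u x) (y x / a (idx u x))) \<le> E"
              unfolding E_def using elim mn by (intro norm_rescaled_le(1) w D) auto
          qed (auto simp: add_nonneg_nonneg)
          finally show ?thesis using True u by (simp add: S_eq)
        next
          case False
          then have "S x u = 0" unfolding S_eq by (rule if_not_P)
          then show ?thesis using E by (simp add: add_nonneg_nonneg)
        qed
      qed
    qed
    \<comment> \<open>At the two end points the rounding of the indices leaves convergence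
      undecided; they form a null set.\<close>
    show "AE u in lborel. ((\<lambda>x. S x u) \<longlongrightarrow> w 0 * (indicator {\<delta>..K} u * (complex_of_real (u powr (-1 / \<alpha>)) * inv_char (u powr (-1 / \<alpha>))))) at_top"
      using AE_lborel_singleton[of \<delta>] AE_lborel_singleton[of K]
    proof eventually_elim
      case (elim u)
      have mA: "((\<lambda>x. real (idx \<delta> x) / A x) \<longlongrightarrow> \<delta>) at_top" and MA: "((\<lambda>x. real (idx K x) / A x) \<longlongrightarrow> K) at_top"
        using \<delta>K by (intro nat_floor_ratio; simp)+
      consider "u < \<delta>" | "\<delta> < u" "u < K" | "K < u" using elim by linarith
      then show ?case
      proof cases
        case 1
        then have "\<forall>\<^sub>F x in at_top. S x u = 0"
          using order_tendstoD(1)[OF mA 1] by (auto simp: S_eq elim!: eventually_mono)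
        then show ?thesis using 1 by (simp add: tendsto_eventually)
      next
        case 3
        then have "\<forall>\<^sub>F x in at_top. S x u = 0"
          using order_tendstoD(2)[OF MA 3] by (auto simp: S_eq elim!: eventually_mono)
        then show ?thesis using 3 \<delta>K by (simp add: tendsto_eventually)
      next
        case 2
        then have u: "0 < u" using \<delta>K by linarith
        have "((\<lambda>x. (y x / x) * (x / a (idx u x))) \<longlongrightarrow> 1 * u powr (-1 / \<alpha>)) at_top"
          by (intro tendsto_mult y x_over_a u)
        moreover have "\<forall>\<^sub>F x in at_top. (y x / x) * (x / a (idx u x)) = y x / a (idx u x)"
          using eventually_gt_at_top[of 0] by eventually_elim simp
        ultimately have p: "((\<lambda>x. y x / a (idx u x)) \<longlongrightarrow> u powr (-1 / \<alpha>)) at_top"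
          by (simp add: Lim_transform_eventually)
        have "((\<lambda>x. f x (idx u x)) \<longlongrightarrow> complex_of_real (u powr (-1 / \<alpha>)) * (w 0 * inv_char (u powr (-1 / \<alpha>)))) at_top"
          unfolding f_def
          by (intro tendsto_mult tendsto_of_real x_over_a u
              rescaled_tendsto[OF w_meas w cont \<eta> D nat_floor_at_top[OF u] p])
        moreover have "\<forall>\<^sub>F x in at_top. f x (idx u x) = S x u"
          using order_tendstoD(2)[OF mA 2(1)] order_tendstoD(1)[OF MA 2(2)]
          by eventually_elim (simp add: S_eq)
        ultimately have "((\<lambda>x. S x u) \<longlongrightarrow> complex_of_real (u powr (-1 / \<alpha>)) * (w 0 * inv_char (u powr (-1 / \<alpha>)))) at_top"
          by (rule Lim_transform_eventually)
        then show ?thesis using 2 by (simp add: mult_ac)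
      qed
    qed
    show "S x \<in> borel_measurable lborel" for x
      unfolding S_def by measurable
    interpret G: real_distribution G by (rule G)
    note [measurable] = G.char_measurable
    have [measurable]: "inv_char \<in> borel_measurable borel"
      unfolding inv_char_def[abs_def] by measurable
    show "(\<lambda>u. w 0 * (indicator {\<delta>..K} u * (complex_of_real (u powr (-1 / \<alpha>)) * inv_char (u powr (-1 / \<alpha>))))) \<in> borel_measurable lborel"
      by measurable
  qed (rule integrable_indicator_Icc)
  then have low: "((\<lambda>x. CLBINT u. S x u) \<longlongrightarrow> w 0 * middle \<delta> K) at_top"
    by (simp add: middle_def)
  have "complex_of_real (x / A x) * (\<Sum>n\<in>{idx \<delta> x..<idx K x}. rescaled \<eta> w n (y x / a n) / a n) = (CLBINT u. S x u)" for x
  proof -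
    have "(\<Sum>n\<in>{idx \<delta> x..<idx K x}. f x n) = A x * (CLBINT u. S x u)"
      unfolding S_def by (rule sum_eq_integral_step[OF A_pos])
    moreover have "complex_of_real (x / A x) * (\<Sum>n\<in>{idx \<delta> x..<idx K x}. rescaled \<eta> w n (y x / a n) / a n) =
        (\<Sum>n\<in>{idx \<delta> x..<idx K x}. f x n) / A x"
      by (simp add: f_def sum_distrib_left sum_divide_distrib mult_ac)
    ultimately show ?thesis using A_pos[of x] by simp
  qed
  with low show ?thesis by simp
qed

text \<open>The weight is cut at the radius \<open>\<eta>\<close> up to which the uniform majorant
  is available. The outer part vanishes near 0, the only zero of \<open>1 - \<phi>\<close> in the
  window.\<close>

lemma block_sum_tendsto:
  assumes w_meas[measurable]: "w \<in> borel_measurable borel" and w: "\<And>t. norm (w t) \<le> B" and cont: "isCont w 0"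
    and supp: "\<And>t. T < \<bar>t\<bar> \<Longrightarrow> w t = 0" and ne: "\<And>t. 0 < \<bar>t\<bar> \<Longrightarrow> \<bar>t\<bar> \<le> T \<Longrightarrow> char F t \<noteq> 1"
    and y: "((\<lambda>x. y x / x) \<longlongrightarrow> 1) at_top" and \<delta>K: "0 < \<delta>" "\<delta> < K"
  shows "((\<lambda>x. complex_of_real (x / A x) * (\<Sum>n\<in>{idx \<delta> x..<idx K x}.
      (CLBINT t. w t * iexp (- (t * y x)) * char F t ^ n))) \<longlongrightarrow> w 0 * middle \<delta> K) at_top"
proof -
  obtain \<eta> D n0 where D: "\<eta> > 0" "D > 0" "n0 > 0"
    "\<And>n s. n0 \<le> n \<Longrightarrow> \<bar>s\<bar> \<le> \<eta> * a n \<Longrightarrow> cmod (char F (s / a n)) ^ n \<le> D / (1 + s\<^sup>2)"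
    by (rule norm_char_power_bound) blast
  have B: "0 \<le> B" using order_trans[OF norm_ge_zero w] .
  define w1 where "w1 = (\<lambda>t. indicator {-\<eta>..\<eta>} t * w t)"
  define w2 where "w2 = (\<lambda>t. w t - w1 t)"
  have meas[measurable]: "w1 \<in> borel_measurable borel" "w2 \<in> borel_measurable borel"
    unfolding w1_def w2_def by measurable
  have bd: "norm (w1 t) \<le> B" "norm (w2 t) \<le> B" for t
    using w[of t] B by (auto simp: w2_def w1_def indicator_def)
  have supp2: "w2 t \<noteq> 0 \<Longrightarrow> \<eta> \<le> \<bar>t\<bar> \<and> \<bar>t\<bar> \<le> T" for t
    using supp[of t] by (cases "T < \<bar>t\<bar>") (auto simp: w2_def w1_def indicator_def split: if_splits)
  have int1: "integrable lborel (\<lambda>t. w1 t * iexp (- (t * z)) * char F t ^ n)"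
    and int2: "integrable lborel (\<lambda>t. w2 t * iexp (- (t * z)) * char F t ^ n)" for z n
    using bd supp by (intro integrable_fourier_power[where B=B and T=T] meas; force simp: w1_def w2_def)+
  have split: "(CLBINT t. w t * iexp (- (t * z)) * char F t ^ n) =
      rescaled \<eta> w n (z / a n) / a n + (CLBINT t. w2 t * iexp (- (t * z)) * char F t ^ n)" for z n
  proof -
    have "(CLBINT t. w t * iexp (- (t * z)) * char F t ^ n) =
       (CLBINT t. w1 t * iexp (- (t * z)) * char F t ^ n + w2 t * iexp (- (t * z)) * char F t ^ n)"
      by (simp add: w2_def ring_distribs)
    also have "\<dots> = (CLBINT t. w1 t * iexp (- (t * z)) * char F t ^ n) + (CLBINT t. w2 t * iexp (- (t * z)) * char F t ^ n)"
      by (rule Bochner_Integration.integral_add[OF int1 int2])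
    also have "(CLBINT t. w1 t * iexp (- (t * z)) * char F t ^ n) = rescaled \<eta> w n (z / a n) / a n"
      unfolding rescaled_eq[symmetric] w1_def by (simp add: mult.assoc)
    finally show ?thesis .
  qed
  show ?thesis
    using tendsto_add[OF low_frequencies_tendsto[OF w_meas w cont D(1) less_imp_le[OF D(2)] D(4) y \<delta>K]
        high_frequencies_negligible[OF meas(2) bd(2) D(1) supp2 ne \<delta>K(1)]]
    unfolding split sum.distrib ring_distribs by simp
qed

end

section \<open>Hitting intervals: the lattice case\<close>

text \<open>Every interval to the right of \<open>x\<close> has positive measure and so contains
  points of equality; a sequence of them converges to \<open>x\<close>.\<close>

lemma AE_lborel_imp_eq:
  fixes f g :: "real \<Rightarrow> complex"
  assumes ae: "AE x in lborel. f x = g x" and cont: "isCont f x" "isCont g x"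
  shows "f x = g x"
proof -
  have "\<exists>y. x < y \<and> y < x + 1 / real (Suc k) \<and> f y = g y" for k
  proof (rule ccontr)
    assume "\<not> (\<exists>y. x < y \<and> y < x + 1 / real (Suc k) \<and> f y = g y)"
    with ae have "AE y in lborel. y \<notin> {x<..<x + 1 / real (Suc k)}"
      by (auto elim!: eventually_mono)
    then have "emeasure lborel {x<..<x + 1 / real (Suc k)} = 0"
      by (subst (asm) AE_iff_measurable[of "{x<..<x + 1 / real (Suc k)}"]) auto
    then show False by simp
  qed
  then obtain Y where Y: "\<And>k. x < Y k" "\<And>k. Y k < x + 1 / real (Suc k)" "\<And>k. f (Y k) = g (Y k)"
    by metis
  have "Y \<longlonglongrightarrow> x"
  proof (rule tendsto_sandwich[of "\<lambda>_. x" _ _ "\<lambda>k. x + 1 / real (Suc k)"])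
    have "(\<lambda>k. x + 1 / real (Suc k)) \<longlonglongrightarrow> x + 0"
      by (intro tendsto_intros LIMSEQ_Suc[OF lim_1_over_n])
    then show "(\<lambda>k. x + 1 / real (Suc k)) \<longlonglongrightarrow> x" by simp
  qed (use Y in \<open>auto intro!: always_eventually less_imp_le\<close>)
  from isCont_tendsto_compose[OF cont(1) this] isCont_tendsto_compose[OF cont(2) this]
  show ?thesis using Y(3) by (simp add: LIMSEQ_unique)
qed

text \<open>The mean of the nonnegative variable \<open>1 - cos (t * X)\<close> is
  \<open>1 - Re (char M t)\<close>, so it vanishes exactly if \<open>t * X\<close> is almost surely
  a multiple of \<open>2 * pi\<close>. A shifted lattice would merely give modulus 1.\<close>

lemma char_eq_1_iff_lattice:
  assumes "real_distribution M" and t: "t \<noteq> 0"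
  shows "char M t = 1 \<longleftrightarrow> (AE x in M. x \<in> range (\<lambda>k::int. 2 * pi / t * of_int k))"
proof -
  interpret M: real_distribution M by fact
  have iff: "x \<in> range (\<lambda>k::int. 2 * pi / t * of_int k) \<longleftrightarrow> cos (t * x) = 1" for x
  proof -
    have "x = 2 * pi / t * of_int k \<longleftrightarrow> t * x = of_int k * 2 * pi" for k :: int
      using t by (auto simp: field_simps)
    then show ?thesis by (auto simp: cos_one_2pi_int image_iff)
  qed
  have icos: "integrable M (\<lambda>x. cos (t * x))"
    by (intro M.integrable_const_bound[where B=1]) auto
  have Re: "Re (char M t) = (\<integral>x. cos (t * x) \<partial>M)"
  proof -
    have "integrable M (\<lambda>x. iexp (t * x))" by (intro M.integrable_const_bound[where B=1]) auto
    from integral_Re[OF this] show ?thesis by (simp add: char_def Re_exp)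
  qed
  show ?thesis
    unfolding iff
  proof
    assume "char M t = 1"
    then have "(\<integral>x. 1 - cos (t * x) \<partial>M) = 0"
      using icos Re M.prob_space by simp
    then have "AE x in M. 1 - cos (t * x) = 0"
      using icos by (subst (asm) integral_nonneg_eq_0_iff_AE) auto
    then show "AE x in M. cos (t * x) = 1" by (auto elim!: eventually_mono)
  next
    assume ae: "AE x in M. cos (t * x) = 1"
    have "iexp (t * x) = 1" if "cos (t * x) = 1" for x
    proof -
      have "(sin (t * x))\<^sup>2 = 0" using sin_cos_squared_add[of "t * x"] that by simp
      then have "sin (t * x) = 0" by simp
      then show ?thesis using that by (simp add: complex_eq_iff Re_exp Im_exp)
    qed
    with ae have "AE x in M. iexp (t * x) = 1" by (auto elim!: eventually_mono)
    then have "char M t = (CLINT x|M. 1)"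
      unfolding char_def by (intro integral_cong_AE) auto
    then show "char M t = 1" using M.prob_space by simp
  qed
qed

lemma lattice_on_iff:
  assumes "real_distribution F" "0 < h"
  shows "lattice_on F h \<longleftrightarrow> char F (2 * pi / h) = 1"
proof -
  interpret real_distribution F by fact
  have "countable (range (\<lambda>k::int. h * of_int k))" by (rule countable_image) simp
  then have meas: "range (\<lambda>k::int. h * of_int k) \<in> sets F"
    unfolding events_eq_borel by (rule sets.countable[rotated]) (rule borel_singleton, rule sets.empty_sets)
  have "lattice_on F h \<longleftrightarrow> prob (range (\<lambda>k::int. h * of_int k)) = 1"
    using assms(2) by (simp only: lattice_on_def simp_thms)
  also have "\<dots> \<longleftrightarrow> (AE x in F. x \<in> range (\<lambda>k::int. h * of_int k))"
    by (rule prob_eq_1[OF meas])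
  also have "\<dots> \<longleftrightarrow> (AE x in F. x \<in> range (\<lambda>k::int. 2 * pi / (2 * pi / h) * of_int k))"
    using assms(2) by simp
  also have "\<dots> \<longleftrightarrow> char F (2 * pi / h) = 1"
    using assms(2) by (intro char_eq_1_iff_lattice[OF assms(1), symmetric]) simp
  finally show ?thesis .
qed

text \<open>Orthogonality of the characters over one period of the dual lattice.\<close>

lemma integral_iexp_lattice:
  fixes h :: real and j :: int
  assumes "0 < h"
  shows "(CLBINT t. complex_of_real (h * indicator {- (pi / h)..pi / h} t) * iexp (t * (h * of_int j))) = (if j = 0 then 2 * pi else 0)"
proof (cases "j = 0")
  case True
  have "(CLBINT t. complex_of_real (h * indicator {- (pi / h)..pi / h} t)) = complex_of_real (LBINT t. h * indicator {- (pi / h)..pi / h} t)"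
    by (rule integral_complex_of_real)
  also have "(LBINT t. h * indicator {- (pi / h)..pi / h} t) = 2 * pi"
    using assms by simp
  finally show ?thesis using True by simp
next
  case False
  let ?y = "h * of_int j"
  have y: "?y \<noteq> 0" using False assms by simp
  have "((\<lambda>t. iexp (t * ?y) * (1 / (\<i> * ?y))) has_vector_derivative iexp (t * ?y)) (at t within {- (pi / h)..pi / h})" for t
    by (rule has_vector_derivative_eq_rhs[OF has_vector_derivative_mult_left[OF has_vector_derivative_iexp_mult]])
       (use y in \<open>simp add: field_simps\<close>)
  then have "(LBINT t. indicator {- (pi / h)..pi / h} t *\<^sub>R iexp (t * ?y)) =
      iexp (pi / h * ?y) * (1 / (\<i> * ?y)) - iexp (- (pi / h) * ?y) * (1 / (\<i> * ?y))"
    using assms by (intro integral_FTC_Icc) (auto intro!: continuous_intros)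
  also have "iexp (pi / h * ?y) = iexp (- (pi / h) * ?y)"
  proof -
    have e: "pi / h * ?y = pi * of_int j" using assms by simp
    have "sin (pi * of_int j) = 0" by (metis mult.commute sin_zero_iff_int2)
    then show ?thesis unfolding mult_minus_left e by (simp add: complex_eq_iff Re_exp Im_exp)
  qed
  finally have "(LBINT t. indicator {- (pi / h)..pi / h} t *\<^sub>R iexp (t * ?y)) = 0" by simp
  then have "complex_of_real h * (LBINT t. indicator {- (pi / h)..pi / h} t *\<^sub>R iexp (t * ?y)) = 0" by simp
  then show ?thesis using False by (simp add: scaleR_conv_of_real mult.assoc flip: integral_mult_right_zero)
qed

text \<open>The atoms are Fourier coefficients of the periodic function \<open>char M\<close>, and
  integration over one period isolates a single atom.\<close>

lemma measure_lattice_point: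
  assumes M: "real_distribution M" and h: "0 < h" and lat: "char M (2 * pi / h) = 1"
  shows "complex_of_real (measure M {h * of_int k}) =
    1 / (2 * pi) * (CLBINT t. complex_of_real (h * indicator {- (pi / h)..pi / h} t) * iexp (- (t * (h * of_int k))) * char M t)"
proof -
  interpret M: real_distribution M by fact
  let ?y = "h * of_int k"
  let ?w = "\<lambda>t. complex_of_real (h * indicator {- (pi / h)..pi / h} t) * iexp (- (t * ?y))"
  have "AE z in M. z \<in> range (\<lambda>j::int. h * of_int j)"
    using char_eq_1_iff_lattice[OF M, of "2 * pi / h"] lat h by simp
  then have ae: "AE z in M. (CLBINT t. ?w t * iexp (t * z)) = 2 * pi * indicator {?y} z"
  proof eventually_elim
    case (elim z)
    then obtain j :: int where z: "z = h * of_int j" by auto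
    have "(CLBINT t. ?w t * iexp (t * z)) =
      (CLBINT t. complex_of_real (h * indicator {- (pi / h)..pi / h} t) * iexp (t * (h * of_int (j - k))))"
      by (intro Bochner_Integration.integral_cong refl) (simp add: z exp_add[symmetric] algebra_simps exp_diff exp_minus divide_inverse)
    also have "\<dots> = 2 * pi * indicator {?y} z"
      unfolding integral_iexp_lattice[OF h] using h by (auto simp: z indicator_def)
    finally show ?case .
  qed
  have int: "integrable lborel ?w"
    by (rule Bochner_Integration.integrable_bound[OF integrable_indicator_Icc[of "- (pi / h)" "pi / h" h]])
       (use h in \<open>auto simp: norm_mult abs_mult\<close>)
  have "(CLBINT t. ?w t * char M t) = (\<integral>z. (CLBINT t. ?w t * iexp (t * z)) \<partial>M)"
    by (rule integral_fourier_swap[OF M int, symmetric])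
  also have "\<dots> = (CLINT z|M. complex_of_real (2 * pi * indicator {?y} z))"
    by (rule integral_cong_AE) (use ae in \<open>auto elim!: eventually_mono simp: indicator_def split: if_splits\<close>)
  also have "\<dots> = complex_of_real (\<integral>z. 2 * pi * indicator {?y} z \<partial>M)"
    by (rule integral_complex_of_real)
  also have "\<dots> = 2 * pi * measure M {?y}" by simp
  finally show ?thesis by simp
qed

context stable_domain
begin

definition block_hits :: "real \<Rightarrow> real \<Rightarrow> real \<Rightarrow> real \<Rightarrow> real" where
  "block_hits h \<delta> K x = x / A x * (\<Sum>n\<in>{idx \<delta> x..<idx K x}. measure (conv_pow F n) {x<..x+h})"

text \<open>A half-open interval of length \<open>h\<close> contains exactly one lattice point
  \<open>y x\<close>, and \<open>y x / x\<close> tends to 1, so the rounding is invisible in the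
  limit.\<close>

lemma block_hits_lattice:
  assumes h: "0 < h" and lat: "char F (2 * pi / h) = 1" and ne: "\<And>t. 0 < \<bar>t\<bar> \<Longrightarrow> \<bar>t\<bar> \<le> pi / h \<Longrightarrow> char F t \<noteq> 1"
    and \<delta>K: "0 < \<delta>" "\<delta> < K"
  shows "((\<lambda>x. complex_of_real (block_hits h \<delta> K x)) \<longlongrightarrow> h / (2 * pi) * middle \<delta> K) at_top"
proof -
  \<comment> \<open>The interval is open at \<open>x\<close>, hence floor plus one and not the
    ceiling: if \<open>x\<close> is a lattice point, the next one is meant.\<close>
  define k where "k = (\<lambda>x. \<lfloor>x / h\<rfloor> + 1)"
  define y where "y = (\<lambda>x. h * of_int (k x))"
  let ?w = "\<lambda>t. complex_of_real (h * indicator {- (pi / h)..pi / h} t)"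
  have y: "x < y x" "y x \<le> x + h" for x
  proof -
    have *: "x / h < of_int (k x)" "of_int (k x) \<le> x / h + 1" by (auto simp: k_def)
    show "x < y x" using *(1) h by (simp add: y_def field_simps)
    show "y x \<le> x + h" using mult_left_mono[OF *(2), of h] h by (simp add: y_def ring_distribs)
  qed
  have yx: "((\<lambda>x. y x / x) \<longlongrightarrow> 1) at_top"
  proof (rule tendsto_sandwich[of "\<lambda>x. 1" _ _ "\<lambda>x. 1 + h / x"])
    show "\<forall>\<^sub>F x in at_top. 1 \<le> y x / x" "\<forall>\<^sub>F x in at_top. y x / x \<le> 1 + h / x"
      using eventually_gt_at_top[of 0] by (eventually_elim, use y in \<open>auto simp: field_simps less_imp_le\<close>)+
    have "((\<lambda>x. 1 + h / x) \<longlongrightarrow> 1 + 0) at_top"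
      by (intro tendsto_intros tendsto_divide_0[OF tendsto_const] filterlim_at_top_imp_at_infinity filterlim_ident)
    then show "((\<lambda>x. 1 + h / x) \<longlongrightarrow> 1) at_top" by simp
  qed simp
  have cont: "isCont ?w 0"
  proof -
    have "\<forall>\<^sub>F t in nhds 0. t \<in> {- (pi / h)<..<pi / h}"
      using h by (intro eventually_nhds_in_open) auto
    then have "\<forall>\<^sub>F t in nhds 0. ?w t = complex_of_real h"
      by eventually_elim auto
    from isCont_cong[OF this] show ?thesis by simp
  qed
  have lim: "((\<lambda>x. complex_of_real (x / A x) * (\<Sum>n\<in>{idx \<delta> x..<idx K x}.
      (CLBINT t. ?w t * iexp (- (t * y x)) * char F t ^ n))) \<longlongrightarrow> ?w 0 * middle \<delta> K) at_top"
  proof (rule block_sum_tendsto[where B = h and T = "pi / h", OF _ _ cont _ ne yx \<delta>K])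
    show "norm (?w t) \<le> h" for t
      using h by (auto simp: indicator_def)
    show "?w t = 0" if "pi / h < \<bar>t\<bar>" for t
      using that by (auto simp: indicator_def)
  qed auto
  have point: "complex_of_real (measure (conv_pow F n) {x<..x+h}) = complex_of_real (1 / (2 * pi)) * (CLBINT t. ?w t * iexp (- (t * y x)) * char F t ^ n)" for n x
  proof -
    interpret N: real_distribution "conv_pow F n"
      by (rule real_distribution_walk)
    have latn: "char (conv_pow F n) (2 * pi / h) = 1"
      using lat by (simp add: char_walk)
    have "AE z in conv_pow F n. z \<in> range (\<lambda>j::int. h * of_int j)"
      using char_eq_1_iff_lattice[OF N.real_distribution_axioms, of "2 * pi / h"] latn h by simp
    then have "AE z in conv_pow F n. z \<in> {x<..x+h} \<longleftrightarrow> z \<in> {y x}"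
    proof eventually_elim
      case (elim z)
      then obtain j :: int where z: "z = h * of_int j" by auto
      have "x < z \<and> z \<le> x + h \<longleftrightarrow> x / h < of_int j \<and> of_int j \<le> x / h + 1"
        using h by (simp add: z field_simps)
      also have "\<dots> \<longleftrightarrow> j = k x"
        unfolding k_def by linarith
      also have "\<dots> \<longleftrightarrow> z = y x" using h by (simp add: z y_def)
      finally show ?case by simp
    qed
    then have "measure (conv_pow F n) {x<..x+h} = measure (conv_pow F n) {y x}"
      by (intro N.finite_measure_eq_AE) auto
    then show ?thesis
      using measure_lattice_point[OF N.real_distribution_axioms h latn, of "k x"]
      by (simp add: y_def char_walk)
  qed
  have "complex_of_real (block_hits h \<delta> K x) = complex_of_real (1 / (2 * pi)) * (complex_of_real (x / A x) * (\<Sum>n\<in>{idx \<delta> x..<idx K x}.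
      (CLBINT t. ?w t * iexp (- (t * y x)) * char F t ^ n)))" for x
    unfolding block_hits_def of_real_mult[of "x / A x"] of_real_sum point sum_distrib_left[symmetric]
    by (simp only: mult.left_commute)
  with tendsto_mult[OF tendsto_const[of "complex_of_real (1 / (2 * pi))"] lim] h show ?thesis
    by (simp add: mult_ac)
qed

end

section \<open>Hitting intervals: the non-lattice case\<close>

lemma real_distributionI:
  assumes sets: "sets M = sets borel" and "emeasure M UNIV = 1"
  shows "real_distribution M"
proof -
  have "space M = UNIV" using sets_eq_imp_space_eq[OF sets] by simp
  then interpret prob_space M using assms by (intro prob_spaceI) simp
  show ?thesis by standard (rule sets)
qed

lemma tri_uminus [simp]: "tri \<eta> (- t) = tri \<eta> t"
  by (simp add: tri_def)

lemma fejer_le_inverse_sq: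
  assumes "0 < \<eta>"
  shows "fejer \<eta> y \<le> (\<eta> + 4 / \<eta>) / (1 + y\<^sup>2)"
proof -
  have "y\<^sup>2 * fejer \<eta> y \<le> 4 / \<eta>"
  proof (cases "y = 0")
    case False
    have "y\<^sup>2 * fejer \<eta> y = 2 * (1 - cos (\<eta> * y)) / \<eta>"
      using False by (simp add: fejer_def)
    also have "2 * (1 - cos (\<eta> * y)) \<le> 4"
      using mult_left_mono[of "1 - cos (\<eta> * y)" 2 2] cos_ge_minus_one[of "\<eta> * y"] by (smt (verit))
    finally show ?thesis using assms by (simp add: divide_right_mono)
  qed (use assms in simp)
  with fejer_le[OF assms, of y] have "fejer \<eta> y * (1 + y\<^sup>2) \<le> \<eta> + 4 / \<eta>"
    by (simp add: ring_distribs mult.commute)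
  then show ?thesis by (simp add: pos_le_divide_eq add_pos_nonneg)
qed

lemma integrable_fejer_lborel:
  assumes "0 < \<eta>"
  shows "integrable lborel (fejer \<eta>)"
  by (rule Bochner_Integration.integrable_bound[OF integrable_mult_right[OF integrable_inverse_1_plus_sq, of "\<eta> + 4 / \<eta>"]])
     (use assms fejer_nonneg[OF assms] fejer_le_inverse_sq[OF assms] in \<open>auto intro: order_trans[OF _ abs_ge_self]\<close>)

text \<open>Fourier inversion applied to the triangular density, whose transform is the integrable function \<open>fejer\<close>.\<close>

lemma fejer_transform:
  assumes \<eta>: "0 < \<eta>"
  shows "(CLBINT y. complex_of_real (fejer \<eta> y) * iexp (\<theta> * y)) = 2 * pi * tri \<eta> \<theta>"
proof -
  define T where "T = density lborel (\<lambda>t. ennreal (tri \<eta> t / \<eta>))"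
  have "emeasure T UNIV = (\<integral>\<^sup>+t. ennreal (tri \<eta> t / \<eta>) \<partial>lborel)"
    by (simp add: T_def emeasure_density)
  also have "\<dots> = 1"
    using integrable_tri[OF \<eta>] integral_tri[OF \<eta>] \<eta> by (subst nn_integral_eq_integral) (auto simp: tri_nonneg)
  finally have T: "real_distribution T"
    by (intro real_distributionI) (simp_all add: T_def)
  have charT: "char T y = complex_of_real (fejer \<eta> y / \<eta>)" for y
  proof -
    have "char T y = (CLBINT t. (tri \<eta> t / \<eta>) *\<^sub>R iexp (y * t))"
      unfolding char_def T_def using \<eta> by (subst integral_density) (auto simp: tri_nonneg)
    also have "\<dots> = (CLBINT t. (complex_of_real (tri \<eta> t) * iexp (t * y)) / \<eta>)"
      by (intro Bochner_Integration.integral_cong refl) (simp add: scaleR_conv_of_real mult.commute)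
    also have "\<dots> = complex_of_real (fejer \<eta> y / \<eta>)"
      using has_bochner_integral_tri_iexp[OF \<eta>, of y] by (simp add: has_bochner_integral_iff)
    finally show ?thesis .
  qed
  define R where "R = (\<lambda>\<theta>. complex_of_real (1 / (2 * pi)) * (CLBINT t. iexp (- (t * \<theta>)) * complex_of_real (fejer \<eta> t / \<eta>)))"
  have "AE \<theta> in lborel. complex_of_real (tri \<eta> \<theta> / \<eta>) = R \<theta>"
    unfolding R_def
    using AE_eq_fourier_inversion[of "\<lambda>t. tri \<eta> t / \<eta>"] T \<eta> integrable_fejer_lborel[OF \<eta>]
    unfolding T_def[symmetric] charT[abs_def] by (simp add: tri_nonneg)
  \<comment> \<open>Evaluation at \<open>- \<theta>\<close> reverses the sign in the exponent of the
    inversion formula; continuity of both sides upgrades the identity from almost everywhere to this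
    point.\<close>
  then have "complex_of_real (tri \<eta> (- \<theta>) / \<eta>) = R (- \<theta>)"
  proof (rule AE_lborel_imp_eq)
    show "isCont (\<lambda>\<theta>. complex_of_real (tri \<eta> \<theta> / \<eta>)) (- \<theta>)"
      using isCont_tri[OF \<eta>] \<eta> by (intro continuous_intros) auto
    show "isCont R (- \<theta>)"
      unfolding R_def continuous_at_sequentially comp_def
    proof (intro allI impI tendsto_mult tendsto_const)
      fix X :: "nat \<Rightarrow> real" assume X: "X \<longlonglongrightarrow> - \<theta>"
      show "(\<lambda>n. CLBINT t. iexp (- (t * X n)) * complex_of_real (fejer \<eta> t / \<eta>)) \<longlonglongrightarrow>
         (CLBINT t. iexp (- (t * - \<theta>)) * complex_of_real (fejer \<eta> t / \<eta>))"
      proof (rule integral_dominated_convergence[where w="\<lambda>t. fejer \<eta> t / \<eta>"])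
        show "AE t in lborel. (\<lambda>n. iexp (- (t * X n)) * complex_of_real (fejer \<eta> t / \<eta>)) \<longlonglongrightarrow>
          iexp (- (t * - \<theta>)) * complex_of_real (fejer \<eta> t / \<eta>)"
          by (intro AE_I2 tendsto_intros X)
        show "AE t in lborel. norm (iexp (- (t * X n)) * complex_of_real (fejer \<eta> t / \<eta>)) \<le> fejer \<eta> t / \<eta>" for n
          using \<eta> fejer_nonneg[OF \<eta>] by (simp add: norm_mult norm_divide)
      qed (use integrable_fejer_lborel[OF \<eta>] in auto)
    qed
  qed
  then have "complex_of_real (tri \<eta> \<theta>) / \<eta> = 1 / (2 * pi) * ((CLBINT t. iexp (t * \<theta>) * complex_of_real (fejer \<eta> t)) / \<eta>)"
    by (simp add: R_def)
  also have "(CLBINT t. iexp (t * \<theta>) * complex_of_real (fejer \<eta> t)) = (CLBINT y. complex_of_real (fejer \<eta> y) * iexp (\<theta> * y))"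
    by (intro Bochner_Integration.integral_cong refl) (simp add: mult.commute)
  finally show ?thesis
    using \<eta> by (simp add: field_simps)
qed

text \<open>Lebesgue measure reweighted by the kernel and normalised. It is the limit law of the
  reweighted block measures, because seen from \<open>x\<close> these measures approach a multiple
  of Lebesgue measure.\<close>

definition fejer_dist :: "real \<Rightarrow> real measure" where
  "fejer_dist \<eta> = density lborel (\<lambda>y. ennreal (fejer \<eta> y / (2 * pi)))"

lemma real_distribution_fejer_dist:
  assumes \<eta>: "0 < \<eta>"
  shows "real_distribution (fejer_dist \<eta>)"
proof -
  have "complex_of_real (LBINT y. fejer \<eta> y) = complex_of_real (2 * pi)"
    using fejer_transform[OF \<eta>, of 0] by simp
  then have "(LBINT y. fejer \<eta> y) = 2 * pi" by (simp only: of_real_eq_iff)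
  then have "(\<integral>\<^sup>+y. ennreal (fejer \<eta> y / (2 * pi)) \<partial>lborel) = 1"
    using integrable_fejer_lborel[OF \<eta>] fejer_nonneg[OF \<eta>] by (subst nn_integral_eq_integral) auto
  then show ?thesis
    by (intro real_distributionI) (simp_all add: fejer_dist_def emeasure_density)
qed

lemma char_fejer_dist:
  assumes \<eta>: "0 < \<eta>"
  shows "char (fejer_dist \<eta>) \<theta> = tri \<eta> \<theta>"
proof -
  have "char (fejer_dist \<eta>) \<theta> = (CLBINT y. (fejer \<eta> y / (2 * pi)) *\<^sub>R iexp (\<theta> * y))"
    unfolding char_def fejer_dist_def using fejer_nonneg[OF \<eta>] by (subst integral_density) auto
  also have "\<dots> = (CLBINT y. complex_of_real (fejer \<eta> y) * iexp (\<theta> * y)) / (2 * pi)"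
    by (simp add: scaleR_conv_of_real)
  finally show ?thesis using fejer_transform[OF \<eta>, of \<theta>] by simp
qed

text \<open>Realises the recentred and reweighted sum of the \<open>Ms n\<close> as a single
  probability measure, since Levy's continuity theorem speaks of such measures only.\<close>

lemma weighted_mixture:
  fixes Ms :: "nat \<Rightarrow> real measure" and H :: "real \<Rightarrow> real"
  assumes Ms: "\<And>n. real_distribution (Ms n)" and J: "finite J" "J \<noteq> {}"
    and [measurable]: "H \<in> borel_measurable borel" and H: "\<And>y. 0 \<le> H y" "\<And>y. H y \<le> b"
    and Z: "0 < (\<Sum>n\<in>J. \<integral>y. H (y - x) \<partial>Ms n)"
  obtains N where "real_distribution N"
    "\<And>f B. f \<in> borel_measurable borel \<Longrightarrow> (\<And>y. norm (f y) \<le> B) \<Longrightarrow>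
       (CLINT y|N. f y) = (\<Sum>n\<in>J. CLINT y|Ms n. complex_of_real (H (y - x)) * f (y - x)) / (\<Sum>n\<in>J. \<integral>y. H (y - x) \<partial>Ms n)"
proof -
  interpret Ms: real_distribution "Ms n" for n by (rule Ms)
  define Z where "Z = (\<Sum>n\<in>J. \<integral>y. H (y - x) \<partial>Ms n)"
  have Zpos: "0 < Z" using assms by (simp add: Z_def)
  \<comment> \<open>A uniformly random index mixes the measures; the resulting factor
    \<open>1 / card J\<close> is compensated in the density of \<open>N\<close>.\<close>
  define p where "p = measure_pmf (pmf_of_set J)"
  interpret p: prob_space p unfolding p_def by (rule prob_space_measure_pmf)
  have kernel: "Ms \<in> measurable p (subprob_algebra borel)"
    unfolding p_def measurable_pmf_measure1
    by (auto simp: space_subprob_algebra intro: prob_space_imp_subprob_space Ms.prob_space_axioms)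
  define P where "P = (p \<bind> Ms)"
  have sP[measurable_cong]: "sets P = sets borel"
    unfolding P_def by (rule sets_bind) (auto simp: p_def)
  interpret P: prob_space P
    unfolding P_def by (rule p.prob_space_bind[OF _ kernel]) (auto intro: Ms.prob_space_axioms)
  have card: "0 < card J" using J by (simp add: card_gt_0_iff)
  have int: "(\<integral>y. f y \<partial>P) = (\<Sum>n\<in>J. \<integral>y. f y \<partial>Ms n) / card J"
    if [measurable]: "f \<in> borel_measurable borel" and f: "\<And>y. \<bar>f y\<bar> \<le> B" for f :: "real \<Rightarrow> real" and B
  proof -
    have "(\<integral>y. f y \<partial>P) = (\<integral>n. (\<integral>y. f y \<partial>Ms n) \<partial>p)"
      unfolding P_def
      by (rule integral_bind[OF _ _ kernel p.finite_measure_axioms, where B = B and B' = 1])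
         (use f Ms.emeasure_space_1 in auto)
    then show ?thesis unfolding p_def by (simp add: integral_pmf_of_set J)
  qed
  define N where "N = density (distr P borel (\<lambda>y. y - x)) (\<lambda>y. ennreal (H y * card J / Z))"
  have b: "0 \<le> b" using order_trans[OF H] .
  have N_int: "(\<integral>y. f y \<partial>N) = (\<Sum>n\<in>J. \<integral>y. H (y - x) * f (y - x) \<partial>Ms n) / Z"
    if [measurable]: "f \<in> borel_measurable borel" and f: "\<And>y. \<bar>f y\<bar> \<le> B" for f :: "real \<Rightarrow> real" and B
  proof -
    have "(\<integral>y. f y \<partial>N) = (\<integral>y. (H (y - x) * card J / Z) * f (y - x) \<partial>P)"
      unfolding N_def using H(1) Zpos
      by (subst integral_density) (auto simp: integral_distr)
    also have "\<dots> = (\<integral>y. card J / Z * (H (y - x) * f (y - x)) \<partial>P)"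
      by (intro Bochner_Integration.integral_cong refl) simp
    also have "\<dots> = card J / Z * (\<integral>y. H (y - x) * f (y - x) \<partial>P)"
      by (rule integral_mult_right_zero)
    also have "(\<integral>y. H (y - x) * f (y - x) \<partial>P) = (\<Sum>n\<in>J. \<integral>y. H (y - x) * f (y - x) \<partial>Ms n) / card J"
    proof (rule int[of "\<lambda>y. H (y - x) * f (y - x)" "b * B"])
      show "\<bar>H (y - x) * f (y - x)\<bar> \<le> b * B" for y
        unfolding abs_mult using H b f by (intro mult_mono) auto
    qed measurable
    finally show ?thesis using card by simp
  qed
  have "emeasure N UNIV = (\<integral>\<^sup>+y. ennreal (H (y - x) * card J / Z) \<partial>P)"
    unfolding N_def by (simp add: emeasure_density nn_integral_distr)
  also have "\<dots> = ennreal (\<integral>y. H (y - x) * card J / Z \<partial>P)"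
  proof (rule nn_integral_eq_integral)
    have "integrable P (\<lambda>y. H (y - x))"
      by (rule P.integrable_const_bound[where B=b]) (use H in auto)
    then show "integrable P (\<lambda>y. H (y - x) * card J / Z)" by simp
  qed (use H Zpos in auto)
  also have "(\<integral>y. H (y - x) * card J / Z \<partial>P) = card J / Z * (\<integral>y. H (y - x) \<partial>P)"
    by (simp add: mult.commute)
  also have "(\<integral>y. H (y - x) \<partial>P) = Z / card J"
    unfolding Z_def using H by (intro int[of "\<lambda>y. H (y - x)" b]) auto
  finally have "emeasure N UNIV = 1" using card Zpos by simp
  then have "real_distribution N"
    by (intro real_distributionI) (simp_all add: N_def)
  then interpret N: real_distribution N .
  have "(CLINT y|N. f y) = (\<Sum>n\<in>J. CLINT y|Ms n. complex_of_real (H (y - x)) * f (y - x)) / Z"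
    if f_meas[measurable]: "f \<in> borel_measurable borel" and f: "\<And>y. norm (f y) \<le> B" for f :: "real \<Rightarrow> complex" and B
  proof -
    have iN: "integrable N f"
      by (rule N.integrable_const_bound[where B=B]) (use f in auto)
    have iM: "integrable (Ms n) (\<lambda>y. complex_of_real (H (y - x)) * f (y - x))" for n
    proof (rule Ms.integrable_const_bound[where B="b * B"])
      have "norm (complex_of_real (H (y - x)) * f (y - x)) \<le> b * B" for y
        unfolding norm_mult using H b f by (intro mult_mono) auto
      then show "AE y in Ms n. norm (complex_of_real (H (y - x)) * f (y - x)) \<le> b * B" by simp
    qed measurable
    have "\<bar>Re (f y)\<bar> \<le> B" "\<bar>Im (f y)\<bar> \<le> B" for y
      using f[of y] abs_Re_le_cmod[of "f y"] abs_Im_le_cmod[of "f y"] by linarith+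
    then have "(\<integral>y. Re (f y) \<partial>N) = (\<Sum>n\<in>J. \<integral>y. H (y - x) * Re (f (y - x)) \<partial>Ms n) / Z"
      and "(\<integral>y. Im (f y) \<partial>N) = (\<Sum>n\<in>J. \<integral>y. H (y - x) * Im (f (y - x)) \<partial>Ms n) / Z"
      by (intro N_int[of _ B]; simp)+
    moreover have "(\<integral>y. H (y - x) * Re (f (y - x)) \<partial>Ms n) = Re (CLINT y|Ms n. complex_of_real (H (y - x)) * f (y - x))"
      and "(\<integral>y. H (y - x) * Im (f (y - x)) \<partial>Ms n) = Im (CLINT y|Ms n. complex_of_real (H (y - x)) * f (y - x))" for n
      using integral_Re[OF iM, of n] integral_Im[OF iM, of n] by simp_all
    ultimately show ?thesis
      by (simp add: complex_eq_iff integral_Re[OF iN] integral_Im[OF iN])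
  qed
  with N.real_distribution_axioms that show ?thesis unfolding Z_def by blast
qed

text \<open>On \<open>(0, h]\<close> the weight \<open>fejer\<close> can be divided out again.\<close>

lemma fejer_dist_weak_limit:
  assumes h: "0 < h" and Ns: "\<And>j. real_distribution (Ns j)" and wc: "weak_conv_m Ns (fejer_dist (1 / h))"
  shows "(\<lambda>j. CLINT y|Ns j. complex_of_real (indicator {0<..h} y / fejer (1 / h) y)) \<longlonglongrightarrow> h / (2 * pi)"
proof -
  define \<eta> where "\<eta> = 1 / h"
  have \<eta>: "0 < \<eta>" using h by (simp add: \<eta>_def)
  let ?H = "fejer \<eta>"
  define f where "f = (\<lambda>y. complex_of_real (indicator {0<..h} y / ?H y))"
  have H_ge: "\<eta> / 2 \<le> ?H y" "0 < ?H y" if "y \<in> {0..h}" for y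
  proof -
    have "\<bar>\<eta> * y\<bar> \<le> 1" using that h by (simp add: \<eta>_def)
    then show "\<eta> / 2 \<le> ?H y" by (rule fejer_ge[OF \<eta>])
    then show "0 < ?H y" using \<eta> by linarith
  qed
  have f_meas: "f \<in> borel_measurable borel" unfolding f_def by measurable
  have f_bdd: "norm (f y) \<le> 2 / \<eta>" for y
  proof (cases "y \<in> {0<..h}")
    case True
    have H: "0 < ?H y" "\<eta> / 2 \<le> ?H y" using H_ge[of y] True by auto
    have "1 / ?H y \<le> 1 / (\<eta> / 2)"
      using H \<eta> by (intro divide_left_mono) auto
    then show ?thesis using H True by (simp add: f_def norm_divide)
  qed (use \<eta> in \<open>auto simp: f_def\<close>)
  have f_cont: "isCont f y" if y: "y \<noteq> 0" "y \<noteq> h" for y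
  proof -
    have "isCont (\<lambda>y. 2 * (1 - cos (\<eta> * y)) / (\<eta> * y\<^sup>2)) y"
      using y \<eta> by (intro continuous_intros) auto
    moreover have "\<forall>\<^sub>F z in nhds y. z \<noteq> 0"
      using y by (simp add: t1_space_nhds)
    then have "\<forall>\<^sub>F z in nhds y. ?H z = 2 * (1 - cos (\<eta> * z)) / (\<eta> * z\<^sup>2)"
      by eventually_elim (simp add: fejer_def)
    ultimately have contH: "isCont ?H y" using isCont_cong by metis
    consider "y < 0 \<or> h < y" | "0 < y" "y < h" using y by linarith
    then show ?thesis
    proof cases
      case 1
      have "\<forall>\<^sub>F z in nhds y. z \<in> {..<0} \<union> {h<..}"
        using 1 by (intro eventually_nhds_in_open) auto
      then have "\<forall>\<^sub>F z in nhds y. f z = 0"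
        by eventually_elim (auto simp: f_def)
      from isCont_cong[OF this] show ?thesis by simp
    next
      case 2
      have "\<forall>\<^sub>F z in nhds y. z \<in> {0<..<h}"
        using 2 by (intro eventually_nhds_in_open) auto
      then have "\<forall>\<^sub>F z in nhds y. f z = complex_of_real (1 / ?H z)"
        by eventually_elim (auto simp: f_def)
      from isCont_cong[OF this] show ?thesis
        using contH H_ge(2)[of y] 2 by (simp add: continuous_divide)
    qed
  qed
  \<comment> \<open>The jumps at 0 and \<open>h\<close> carry no mass under the absolutely
    continuous limit.\<close>
  have null: "emeasure (fejer_dist \<eta>) {y. \<not> isCont f y} = 0"
  proof -
    have "{y. \<not> isCont f y} \<subseteq> {0, h}" using f_cont by auto
    then have "finite {y. \<not> isCont f y}" by (rule finite_subset) simp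
    then have "{y. \<not> isCont f y} \<in> null_sets lborel"
      by (rule finite_imp_null_set_lborel)
    then have "{y. \<not> isCont f y} \<in> null_sets (fejer_dist \<eta>)"
      unfolding fejer_dist_def by (subst null_sets_density_iff) (auto dest: AE_not_in)
    then show ?thesis by auto
  qed
  have "(\<lambda>j. CLINT y|Ns j. f y) \<longlonglongrightarrow> (CLINT y|fejer_dist \<eta>. f y)"
    by (rule weak_conv_imp_bdd_ae_continuous_conv[OF Ns real_distribution_fejer_dist[OF \<eta>] _ null f_bdd f_meas])
       (use wc in \<open>simp add: \<eta>_def\<close>)
  also have "(CLINT y|fejer_dist \<eta>. f y) = (CLBINT y. (?H y / (2 * pi)) *\<^sub>R f y)"
    unfolding fejer_dist_def using fejer_nonneg[OF \<eta>] f_meas by (subst integral_density) auto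
  also have "\<dots> = (CLBINT y. complex_of_real (indicator {0<..h} y * (1 / (2 * pi))))"
  proof (intro Bochner_Integration.integral_cong refl)
    fix y show "(?H y / (2 * pi)) *\<^sub>R f y = complex_of_real (indicator {0<..h} y * (1 / (2 * pi)))"
      using H_ge(2)[of y] by (cases "y \<in> {0<..h}") (auto simp: f_def scaleR_conv_of_real)
  qed
  also have "\<dots> = complex_of_real (LBINT y. indicator {0<..h} y * (1 / (2 * pi)))"
    by (rule integral_complex_of_real)
  also have "\<dots> = complex_of_real (h / (2 * pi))" using h by simp
  finally show ?thesis by (simp add: f_def \<eta>_def)
qed

context stable_domain
begin

text \<open>The weight is the triangle shifted by \<open>\<theta>\<close>. Its value at frequency 0
  is \<open>tri \<eta> \<theta>\<close>, the characteristic function of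
  \<open>fejer_dist \<eta>\<close>.\<close>

lemma block_fejer_tendsto:
  assumes \<eta>: "0 < \<eta>" and ne: "\<And>t. t \<noteq> 0 \<Longrightarrow> char F t \<noteq> 1" and \<delta>K: "0 < \<delta>" "\<delta> < K"
  shows "((\<lambda>x. complex_of_real (x / A x) * (\<Sum>n\<in>{idx \<delta> x..<idx K x}.
      (CLINT y|conv_pow F n. complex_of_real (fejer \<eta> (y - x)) * iexp (\<theta> * (y - x))))) \<longlongrightarrow> tri \<eta> \<theta> * middle \<delta> K) at_top"
proof -
  let ?w = "\<lambda>t. complex_of_real (tri \<eta> (t - \<theta>))"
  have "((\<lambda>x. complex_of_real (x / A x) * (\<Sum>n\<in>{idx \<delta> x..<idx K x}. (CLBINT t. ?w t * iexp (- (t * x)) * char F t ^ n))) \<longlongrightarrow> ?w 0 * middle \<delta> K) at_top"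
  proof (rule block_sum_tendsto[where B = 1 and T = "\<eta> + \<bar>\<theta>\<bar>", OF _ _ _ _ _ _ \<delta>K])
    show "norm (?w t) \<le> 1" for t using tri_nonneg tri_le_1[OF \<eta>] by simp
    show "isCont ?w 0"
      by (intro continuous_intros isCont_o2[OF _ isCont_tri[OF \<eta>]])
    show "?w t = 0" if "\<eta> + \<bar>\<theta>\<bar> < \<bar>t\<bar>" for t
      using that by (simp add: tri_eq_0[OF \<eta>])
    show "((\<lambda>x. x / x) \<longlongrightarrow> (1::real)) at_top"
      by (rule tendsto_eventually) (use eventually_gt_at_top[of 0] in \<open>auto elim!: eventually_mono\<close>)
  qed (use ne in auto)
  moreover have "(CLBINT t. ?w t * iexp (- (t * x)) * char F t ^ n) =
    (CLINT y|conv_pow F n. complex_of_real (fejer \<eta> (y - x)) * iexp (\<theta> * (y - x)))" for n x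
    using integral_tri_char[OF real_distribution_walk \<eta>, of \<theta> x n] by (simp only: char_walk)
  ultimately show ?thesis by simp
qed

text \<open>The measures \<open>\<Sum> P (S\<^sub>n - x \<in> dy)\<close>, reweighted by the Fejer kernel, have converging characteristic
  functions; Levy's continuity theorem then gives convergence on the interval \<open>(0, h]\<close>.\<close>

lemma block_hits_nonlattice:
  assumes h: "0 < h" and ne: "\<And>t. t \<noteq> 0 \<Longrightarrow> char F t \<noteq> 1" and \<delta>K: "0 < \<delta>" "\<delta> < K"
  shows "((\<lambda>x. complex_of_real (block_hits h \<delta> K x)) \<longlongrightarrow> h / (2 * pi) * middle \<delta> K) at_top"
proof -
  define \<eta> where "\<eta> = 1 / h"
  have \<eta>: "0 < \<eta>" "\<eta> * h \<le> 1" using h by (auto simp: \<eta>_def)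
  let ?J = "\<lambda>x. {idx \<delta> x..<idx K x}"
  let ?H = "fejer \<eta>"
  define c where "c = middle \<delta> K"
  define L where "L = (\<lambda>x. \<Sum>n\<in>?J x. \<integral>y. ?H (y - x) \<partial>conv_pow F n)"
  define Lc where "Lc = (\<lambda>\<theta> x. \<Sum>n\<in>?J x. (CLINT y|conv_pow F n. complex_of_real (?H (y - x)) * iexp (\<theta> * (y - x))))"
  have Lc_lim: "((\<lambda>x. complex_of_real (x / A x) * Lc \<theta> x) \<longlongrightarrow> tri \<eta> \<theta> * c) at_top" for \<theta>
    unfolding Lc_def c_def by (rule block_fejer_tendsto[OF \<eta>(1) ne \<delta>K])
  have "Lc 0 x = complex_of_real (L x)" for x
    by (simp add: Lc_def L_def)
  then have lim0: "((\<lambda>x. complex_of_real (x / A x * L x)) \<longlongrightarrow> c) at_top"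
    using Lc_lim[of 0] by simp
  have L_nonneg: "0 \<le> L x" for x
    unfolding L_def using fejer_nonneg[OF \<eta>(1)] by (intro sum_nonneg integral_nonneg_AE) auto
  show ?thesis
    unfolding c_def[symmetric]
  proof (cases "c = 0")
    \<comment> \<open>If the limiting total mass is 0, normalisation is impossible, but the smoothed
      mass dominates the hits of the interval and settles the claim directly.\<close>
    case True
    have "((\<lambda>x. complex_of_real (block_hits h \<delta> K x)) \<longlongrightarrow> 0) at_top"
    proof (rule Lim_null_comparison)
      show "\<forall>\<^sub>F x in at_top. norm (complex_of_real (block_hits h \<delta> K x)) \<le> 2 / \<eta> * norm (complex_of_real (x / A x * L x))"
        using eventually_gt_at_top[of 0]
      proof eventually_elim
        case (elim x)
        have xA: "0 \<le> x / A x" using elim A_pos[of x] by simp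
        have "(\<Sum>n\<in>?J x. measure (conv_pow F n) {x<..x+h}) \<le> 2 / \<eta> * L x"
          unfolding L_def sum_distrib_left by (intro sum_mono measure_Ioc_le_fejer real_distribution_walk \<eta>)
        with xA have "block_hits h \<delta> K x \<le> x / A x * (2 / \<eta> * L x)"
          unfolding block_hits_def by (intro mult_left_mono)
        moreover have "0 \<le> block_hits h \<delta> K x"
          unfolding block_hits_def using xA by (intro mult_nonneg_nonneg sum_nonneg) auto
        moreover have "0 \<le> x / A x * L x" using xA L_nonneg by (rule mult_nonneg_nonneg)
        ultimately show ?case by (simp only: norm_of_real abs_of_nonneg mult.left_commute)
      qed
      show "((\<lambda>x. 2 / \<eta> * norm (complex_of_real (x / A x * L x))) \<longlongrightarrow> 0) at_top"
        using tendsto_mult[OF tendsto_const[of "2 / \<eta>"] tendsto_norm[OF lim0]] True by simp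
    qed
    then show "((\<lambda>x. complex_of_real (block_hits h \<delta> K x)) \<longlongrightarrow> h / (2 * pi) * c) at_top" using True by simp
  next
    case False
    have "\<forall>\<^sub>F x in at_top. complex_of_real (x / A x * L x) \<noteq> 0"
      by (rule tendsto_imp_eventually_ne[OF lim0 False])
    then have ev: "\<forall>\<^sub>F x in at_top. 0 < L x \<and> 0 < x"
      using eventually_gt_at_top[of 0] by eventually_elim (use L_nonneg in \<open>force simp: less_le\<close>)
    show "((\<lambda>x. complex_of_real (block_hits h \<delta> K x)) \<longlongrightarrow> h / (2 * pi) * c) at_top"
    proof (rule tendsto_at_topI_sequentially)
      fix X :: "nat \<Rightarrow> real" assume X: "filterlim X at_top sequentially"
      obtain j0 where j0: "\<And>j. j0 \<le> j \<Longrightarrow> 0 < L (X j) \<and> 0 < X j"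
        using eventually_compose_filterlim[OF ev X] by (auto simp: eventually_sequentially)
      \<comment> \<open>A tail of the sequence on which the total mass is positive for every index,
        so that a normalised measure exists for every \<open>j\<close>.\<close>
      define Y where "Y = (\<lambda>j. X (j + j0))"
      have Y: "filterlim Y at_top sequentially"
        unfolding Y_def by (rule filterlim_compose[OF X filterlim_add_const_nat_at_top])
      have LY: "0 < L (Y j)" "0 < Y j" for j using j0 by (simp_all add: Y_def)
      have YA: "Y j / A (Y j) \<noteq> 0" for j using LY A_pos[of "Y j"] by (simp add: less_imp_neq[symmetric])
      define Q where "Q = (\<lambda>j N. real_distribution N \<and> (\<forall>f B. f \<in> borel_measurable borel \<longrightarrow> (\<forall>y. norm (f y) \<le> B) \<longrightarrow>
        (CLINT y|N. f y) = (\<Sum>n\<in>?J (Y j). CLINT y|conv_pow F n. complex_of_real (?H (y - Y j)) * f (y - Y j)) / L (Y j)))"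
      have "\<exists>N. Q j N" for j
      proof -
        have ne: "?J (Y j) \<noteq> {}" using LY(1)[of j] unfolding L_def by (metis less_irrefl sum.empty)
        show ?thesis
          by (rule weighted_mixture[OF real_distribution_walk _ ne fejer_measurable
                fejer_nonneg[OF \<eta>(1)] fejer_le[OF \<eta>(1)] LY(1)[of j, unfolded L_def]])
            (simp, unfold Q_def L_def, blast)
      qed
      then have "\<forall>j. \<exists>N. Q j N" by blast
      from choice[OF this] obtain Ns where Q: "\<And>j. Q j (Ns j)" by blast
      have Ns: "real_distribution (Ns j)" for j
        using Q[of j] by (simp add: Q_def)
      have Ns_int: "(CLINT y|Ns j. f y) = (\<Sum>n\<in>?J (Y j). CLINT y|conv_pow F n. complex_of_real (?H (y - Y j)) * f (y - Y j)) / L (Y j)"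
        if "f \<in> borel_measurable borel" "\<And>y. norm (f y) \<le> B" for j f B
        using Q[of j] that unfolding Q_def by blast
      have "(\<lambda>j. char (Ns j) \<theta>) \<longlonglongrightarrow> char (fejer_dist \<eta>) \<theta>" for \<theta>
      proof -
        have "char (Ns j) \<theta> = (complex_of_real (Y j / A (Y j)) * Lc \<theta> (Y j)) / complex_of_real (Y j / A (Y j) * L (Y j))" for j
          unfolding char_def Lc_def of_real_mult[of "Y j / A (Y j)"]
          using YA[of j] by (subst Ns_int[of _ 1]) (auto simp del: of_real_divide)
        moreover have "(\<lambda>j. (complex_of_real (Y j / A (Y j)) * Lc \<theta> (Y j)) / complex_of_real (Y j / A (Y j) * L (Y j))) \<longlonglongrightarrow> tri \<eta> \<theta> * c / c"
          by (intro tendsto_divide filterlim_compose[OF Lc_lim Y] filterlim_compose[OF lim0 Y] False)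
        ultimately show ?thesis
          using False by (simp only: char_fejer_dist[OF \<eta>(1)]) simp
      qed
      then have wc: "weak_conv_m Ns (fejer_dist \<eta>)"
        by (rule levy_continuity[OF Ns real_distribution_fejer_dist[OF \<eta>(1)]])
      let ?f = "\<lambda>y. complex_of_real (indicator {0<..h} y / ?H y)"
      have H_ge: "\<eta> / 2 \<le> ?H y" if "y \<in> {0<..h}" for y
        using that h by (intro fejer_ge[OF \<eta>(1)]) (simp add: \<eta>_def)
      have "norm (?f y) \<le> 2 / \<eta>" for y
      proof (cases "y \<in> {0<..h}")
        case True
        have "1 / ?H y \<le> 1 / (\<eta> / 2)"
          using H_ge[OF True] \<eta> by (intro divide_left_mono mult_pos_pos) auto
        then show ?thesis using True fejer_nonneg[OF \<eta>(1), of y] by (simp add: norm_divide)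
      qed (use \<eta> in auto)
      \<comment> \<open>Multiplication by the total mass undoes the normalisation, and the quotient
        \<open>?f\<close> cancels the kernel on the interval.\<close>
      then have "(CLINT y|Ns j. ?f y) * complex_of_real (Y j / A (Y j) * L (Y j)) = complex_of_real (block_hits h \<delta> K (Y j))" for j
      proof -
        interpret N: real_distribution "conv_pow F n" for n by (rule real_distribution_walk)
        have "complex_of_real (?H (y - Y j)) * ?f (y - Y j) = complex_of_real (indicator {Y j<..Y j + h} y)" for y
          using H_ge[of "y - Y j"] \<eta> by (cases "y \<in> {Y j<..Y j + h}") auto
        then have "(CLINT y|Ns j. ?f y) = (\<Sum>n\<in>?J (Y j). complex_of_real (measure (conv_pow F n) {Y j<..Y j + h})) / L (Y j)"
          using \<open>\<And>y. norm (?f y) \<le> 2 / \<eta>\<close> by (subst Ns_int[of _ "2 / \<eta>"]) simp_all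
        then show ?thesis
          using LY(1)[of j] by (simp add: block_hits_def)
      qed
      moreover have "(\<lambda>j. (CLINT y|Ns j. ?f y) * complex_of_real (Y j / A (Y j) * L (Y j))) \<longlonglongrightarrow> h / (2 * pi) * c"
        using fejer_dist_weak_limit[OF h Ns] wc
        by (intro tendsto_mult filterlim_compose[OF lim0 Y]) (simp add: \<eta>_def)
      ultimately have "(\<lambda>j. complex_of_real (block_hits h \<delta> K (Y j))) \<longlonglongrightarrow> h / (2 * pi) * c" by (simp only:)
      then show "(\<lambda>j. complex_of_real (block_hits h \<delta> K (X j))) \<longlonglongrightarrow> h / (2 * pi) * c"
        unfolding Y_def by (rule LIMSEQ_offset)
    qed
  qed
qed

end

section \<open>The renewal limit\<close>

text \<open>All \<open>w j\<close> are close to the same \<open>u\<close>, so their limits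
  \<open>v j\<close> differ by at most \<open>e i + e j\<close> and form a Cauchy sequence. Hence
  \<open>c\<close>, which could a priori be infinite, is finite.\<close>

lemma tendsto_ennreal_by_approximation:
  fixes u :: "real \<Rightarrow> real" and v e :: "nat \<Rightarrow> real" and w :: "nat \<Rightarrow> real \<Rightarrow> real"
  assumes w: "\<And>j. (w j \<longlongrightarrow> v j) at_top" and close: "\<And>j. \<forall>\<^sub>F x in at_top. \<bar>u x - w j x\<bar> \<le> e j"
    and e: "e \<longlonglongrightarrow> 0" and v: "(\<lambda>j. ennreal (v j)) \<longlonglongrightarrow> c"
  shows "((\<lambda>x. ennreal (u x)) \<longlongrightarrow> c) at_top"
proof -
  have "\<bar>v i - v j\<bar> \<le> e i + e j" for i j
  proof (rule tendsto_upperbound)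
    show "((\<lambda>x. \<bar>w i x - w j x\<bar>) \<longlongrightarrow> \<bar>v i - v j\<bar>) at_top"
      by (intro tendsto_intros w)
    show "\<forall>\<^sub>F x in at_top. \<bar>w i x - w j x\<bar> \<le> e i + e j"
      using close[of i] close[of j] by eventually_elim linarith
  qed simp
  note v_diff = this
  have "Cauchy v"
  proof (rule metric_CauchyI)
    fix \<epsilon> :: real assume "0 < \<epsilon>"
    then obtain N where N: "\<And>n. N \<le> n \<Longrightarrow> e n < \<epsilon> / 2"
      using order_tendstoD(2)[OF e, of "\<epsilon> / 2"] by (auto simp: eventually_sequentially)
    have "dist (v m) (v n) < \<epsilon>" if "N \<le> m" "N \<le> n" for m n
      using v_diff[of m n] N[OF that(1)] N[OF that(2)] by (simp add: dist_real_def)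
    then show "\<exists>M. \<forall>m\<ge>M. \<forall>n\<ge>M. dist (v m) (v n) < \<epsilon>" by blast
  qed
  then obtain l where l: "v \<longlonglongrightarrow> l" using Cauchy_convergent convergent_def by blast
  have "c = ennreal l"
    using LIMSEQ_unique[OF v tendsto_ennrealI[OF l]] .
  moreover have "(u \<longlongrightarrow> l) at_top"
  proof (rule tendstoI)
    fix \<epsilon> :: real assume "0 < \<epsilon>"
    have "\<forall>\<^sub>F j in sequentially. e j < \<epsilon> / 3" "\<forall>\<^sub>F j in sequentially. dist (v j) l < \<epsilon> / 3"
      using order_tendstoD(2)[OF e, of "\<epsilon> / 3"] tendstoD[OF l, of "\<epsilon> / 3"] \<open>0 < \<epsilon>\<close> by auto
    then have "\<forall>\<^sub>F j in sequentially. e j < \<epsilon> / 3 \<and> dist (v j) l < \<epsilon> / 3" by (rule eventually_conj)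
    then obtain j where j: "e j < \<epsilon> / 3" "dist (v j) l < \<epsilon> / 3"
      using eventually_happens'[OF sequentially_bot] by blast
    have "\<forall>\<^sub>F x in at_top. dist (w j x) (v j) < \<epsilon> / 3"
      using tendstoD[OF w, of "\<epsilon> / 3"] \<open>0 < \<epsilon>\<close> by simp
    with close[of j] show "\<forall>\<^sub>F x in at_top. dist (u x) l < \<epsilon>"
      by eventually_elim (use j in \<open>unfold dist_real_def, linarith\<close>)
  qed
  ultimately show ?thesis by (simp add: tendsto_ennrealI)
qed

text \<open>With \<open>u = v powr (- \<alpha>)\<close> the Jacobian is
  \<open>\<alpha> * v powr (- \<alpha> - 1)\<close>, and the factor
  \<open>u powr (-1 / \<alpha>) = v\<close> raises the exponent by one.\<close>

lemma nn_integral_powr_substitution: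
  fixes k :: "real \<Rightarrow> real"
  assumes [measurable]: "k \<in> borel_measurable borel" and k: "\<And>v. 0 \<le> k v"
    and \<delta>K: "0 < \<delta>" "\<delta> \<le> K" and \<alpha>: "0 < \<alpha>"
  shows "(\<integral>\<^sup>+u\<in>{\<delta>..K}. ennreal (u powr (-1 / \<alpha>) * k (u powr (-1 / \<alpha>))) \<partial>lborel) =
    ennreal \<alpha> * (\<integral>\<^sup>+v\<in>{K powr (-1 / \<alpha>)..\<delta> powr (-1 / \<alpha>)}. ennreal (v powr (- \<alpha>) * k v) \<partial>lborel)"
proof -
  define a b where "a = K powr (-1 / \<alpha>)" and "b = \<delta> powr (-1 / \<alpha>)"
  have ab: "0 < a" "a \<le> b"
    using \<delta>K \<alpha> by (auto simp: a_def b_def intro!: powr_mono2')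
  define f where "f = (\<lambda>w. (- w) powr (-1 / \<alpha>) * k ((- w) powr (-1 / \<alpha>)))"
  \<comment> \<open>The substitution is decreasing; reflecting \<open>u\<close> first makes it
    increasing, as the substitution rule requires.\<close>
  define s where "s = (\<lambda>v. - (v powr (- \<alpha>)))"
  have s: "s a = - K" "s b = - \<delta>"
    using \<delta>K \<alpha> by (simp_all add: s_def a_def b_def powr_powr)
  have "(\<integral>\<^sup>+u\<in>{\<delta>..K}. ennreal (u powr (-1 / \<alpha>) * k (u powr (-1 / \<alpha>))) \<partial>lborel) =
     (\<integral>\<^sup>+w. ennreal (f w * indicator {s a..s b} w) \<partial>lborel)"
    unfolding s f_def
    by (subst nn_integral_real_affine[where c = "-1" and t = 0])
       (auto intro!: nn_integral_cong simp: indicator_def)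
  also have "\<dots> = (\<integral>\<^sup>+v. ennreal (f (s v) * (\<alpha> * v powr (- \<alpha> - 1)) * indicator {a..b} v) \<partial>lborel)"
  proof (rule nn_integral_substitution)
    show "set_borel_measurable borel {s a..s b} f"
      unfolding set_borel_measurable_def f_def by measurable
    show "(s has_real_derivative \<alpha> * v powr (- \<alpha> - 1)) (at v)" if "v \<in> {a..b}" for v
      unfolding s_def using that ab by (auto intro!: derivative_eq_intros)
    show "continuous_on {a..b} (\<lambda>v. \<alpha> * v powr (- \<alpha> - 1))"
      using ab by (intro continuous_intros) auto
  qed (use ab \<alpha> in auto)
  also have "\<dots> = (\<integral>\<^sup>+v. ennreal \<alpha> * (ennreal (v powr (- \<alpha>) * k v) * indicator {a..b} v) \<partial>lborel)"
  proof (rule nn_integral_cong)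
    fix v
    show "ennreal (f (s v) * (\<alpha> * v powr (- \<alpha> - 1)) * indicator {a..b} v) =
      ennreal \<alpha> * (ennreal (v powr (- \<alpha>) * k v) * indicator {a..b} v)"
    proof (cases "v \<in> {a..b}")
      case True
      then have v: "0 < v" using ab by auto
      then have "f (s v) = v * k v" using \<alpha> by (simp add: f_def s_def powr_powr)
      moreover have "v * v powr (- \<alpha> - 1) = v powr (- \<alpha>)"
        using v by (metis diff_add_cancel mult.commute powr_add powr_one less_imp_le)
      ultimately have eq: "f (s v) * (\<alpha> * v powr (- \<alpha> - 1)) = \<alpha> * (v powr (- \<alpha>) * k v)"
        by (simp add: mult_ac)
      show ?thesis unfolding eq using \<alpha> k[of v] True by (simp add: ennreal_mult)
    qed simp
  qed
  also have "\<dots> = ennreal \<alpha> * (\<integral>\<^sup>+v. ennreal (v powr (- \<alpha>) * k v) * indicator {a..b} v \<partial>lborel)"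
    by (rule nn_integral_cmult) measurable
  finally show ?thesis by (simp add: a_def b_def)
qed

context stable_domain
begin

section \<open>Identification of the limit and the error terms\<close>

lemma isCont_inv_char: "isCont inv_char v"
  unfolding inv_char_def[abs_def] continuous_at_sequentially comp_def
proof (intro allI impI)
  interpret G: real_distribution G by (rule G)
  fix X :: "nat \<Rightarrow> real" assume X: "X \<longlonglongrightarrow> v"
  show "(\<lambda>n. CLBINT s. iexp (- (s * X n)) * char G s) \<longlonglongrightarrow> (CLBINT s. iexp (- (s * v)) * char G s)"
  proof (rule integral_dominated_convergence[where w="\<lambda>s. norm (char G s)"])
    show "AE s in lborel. (\<lambda>n. iexp (- (s * X n)) * char G s) \<longlonglongrightarrow> iexp (- (s * v)) * char G s"
      by (intro AE_I2 tendsto_intros X)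
  qed (use integrable_char_G in \<open>auto simp: norm_mult\<close>)
qed

text \<open>The given \<open>g\<close> is only one version of the density. Inversion supplies the
  continuous version \<open>k\<close>; being equal to \<open>g\<close> almost everywhere it is real
  and nonnegative at every point, so \<open>middle\<close> can be read as a nonnegative
  integral.\<close>

lemma middle_eq:
  fixes g :: "real \<Rightarrow> real"
  assumes g: "g \<in> borel_measurable borel" "\<And>x. 0 \<le> g x" and Gg: "G = density lborel (\<lambda>x. ennreal (g x))"
    and \<delta>K: "0 < \<delta>" "\<delta> \<le> K"
  shows "ennreal (Re (middle \<delta> K) / (2 * pi)) =
    ennreal \<alpha> * (\<integral>\<^sup>+v\<in>{K powr (-1 / \<alpha>)..\<delta> powr (-1 / \<alpha>)}. ennreal (v powr (- \<alpha>) * g v) \<partial>lborel)"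
proof -
  have ae: "AE v in lborel. complex_of_real (g v) = 1 / (2 * pi) * inv_char v"
    using AE_eq_fourier_inversion[OF g] G integrable_char_G unfolding Gg[symmetric] inv_char_def by simp
  define k where "k = (\<lambda>v. cmod (inv_char v) / (2 * pi))"
  have "continuous_on UNIV inv_char" by (simp add: continuous_at_imp_continuous_on isCont_inv_char)
  then have inv_char_meas[measurable]: "inv_char \<in> borel_measurable borel" by (rule borel_measurable_continuous_onI)
  have k_meas[measurable]: "k \<in> borel_measurable borel" unfolding k_def by measurable
  have k0: "0 \<le> k v" for v by (simp add: k_def)
  have inv_char_eq: "inv_char v = complex_of_real (2 * pi * k v)" for v
  proof -
    have "AE v in lborel. inv_char v = complex_of_real (cmod (inv_char v))"
      using ae
    proof eventually_elim
      case (elim v)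
      then have "inv_char v = complex_of_real (2 * pi * g v)" by (simp add: field_simps)
      then show ?case using g(2)[of v] by (simp add: norm_mult)
    qed
    then have "inv_char v = complex_of_real (cmod (inv_char v))"
      by (rule AE_lborel_imp_eq) (intro continuous_intros isCont_inv_char)+
    then show ?thesis by (simp add: k_def)
  qed
  have k_ae: "AE v in lborel. k v = g v"
    using ae
  proof eventually_elim
    case (elim v)
    then have "complex_of_real (g v) = complex_of_real (k v)" by (simp add: inv_char_eq)
    then show ?case by simp
  qed
  let ?q = "\<lambda>u. u powr (-1 / \<alpha>) * k (u powr (-1 / \<alpha>))"
  have "continuous_on {\<delta>..K} ?q"
    unfolding k_def using \<delta>K
    by (intro continuous_intros continuous_on_compose2[OF \<open>continuous_on UNIV inv_char\<close>]) auto
  then have int: "integrable lborel (\<lambda>u. indicator {\<delta>..K} u * ?q u)"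
    using borel_integrable_compact[of "{\<delta>..K}" ?q] by simp
  have "middle \<delta> K = (CLBINT u. complex_of_real (2 * pi * (indicator {\<delta>..K} u * ?q u)))"
    unfolding middle_def by (intro Bochner_Integration.integral_cong refl) (simp add: inv_char_eq indicator_def)
  also have "\<dots> = complex_of_real (LBINT u. 2 * pi * (indicator {\<delta>..K} u * ?q u))"
    by (rule integral_complex_of_real)
  finally have "Re (middle \<delta> K) / (2 * pi) = (LBINT u. indicator {\<delta>..K} u * ?q u)" by simp
  then have "ennreal (Re (middle \<delta> K) / (2 * pi)) = (\<integral>\<^sup>+u. ennreal (indicator {\<delta>..K} u * ?q u) \<partial>lborel)"
    using int k0 by (subst nn_integral_eq_integral) auto
  also have "\<dots> = (\<integral>\<^sup>+u\<in>{\<delta>..K}. ennreal (?q u) \<partial>lborel)"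
    by (intro nn_integral_cong) (simp add: indicator_def)
  also have "\<dots> = ennreal \<alpha> * (\<integral>\<^sup>+v\<in>{K powr (-1 / \<alpha>)..\<delta> powr (-1 / \<alpha>)}. ennreal (v powr (- \<alpha>) * k v) \<partial>lborel)"
    using \<alpha> by (intro nn_integral_powr_substitution k_meas k0 \<delta>K) auto
  also have "(\<integral>\<^sup>+v\<in>{K powr (-1 / \<alpha>)..\<delta> powr (-1 / \<alpha>)}. ennreal (v powr (- \<alpha>) * k v) \<partial>lborel) =
     (\<integral>\<^sup>+v\<in>{K powr (-1 / \<alpha>)..\<delta> powr (-1 / \<alpha>)}. ennreal (v powr (- \<alpha>) * g v) \<partial>lborel)"
    by (intro nn_integral_cong_AE) (use k_ae in \<open>auto elim!: eventually_mono\<close>)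
  finally show ?thesis .
qed

text \<open>Inserting \<open>conv_pow_Ioc_small\<close> and \<open>sum_small_le\<close> leaves
  \<open>(m / A x)^2 * (x / a m)\<close> with \<open>m = idx \<delta> x\<close>, which tends to
  \<open>\<delta> powr (2 - 1 / \<alpha>)\<close>. The doubled constant turns the limit into an
  eventual bound.\<close>

lemma small_part:
  assumes "0 < h"
  obtains C where "0 < C" "\<And>\<delta>. 0 < \<delta> \<Longrightarrow> \<forall>\<^sub>F x in at_top.
    x / A x * (\<Sum>n<idx \<delta> x. measure (conv_pow F n) {x<..x+h}) \<le> C * \<delta> powr (2 - 1 / \<alpha>)"
proof -
  obtain C1 x0 where C1: "0 < C1" "\<And>n x. x0 \<le> x \<Longrightarrow> measure (conv_pow F n) {x<..x+h} \<le> C1 * Fbar F x * (n / a n)"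
    by (rule conv_pow_Ioc_small[OF assms]) blast
  obtain C2 N0 where C2: "0 < C2" "0 < N0" "\<And>N. N0 \<le> N \<Longrightarrow> (\<Sum>n\<le>N. real n / a n) \<le> C2 * (real N)\<^sup>2 / a N"
    by (rule sum_small_le) blast
  have "\<forall>\<^sub>F x in at_top. x / A x * (\<Sum>n<idx \<delta> x. measure (conv_pow F n) {x<..x+h})
      \<le> (2 * C1 * C2) * \<delta> powr (2 - 1 / \<alpha>)" if \<delta>: "0 < \<delta>" for \<delta>
  proof -
    let ?m = "idx \<delta>"
    have "((\<lambda>x. C1 * C2 * ((real (?m x) / A x)\<^sup>2 * (x / a (?m x)))) \<longlongrightarrow> C1 * C2 * (\<delta>\<^sup>2 * \<delta> powr (-1 / \<alpha>))) at_top"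
      using \<delta> by (intro tendsto_intros nat_floor_ratio x_over_a) auto
    moreover have "\<delta>\<^sup>2 * \<delta> powr (-1 / \<alpha>) = \<delta> powr (2 - 1 / \<alpha>)"
      using \<delta> by (simp add: powr_diff powr_minus_divide)
    ultimately have lim: "((\<lambda>x. C1 * C2 * ((real (?m x) / A x)\<^sup>2 * (x / a (?m x)))) \<longlongrightarrow> C1 * C2 * \<delta> powr (2 - 1 / \<alpha>)) at_top"
      by simp
    have "C1 * C2 * \<delta> powr (2 - 1 / \<alpha>) < (2 * C1 * C2) * \<delta> powr (2 - 1 / \<alpha>)"
      using C1 C2 \<delta> by simp
    from order_tendstoD(2)[OF lim this]
    have ev: "\<forall>\<^sub>F x in at_top. C1 * C2 * ((real (?m x) / A x)\<^sup>2 * (x / a (?m x))) < (2 * C1 * C2) * \<delta> powr (2 - 1 / \<alpha>)" .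
    have "\<forall>\<^sub>F x in at_top. N0 \<le> ?m x"
      using nat_floor_at_top[OF \<delta>] by (simp add: filterlim_at_top)
    with ev eventually_ge_at_top[of x0] eventually_gt_at_top[of 0] show ?thesis
    proof eventually_elim
      case (elim x)
      have "(\<Sum>n<?m x. measure (conv_pow F n) {x<..x+h}) \<le> (\<Sum>n<?m x. C1 * Fbar F x * (n / a n))"
        using elim by (intro sum_mono C1)
      also have "\<dots> \<le> (\<Sum>n\<le>?m x. C1 * Fbar F x * (n / a n))"
        using C1 Fbar_pos[of x] a_pos by (intro sum_mono2) (auto simp: less_imp_le)
      also have "\<dots> = C1 * Fbar F x * (\<Sum>n\<le>?m x. n / a n)"
        by (simp add: sum_distrib_left)
      also have "\<dots> \<le> C1 * Fbar F x * (C2 * (real (?m x))\<^sup>2 / a (?m x))"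
        using C1 Fbar_pos[of x] elim by (intro mult_left_mono C2) auto
      finally have "x / A x * (\<Sum>n<?m x. measure (conv_pow F n) {x<..x+h}) \<le>
        x / A x * (C1 * Fbar F x * (C2 * (real (?m x))\<^sup>2 / a (?m x)))"
        using elim A_pos[of x] by (intro mult_left_mono) auto
      also have "\<dots> = C1 * C2 * ((real (?m x) / A x)\<^sup>2 * (x / a (?m x)))"
        by (simp add: A_def power2_eq_square)
      finally show ?case using elim by linarith
    qed
  qed
  moreover have "0 < 2 * C1 * C2" using C1 C2 by simp
  ultimately show ?thesis using that by blast
qed

text \<open>The bound holds for all \<open>L\<close> beyond one common threshold in
  \<open>x\<close>, so it can be carried over to the infinite series. It decays in \<open>K\<close>
  because \<open>1 - 1 / \<alpha>\<close> is negative.\<close>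

lemma large_part:
  assumes "0 < h"
  obtains C where "0 < C" "\<And>K. 0 < K \<Longrightarrow> \<forall>\<^sub>F x in at_top. \<forall>L.
    x / A x * (\<Sum>n\<in>{idx K x..<L}. measure (conv_pow F n) {x<..x+h}) \<le> C * K powr (1 - 1 / \<alpha>)"
proof -
  obtain C1 where C1: "0 < C1" "\<And>n z. measure (conv_pow F n) {z<..z+h} \<le> C1 / a n"
    by (rule conv_pow_Ioc_le[OF assms]) blast
  obtain C2 N0 where C2: "0 < C2" "0 < N0" "\<And>N L. N0 \<le> N \<Longrightarrow> (\<Sum>n\<in>{N..<L}. 1 / a n) \<le> C2 * real N / a N"
    by (rule sum_large_le) blast
  have "\<forall>\<^sub>F x in at_top. \<forall>L. x / A x * (\<Sum>n\<in>{idx K x..<L}. measure (conv_pow F n) {x<..x+h})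
      \<le> (2 * C1 * C2) * K powr (1 - 1 / \<alpha>)" if K: "0 < K" for K
  proof -
    let ?M = "idx K"
    have "((\<lambda>x. C1 * C2 * ((real (?M x) / A x) * (x / a (?M x)))) \<longlongrightarrow> C1 * C2 * (K * K powr (-1 / \<alpha>))) at_top"
      using K by (intro tendsto_intros nat_floor_ratio x_over_a) auto
    moreover have "K * K powr (-1 / \<alpha>) = K powr (1 - 1 / \<alpha>)"
      using K by (simp add: powr_diff powr_minus_divide)
    ultimately have lim: "((\<lambda>x. C1 * C2 * ((real (?M x) / A x) * (x / a (?M x)))) \<longlongrightarrow> C1 * C2 * K powr (1 - 1 / \<alpha>)) at_top"
      by simp
    have "C1 * C2 * K powr (1 - 1 / \<alpha>) < (2 * C1 * C2) * K powr (1 - 1 / \<alpha>)"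
      using C1 C2 K by simp
    from order_tendstoD(2)[OF lim this]
    have ev: "\<forall>\<^sub>F x in at_top. C1 * C2 * ((real (?M x) / A x) * (x / a (?M x))) < (2 * C1 * C2) * K powr (1 - 1 / \<alpha>)" .
    have "\<forall>\<^sub>F x in at_top. N0 \<le> ?M x"
      using nat_floor_at_top[OF K] by (simp add: filterlim_at_top)
    with ev eventually_gt_at_top[of 0] show ?thesis
    proof eventually_elim
      case (elim x)
      show ?case
      proof
        fix L
        have "(\<Sum>n\<in>{?M x..<L}. measure (conv_pow F n) {x<..x+h}) \<le> (\<Sum>n\<in>{?M x..<L}. C1 * (1 / a n))"
          using C1 by (intro sum_mono) simp
        also have "\<dots> = C1 * (\<Sum>n\<in>{?M x..<L}. 1 / a n)"
          by (simp add: sum_distrib_left)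
        also have "\<dots> \<le> C1 * (C2 * real (?M x) / a (?M x))"
          using C1 elim by (intro mult_left_mono C2) auto
        finally have "x / A x * (\<Sum>n\<in>{?M x..<L}. measure (conv_pow F n) {x<..x+h}) \<le>
          x / A x * (C1 * (C2 * real (?M x) / a (?M x)))"
          using elim A_pos[of x] by (intro mult_left_mono) auto
        also have "\<dots> = C1 * C2 * ((real (?M x) / A x) * (x / a (?M x)))" by simp
        finally show "x / A x * (\<Sum>n\<in>{?M x..<L}. measure (conv_pow F n) {x<..x+h}) \<le> (2 * C1 * C2) * K powr (1 - 1 / \<alpha>)"
          using elim by linarith
      qed
    qed
  qed
  moreover have "0 < 2 * C1 * C2" using C1 C2 by simp
  ultimately show ?thesis using that by blast
qed

lemma summable_conv_pow:
  assumes "0 < h"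
  shows "summable (\<lambda>n. measure (conv_pow F n) {x<..x+h})"
proof -
  obtain C1 where C1: "0 < C1" "\<And>n z. measure (conv_pow F n) {z<..z+h} \<le> C1 / a n"
    by (rule conv_pow_Ioc_le[OF assms]) blast
  obtain C2 N0 where C2: "0 < C2" "0 < N0" "\<And>N L. N0 \<le> N \<Longrightarrow> (\<Sum>n\<in>{N..<L}. 1 / a n) \<le> C2 * real N / a N"
    by (rule sum_large_le) blast
  have "summable (\<lambda>n. 1 / a (n + N0))"
  proof (rule summableI_nonneg_bounded)
    fix n
    have "(\<Sum>i<n. 1 / a (i + N0)) = (\<Sum>i\<in>{N0..<n + N0}. 1 / a i)"
      using sum.shift_bounds_nat_ivl[of "\<lambda>i. 1 / a i" 0 N0 n] by (simp add: atLeast0LessThan)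
    then show "(\<Sum>i<n. 1 / a (i + N0)) \<le> C2 * real N0 / a N0"
      using C2(3)[of N0 "n + N0"] by simp
  qed (use a_pos in \<open>auto simp: less_imp_le\<close>)
  then have "summable (\<lambda>n. 1 / a n)" by (rule summable_iff_shift[THEN iffD1])
  then have "summable (\<lambda>n. C1 * (1 / a n))" by (rule summable_mult)
  then show ?thesis
    by (rule summable_comparison_test[rotated]) (use C1 in auto)
qed

lemma renewal_eq:
  assumes "0 < h"
  shows "renewal F {x<..x+h} = ennreal (\<Sum>n. measure (conv_pow F n) {x<..x+h})"
proof -
  interpret N: real_distribution "conv_pow F n" for n
    by (rule real_distribution_walk)
  show ?thesis
    unfolding renewal_def N.emeasure_eq_measure
    by (rule suminf_ennreal2) (use summable_conv_pow[OF assms] in auto)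
qed

text \<open>The assumption \<open>block\<close> isolates the part where the lattice and the
  non-lattice case differ; truncation and passage to the limit are common to both.\<close>

lemma renewal_limit:
  fixes g :: "real \<Rightarrow> real"
  assumes h: "0 < h" and g: "g \<in> borel_measurable borel" "\<And>x. 0 \<le> g x" and Gg: "G = density lborel (\<lambda>x. ennreal (g x))"
    and block: "\<And>\<delta> K. 0 < \<delta> \<Longrightarrow> \<delta> < K \<Longrightarrow>
      ((\<lambda>x. complex_of_real (block_hits h \<delta> K x)) \<longlongrightarrow> h / (2 * pi) * middle \<delta> K) at_top"
  shows "((\<lambda>x. ennreal (x * Fbar F x) * renewal F {x<..x+h}) \<longlongrightarrow>
            ennreal (\<alpha> * h) * (\<integral>\<^sup>+ x\<in>{0<..}. ennreal (x powr (-\<alpha>) * g x) \<partial>lborel)) at_top"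
proof -
  obtain Cs where Cs: "0 < Cs" "\<And>\<delta>. 0 < \<delta> \<Longrightarrow> \<forall>\<^sub>F x in at_top.
    x / A x * (\<Sum>n<idx \<delta> x. measure (conv_pow F n) {x<..x+h}) \<le> Cs * \<delta> powr (2 - 1 / \<alpha>)"
    by (rule small_part[OF h]) blast
  obtain Cl where Cl: "0 < Cl" "\<And>K. 0 < K \<Longrightarrow> \<forall>\<^sub>F x in at_top. \<forall>L.
    x / A x * (\<Sum>n\<in>{idx K x..<L}. measure (conv_pow F n) {x<..x+h}) \<le> Cl * K powr (1 - 1 / \<alpha>)"
    by (rule large_part[OF h]) blast
  \<comment> \<open>One parameter drives both cut-offs, \<open>\<delta> j = 1 / K j\<close>; the two
    errors vanish since \<open>2 - 1 / \<alpha> > 0 > 1 - 1 / \<alpha>\<close>.\<close>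
  define K where "K = (\<lambda>j::nat. 2 + real j)"
  define \<delta> where "\<delta> = (\<lambda>j::nat. 1 / K j)"
  have K: "1 < K j" and \<delta>: "0 < \<delta> j" "\<delta> j < 1" "\<delta> j < K j" for j
  proof -
    show "1 < K j" by (simp add: K_def)
    then show "0 < \<delta> j" "\<delta> j < 1" by (auto simp: \<delta>_def)
    then show "\<delta> j < K j" using \<open>1 < K j\<close> by linarith
  qed
  have K_lim: "filterlim K at_top sequentially"
    unfolding K_def by (rule filterlim_tendsto_add_at_top[OF tendsto_const filterlim_real_sequentially])
  define u where "u = (\<lambda>x. x / A x * (\<Sum>n. measure (conv_pow F n) {x<..x+h}))"
  define e where "e = (\<lambda>j. Cs * \<delta> j powr (2 - 1 / \<alpha>) + Cl * K j powr (1 - 1 / \<alpha>))"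
  define v where "v = (\<lambda>j. h * (Re (middle (\<delta> j) (K j)) / (2 * pi)))"
  have u_eq: "\<forall>\<^sub>F x in at_top. ennreal (u x) = ennreal (x * Fbar F x) * renewal F {x<..x+h}"
    using eventually_gt_at_top[of 0]
  proof eventually_elim
    case (elim x)
    have "0 \<le> (\<Sum>n. measure (conv_pow F n) {x<..x+h})"
      by (rule suminf_nonneg[OF summable_conv_pow[OF h]]) simp
    moreover have "u x = x * Fbar F x * (\<Sum>n. measure (conv_pow F n) {x<..x+h})"
      by (simp add: u_def A_def)
    ultimately show ?case
      using elim Fbar_pos[of x] by (simp add: renewal_eq[OF h] ennreal_mult)
  qed
  have "((\<lambda>x. ennreal (u x)) \<longlongrightarrow> ennreal (\<alpha> * h) * (\<integral>\<^sup>+ x\<in>{0<..}. ennreal (x powr (-\<alpha>) * g x) \<partial>lborel)) at_top"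
  proof (rule tendsto_ennreal_by_approximation[where w = "\<lambda>j. block_hits h (\<delta> j) (K j)" and e = e and v = v])
    fix j
    show "(block_hits h (\<delta> j) (K j) \<longlongrightarrow> v j) at_top"
      using tendsto_Re[OF block[OF \<delta>(1,3), of j]] by (simp add: v_def)
    show "\<forall>\<^sub>F x in at_top. \<bar>u x - block_hits h (\<delta> j) (K j) x\<bar> \<le> e j"
    proof -
      have K0: "0 < K j" using K[of j] by linarith
      show ?thesis
        using Cs(2)[OF \<delta>(1)[of j]] Cl(2)[OF K0] eventually_gt_at_top[of 0]
      proof eventually_elim
        case (elim x)
        let ?m = "idx (\<delta> j) x" and ?M = "idx (K j) x"
        let ?p = "\<lambda>n. measure (conv_pow F n) {x<..x+h}"
        have xA: "0 < x / A x" using elim A_pos[of x] by simp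
        have mM: "?m \<le> ?M"
          using \<delta>(3)[of j] A_pos[of x] by (intro nat_mono floor_mono mult_right_mono) auto
        have "(\<Sum>n\<in>{?m..<?M}. ?p n) \<le> suminf ?p"
          by (rule sum_le_suminf[OF summable_conv_pow[OF h]]) auto
        then have lower: "block_hits h (\<delta> j) (K j) x \<le> u x"
          unfolding block_hits_def u_def using xA by (intro mult_left_mono) auto
        \<comment> \<open>The series is bounded through its partial sums, because
          \<open>large_part\<close> controls finite stretches of any length.\<close>
        have "suminf ?p \<le> (block_hits h (\<delta> j) (K j) x + e j) / (x / A x)"
        proof (rule suminf_le_const[OF summable_conv_pow[OF h]])
          fix L
          have "{..<L} \<subseteq> {..<?m} \<union> {?m..<?M} \<union> {?M..<L}" by auto
          then have "(\<Sum>n<L. ?p n) \<le> (\<Sum>n\<in>{..<?m} \<union> {?m..<?M} \<union> {?M..<L}. ?p n)"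
            by (intro sum_mono2) auto
          also have "\<dots> = (\<Sum>n<?m. ?p n) + (\<Sum>n\<in>{?m..<?M}. ?p n) + (\<Sum>n\<in>{?M..<L}. ?p n)"
            using mM by (subst sum.union_disjoint, auto)+
          finally have "x / A x * (\<Sum>n<L. ?p n) \<le> x / A x * ((\<Sum>n<?m. ?p n) + (\<Sum>n\<in>{?m..<?M}. ?p n) + (\<Sum>n\<in>{?M..<L}. ?p n))"
            using xA by (intro mult_left_mono) auto
          also have "\<dots> \<le> block_hits h (\<delta> j) (K j) x + e j"
            using elim(1) elim(2)[rule_format, of L] unfolding block_hits_def e_def distrib_left by linarith
          finally show "(\<Sum>n<L. ?p n) \<le> (block_hits h (\<delta> j) (K j) x + e j) / (x / A x)"
            using xA by (simp only: pos_le_divide_eq[OF xA] mult.commute)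
        qed
        then have "u x \<le> block_hits h (\<delta> j) (K j) x + e j"
          unfolding u_def by (simp only: pos_le_divide_eq[OF xA] mult.commute)
        with lower show ?case by linarith
      qed
    qed
  next
    have \<alpha>': "0 < 2 - 1 / \<alpha>" "1 - 1 / \<alpha> < 0" using \<alpha> by (auto simp: field_simps)
    have "\<delta> \<longlonglongrightarrow> 0"
      unfolding \<delta>_def by (intro tendsto_divide_0[OF tendsto_const] filterlim_at_top_imp_at_infinity K_lim)
    then have "(\<lambda>j. \<delta> j powr (2 - 1 / \<alpha>)) \<longlonglongrightarrow> 0 powr (2 - 1 / \<alpha>)"
      using \<alpha>' \<delta>(1) by (intro tendsto_powr' tendsto_const) (auto intro!: always_eventually less_imp_le)
    moreover have "(\<lambda>j. K j powr (1 - 1 / \<alpha>)) \<longlonglongrightarrow> 0"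
      by (rule tendsto_neg_powr[OF \<alpha>'(2) K_lim])
    ultimately have "e \<longlonglongrightarrow> Cs * 0 + Cl * 0"
      unfolding e_def by (intro tendsto_intros) simp_all
    then show "e \<longlonglongrightarrow> 0" by simp
  next
    let ?I = "\<lambda>j. {K j powr (-1 / \<alpha>)..\<delta> j powr (-1 / \<alpha>)}"
    let ?q = "\<lambda>v. ennreal (v powr (- \<alpha>) * g v)"
    have \<delta>_powr: "\<delta> j powr (-1 / \<alpha>) = K j powr (1 / \<alpha>)" for j
      using K[of j] by (simp add: \<delta>_def powr_divide powr_minus_divide)
    have v_eq: "ennreal (v j) = ennreal (\<alpha> * h) * (\<integral>\<^sup>+v. ?q v * indicator (?I j) v \<partial>lborel)" for j
    proof -
      have "ennreal (v j) = ennreal h * ennreal (Re (middle (\<delta> j) (K j)) / (2 * pi))"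
        unfolding v_def using h by (rule ennreal_mult'[OF less_imp_le])
      also have "ennreal (Re (middle (\<delta> j) (K j)) / (2 * pi)) = ennreal \<alpha> * (\<integral>\<^sup>+v. ?q v * indicator (?I j) v \<partial>lborel)"
        using \<delta>[of j] by (intro middle_eq g Gg) auto
      finally show ?thesis using h \<alpha> by (simp add: ennreal_mult mult_ac)
    qed
    \<comment> \<open>Monotone convergence: the windows are \<open>K powr (-1 / \<alpha>)\<close> to
      \<open>K powr (1 / \<alpha>)\<close> and increase to the positive half-line.\<close>
    have "(\<lambda>j. \<integral>\<^sup>+v. ?q v * indicator (?I j) v \<partial>lborel) \<longlonglongrightarrow> (\<integral>\<^sup>+v. ?q v * indicator {0<..} v \<partial>lborel)"
    proof (rule nn_integral_LIMSEQ)
      have I_mono: "?I i \<subseteq> ?I j" if "i \<le> j" for i j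
      proof -
        have "K i \<le> K j" "0 < K i" using that K[of i] by (auto simp: K_def)
        then have "K j powr (-1 / \<alpha>) \<le> K i powr (-1 / \<alpha>)"
          using \<alpha> by (intro powr_mono2') auto
        moreover have "K i powr (1 / \<alpha>) \<le> K j powr (1 / \<alpha>)"
          using \<alpha> \<open>K i \<le> K j\<close> \<open>0 < K i\<close> by (intro powr_mono2) auto
        ultimately show ?thesis unfolding \<delta>_powr by auto
      qed
      show "incseq (\<lambda>j v. ?q v * indicator (?I j) v)"
      proof (intro incseq_SucI le_funI mult_left_mono)
        fix i v show "indicator (?I i) v \<le> (indicator (?I (Suc i)) v :: ennreal)"
          using I_mono[of i "Suc i"] by (auto simp: indicator_def simp del: atLeastAtMost_iff atLeastatMost_subset_iff)
      qed simp
      show "(\<lambda>j. ?q v * indicator (?I j) v) \<longlonglongrightarrow> ?q v * indicator {0<..} v" for v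
      proof (rule tendsto_eventually, cases "0 < v")
        case True
        have "(\<lambda>j. K j powr (-1 / \<alpha>)) \<longlonglongrightarrow> 0"
          by (rule tendsto_neg_powr[OF _ K_lim]) (use \<alpha> in auto)
        then have 1: "\<forall>\<^sub>F j in sequentially. K j powr (-1 / \<alpha>) < v"
          using True by (rule order_tendstoD)
        have 2: "\<forall>\<^sub>F j in sequentially. v powr \<alpha> \<le> K j"
          using K_lim by (simp add: filterlim_at_top)
        show "\<forall>\<^sub>F j in sequentially. ?q v * indicator (?I j) v = ?q v * indicator {0<..} v"
          using 1 2
        proof eventually_elim
          case (elim j)
          have "(v powr \<alpha>) powr (1 / \<alpha>) \<le> K j powr (1 / \<alpha>)"
            using elim True \<alpha> by (intro powr_mono2) auto
          then have "v \<le> \<delta> j powr (-1 / \<alpha>)"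
            unfolding \<delta>_powr using True \<alpha> by (simp add: powr_powr)
          then show ?case using elim True by simp
        qed
      next
        case False
        have "0 < K j powr (-1 / \<alpha>)" for j using K[of j] by simp
        then have "v \<notin> ?I j" for j using False by (smt (verit) atLeastAtMost_iff)
        then show "\<forall>\<^sub>F j in sequentially. ?q v * indicator (?I j) v = ?q v * indicator {0<..} v"
          using False by simp
      qed
    qed (use g in measurable)
    then show "(\<lambda>j. ennreal (v j)) \<longlonglongrightarrow> ennreal (\<alpha> * h) * (\<integral>\<^sup>+ x\<in>{0<..}. ennreal (x powr (-\<alpha>) * g x) \<partial>lborel)"
      unfolding v_eq by (intro ennreal_tendsto_cmult) auto
  qed
  then show ?thesis
    by (rule Lim_transform_eventually[OF _ u_eq])
qed

end

section \<open>The span and the zeros of \<open>1 - char F\<close>\<close>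

context heavy_tail
begin

lemma char_eq_1_imp_lattice:
  assumes "t \<noteq> 0" "char F t = 1"
  shows "lattice_on F (2 * pi / \<bar>t\<bar>)"
proof -
  have "char F \<bar>t\<bar> = 1"
    using char_uminus[OF real_distribution_axioms, of t] assms by (cases "0 \<le> t") auto
  then show ?thesis
    using assms by (subst lattice_on_iff[OF real_distribution_axioms]) auto
qed

text \<open>The spans correspond to the positive zeros of \<open>1 - \<phi>\<close>, a closed set bounded away from \<open>0\<close>.\<close>

lemma lattice_on_span:
  assumes "arithmetic F"
  shows "lattice_on F (span F)" and "lattice_on F h \<Longrightarrow> h \<le> span F"
proof -
  obtain c \<eta> where c: "c > 0" "\<eta> > 0"
    "\<And>t. t \<noteq> 0 \<Longrightarrow> \<bar>t\<bar> \<le> \<eta> \<Longrightarrow> cmod (char F t) \<le> exp (- (c * Fbar F (1 / \<bar>t\<bar>)))"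
    by (rule char_decay) blast
  define Z where "Z = {t. \<eta> \<le> t \<and> char F t = 1}"
  \<comment> \<open>By \<open>char_decay\<close> no positive zero lies below \<open>\<eta>\<close>,
    so the closed set \<open>Z\<close> contains all of them.\<close>
  have Z: "t \<in> Z \<longleftrightarrow> 0 < t \<and> char F t = 1" for t
  proof -
    have "char F t \<noteq> 1" if "0 < t" "t < \<eta>"
    proof -
      have "cmod (char F t) \<le> exp (- (c * Fbar F (1 / \<bar>t\<bar>)))" using that by (intro c) auto
      also have "\<dots> < 1" using c Fbar_pos by simp
      finally show ?thesis by auto
    qed
    then show ?thesis unfolding Z_def using c(2) by force
  qed
  obtain h0 where h0: "lattice_on F h0" using assms by (auto simp: arithmetic_def)
  then have "0 < h0" by (simp add: lattice_on_def)
  then have "2 * pi / h0 \<in> Z"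
    using h0 lattice_on_iff[OF real_distribution_axioms, of h0] by (simp add: Z)
  then have "Z \<noteq> {}" by blast
  moreover have "bdd_below Z" by (rule bdd_belowI[of _ \<eta>]) (simp add: Z_def)
  moreover have "closed Z"
    unfolding Z_def
    by (intro closed_Collect_conj closed_Collect_le closed_Collect_eq continuous_intros
        continuous_at_imp_continuous_on ballI isCont_char)
  ultimately have Inf: "Inf Z \<in> Z" "\<And>t. t \<in> Z \<Longrightarrow> Inf Z \<le> t"
    by (auto intro: closed_contains_Inf cInf_lower)
  have "lattice_on F (2 * pi / Inf Z)"
    using Inf(1) char_eq_1_imp_lattice[of "Inf Z"] by (simp add: Z)
  moreover have le: "h \<le> 2 * pi / Inf Z" if "lattice_on F h" for h
  proof -
    have h: "0 < h" using that by (simp add: lattice_on_def)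
    then have "2 * pi / h \<in> Z"
      using that lattice_on_iff[OF real_distribution_axioms, of h] by (simp add: Z)
    then have "Inf Z \<le> 2 * pi / h" by (rule Inf)
    moreover have "0 < Inf Z" using Inf(1) by (simp add: Z)
    ultimately show ?thesis using h by (simp add: field_simps)
  qed
  \<comment> \<open>The least positive zero corresponds to the largest lattice step, so the greatest
    element in the definition of \<open>span\<close> exists.\<close>
  ultimately have "span F = 2 * pi / Inf Z"
    unfolding span_def by (intro Greatest_equality) auto
  with le \<open>lattice_on F (2 * pi / Inf Z)\<close>
  show "lattice_on F (span F)" and "lattice_on F h \<Longrightarrow> h \<le> span F" by auto
qed

section \<open>The norming constants\<close>

lemma powr_scale_solution:
  assumes "0 < q"
  obtains \<mu> where "0 < \<mu>" "\<mu> powr \<alpha> * \<mu> = q" "q < 1 \<Longrightarrow> \<mu> < 1" "1 < q \<Longrightarrow> 1 < \<mu>"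
proof
  let ?\<mu> = "q powr (1 / (\<alpha> + 1))"
  show "0 < ?\<mu>" using assms by simp
  then have "?\<mu> powr \<alpha> * ?\<mu> = ?\<mu> powr (\<alpha> + 1)" by (simp add: powr_add)
  then show "?\<mu> powr \<alpha> * ?\<mu> = q" using \<alpha> assms by (simp add: powr_powr)
  show "?\<mu> < 1" if "q < 1"
    using that assms \<alpha> powr_less_mono2[of "1 / (\<alpha> + 1)" q 1] by simp
  show "1 < ?\<mu>" if "1 < q"
    using that \<alpha> powr_less_mono2[of "1 / (\<alpha> + 1)" 1 q] by simp
qed

text \<open>Since \<open>r\<close> may jump, \<open>r (a n)\<close> need not be close to
  \<open>n\<close>. Instead \<open>r\<close> is evaluated slightly below and slightly above
  \<open>a n\<close>, and monotonicity of \<open>A\<close> bridges the gap. The number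
  \<open>\<mu>\<close> serves both as the dilation of the argument and as the tolerance for
  \<open>r / A\<close>, whence the total factor \<open>\<mu> powr \<alpha> * \<mu>\<close>.\<close>

lemma scale_ratio:
  assumes a: "filterlim a at_top sequentially" and r: "((\<lambda>x. r x / A x) \<longlongrightarrow> 1) at_top"
    and below: "\<And>n t. 1 \<le> t \<Longrightarrow> t < a n \<Longrightarrow> r t \<le> real n"
    and above: "\<And>n s. a n < s \<Longrightarrow> \<exists>t. a n \<le> t \<and> t < s \<and> real n < r t"
  shows "(\<lambda>n. A (a n) / real n) \<longlonglongrightarrow> 1"
proof -
  have a_pos: "\<forall>\<^sub>F n in sequentially. 0 < a n" using a by (simp add: filterlim_at_top_dense)
  have "(\<lambda>n. real n / A (a n)) \<longlonglongrightarrow> 1"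
  proof (rule order_tendstoI)
    fix p :: real assume "p < 1"
    \<comment> \<open>Keeps the target \<open>(1 + p') / 2\<close> positive and strictly between
      \<open>p'\<close> and 1.\<close>
    define p' where "p' = max p (1/2)"
    have p': "0 < p'" "p' < 1" "p \<le> p'" using \<open>p < 1\<close> by (auto simp: p'_def)
    obtain \<mu> where \<mu>: "0 < \<mu>" "\<mu> powr \<alpha> * \<mu> = (1 + p') / 2" and "\<mu> < 1"
      using powr_scale_solution[of "(1 + p') / 2"] p'(1,2) by auto
    have "(\<lambda>n. A (\<mu> * a n) / A (a n) * \<mu>) \<longlonglongrightarrow> \<mu> powr \<alpha> * \<mu>"
      by (intro tendsto_mult tendsto_const filterlim_compose[OF A_ratio[OF \<mu>(1)] a])
    moreover have "p < \<mu> powr \<alpha> * \<mu>" using p' \<mu>(2) by simp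
    ultimately have ev1: "\<forall>\<^sub>F n in sequentially. p < A (\<mu> * a n) / A (a n) * \<mu>"
      by (rule order_tendstoD)
    have \<mu>a: "filterlim (\<lambda>n. \<mu> * a n) at_top sequentially"
      by (rule filterlim_tendsto_pos_mult_at_top[OF tendsto_const \<mu>(1) a])
    have "\<forall>\<^sub>F n in sequentially. \<mu> < r (\<mu> * a n) / A (\<mu> * a n)"
      by (rule order_tendstoD(1)[OF filterlim_compose[OF r \<mu>a] \<open>\<mu> < 1\<close>])
    moreover have "\<forall>\<^sub>F n in sequentially. 1 \<le> \<mu> * a n"
      using \<mu>a by (simp add: filterlim_at_top)
    ultimately show "\<forall>\<^sub>F n in sequentially. p < real n / A (a n)"
      using ev1 a_pos
    proof eventually_elim
      case (elim n)
      have "\<mu> * a n < a n" using \<open>\<mu> < 1\<close> elim(4) by simp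
      with elim(2) have "r (\<mu> * a n) \<le> real n" by (rule below)
      then have "\<mu> * A (\<mu> * a n) \<le> real n"
        using elim(1) A_pos[of "\<mu> * a n"] by (simp add: pos_less_divide_eq)
      then have "A (\<mu> * a n) / A (a n) * \<mu> \<le> real n / A (a n)"
        using A_pos[of "a n"] by (simp add: divide_right_mono mult.commute)
      then show ?case using elim(3) by linarith
    qed
  next
    fix q :: real assume q: "1 < q"
    obtain \<mu> where \<mu>: "0 < \<mu>" "\<mu> powr \<alpha> * \<mu> = (1 + q) / 2" and "1 < \<mu>"
      using powr_scale_solution[of "(1 + q) / 2"] q by auto
    have "(\<lambda>n. A (\<mu> * a n) / A (a n) * \<mu>) \<longlonglongrightarrow> \<mu> powr \<alpha> * \<mu>"
      by (intro tendsto_mult tendsto_const filterlim_compose[OF A_ratio[OF \<mu>(1)] a])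
    moreover have "\<mu> powr \<alpha> * \<mu> < q" using q \<mu>(2) by simp
    ultimately have ev1: "\<forall>\<^sub>F n in sequentially. A (\<mu> * a n) / A (a n) * \<mu> < q"
      by (rule order_tendstoD)
    have "\<forall>\<^sub>F x in at_top. r x / A x < \<mu>"
      by (rule order_tendstoD(2)[OF r \<open>1 < \<mu>\<close>])
    then obtain x0 where x0: "\<And>x. x0 \<le> x \<Longrightarrow> r x / A x < \<mu>" by (auto simp: eventually_at_top_linorder)
    have "\<forall>\<^sub>F n in sequentially. x0 \<le> a n" using a by (simp add: filterlim_at_top)
    then show "\<forall>\<^sub>F n in sequentially. real n / A (a n) < q"
      using ev1 a_pos
    proof eventually_elim
      case (elim n)
      have "a n < \<mu> * a n" using \<open>1 < \<mu>\<close> elim(3) by simp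
      then obtain t where t: "a n \<le> t" "t < \<mu> * a n" "real n < r t" using above by blast
      have "r t < \<mu> * A t"
        using x0[of t] t elim(1) A_pos[of t] by (simp add: pos_divide_less_eq)
      also have "\<dots> \<le> \<mu> * A (\<mu> * a n)"
        using \<mu> t by (intro mult_left_mono A_mono) auto
      finally have "real n \<le> \<mu> * A (\<mu> * a n)" using t by linarith
      then have "real n / A (a n) \<le> A (\<mu> * a n) / A (a n) * \<mu>"
        using A_pos[of "a n"] by (simp add: divide_right_mono mult.commute)
      then show ?case using elim(2) by linarith
    qed
  qed
  from tendsto_inverse[OF this] show ?thesis by simp
qed

text \<open>If the norming sequence stayed bounded by \<open>B\<close>, then \<open>\<bar>\<phi> (s / a\<^sub>n)\<bar> \<le> exp (- c * Fbar (B / s))\<close> would force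
  \<open>char G s = 0\<close> for all small \<open>s > 0\<close>, contradicting the continuity of \<open>char G\<close> at \<open>0\<close>.\<close>

lemma scale_at_top:
  assumes mono: "\<And>m n. m \<le> n \<Longrightarrow> a m \<le> a n" and ge: "\<And>n. 1 \<le> a n" and G: "real_distribution G"
    and lim: "\<And>s. (\<lambda>n. char F (s / a n) ^ n) \<longlonglongrightarrow> char G s"
  shows "filterlim a at_top sequentially"
proof (rule ccontr)
  assume not: "\<not> filterlim a at_top sequentially"
  obtain B where B: "\<And>n. a n \<le> B"
  proof -
    from not obtain Z where Z: "\<not> (\<forall>\<^sub>F n in sequentially. Z \<le> a n)" by (auto simp: filterlim_at_top)
    have "a n \<le> Z" for n
    proof (rule ccontr)
      assume "\<not> a n \<le> Z"
      then have "\<forall>m\<ge>n. Z \<le> a m" using mono[of n] by (meson linear order_trans)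
      with Z show False by (auto simp: eventually_sequentially)
    qed
    then show ?thesis using that by blast
  qed
  obtain c \<eta> where c: "c > 0" "\<eta> > 0"
    "\<And>t. t \<noteq> 0 \<Longrightarrow> \<bar>t\<bar> \<le> \<eta> \<Longrightarrow> cmod (char F t) \<le> exp (- (c * Fbar F (1 / \<bar>t\<bar>)))"
    by (rule char_decay) blast
  interpret G: real_distribution G by fact
  have zero: "char G s = 0" if s: "0 < s" "s \<le> \<eta>" for s
  proof -
    define \<rho> where "\<rho> = exp (- (c * Fbar F (B / s)))"
    have \<rho>: "0 \<le> \<rho>" "\<rho> < 1" using c Fbar_pos by (simp_all add: \<rho>_def)
    have "(\<lambda>n. char F (s / a n) ^ n) \<longlonglongrightarrow> 0"
    proof (rule Lim_null_comparison)
      show "(\<lambda>n. \<rho> ^ n) \<longlonglongrightarrow> 0" by (rule LIMSEQ_realpow_zero[OF \<rho>])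
      have "norm (char F (s / a n) ^ n) \<le> \<rho> ^ n" for n
        unfolding norm_power
      proof (rule power_mono)
        have an: "0 < a n" using ge[of n] by linarith
        have "s / a n \<le> s / 1" using s ge[of n] by (intro divide_left_mono) auto
        then have "cmod (char F (s / a n)) \<le> exp (- (c * Fbar F (1 / \<bar>s / a n\<bar>)))"
          using s an by (intro c) auto
        also have "1 / \<bar>s / a n\<bar> = a n / s" using s an by simp
        also have "exp (- (c * Fbar F (a n / s))) \<le> \<rho>"
          unfolding \<rho>_def using s c B[of n] by (simp add: Fbar_mono divide_right_mono)
        finally show "cmod (char F (s / a n)) \<le> \<rho>" .
      qed simp
      then show "\<forall>\<^sub>F n in sequentially. norm (char F (s / a n) ^ n) \<le> \<rho> ^ n" by simp
    qed
    from LIMSEQ_unique[OF lim this] show ?thesis .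
  qed
  have "(\<lambda>n. \<eta> / real (Suc n)) \<longlonglongrightarrow> 0"
    using tendsto_mult[OF tendsto_const[of \<eta>] LIMSEQ_Suc[OF lim_1_over_n]] by simp
  then have "(\<lambda>n. char G (\<eta> / real (Suc n))) \<longlonglongrightarrow> char G 0"
    by (rule isCont_tendsto_compose[OF G.isCont_char])
  moreover have "char G (\<eta> / real (Suc n)) = 0" for n
    using c(2) by (intro zero) (auto simp: field_simps)
  ultimately have "char G 0 = 0" by (simp add: LIMSEQ_const_iff)
  then show False using G.char_zero by simp
qed

text \<open>Nothing prevents \<open>r\<close> from being unbounded on a bounded interval, so
  divergence of \<open>rinv r n\<close> is not automatic; it is extracted from the convergence in
  law, and only then can \<open>A\<close> be compared with \<open>n\<close>.\<close>

lemma stable_domain_rinv: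
  assumes r: "((\<lambda>x. r x / A x) \<longlongrightarrow> 1) at_top" and G: "real_distribution G"
    and stable: "weak_conv_m (\<lambda>n. distr (conv_pow F n) borel (\<lambda>x. x / rinv r (real n))) G"
  shows "stable_domain F \<alpha> (\<lambda>n. rinv r (real n)) G"
proof -
  let ?a = "\<lambda>n. rinv r (real n)"
  let ?S = "\<lambda>n. {t. 1 \<le> t \<and> real n < r t}"
  interpret N: real_distribution "conv_pow F n" for n
    by (rule real_distribution_walk)
  have "filterlim (\<lambda>x. r x / A x * A x) at_top at_top"
    by (rule filterlim_tendsto_pos_mult_at_top[OF r _ A_at_top]) simp
  then have r_top: "filterlim r at_top at_top"
    using A_pos by (simp add: less_imp_neq[symmetric])
  \<comment> \<open>As \<open>r\<close> tends to infinity, the sets in the definition of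
    \<open>rinv\<close> are nonempty and the infima are genuine.\<close>
  have ne: "?S n \<noteq> {}" for n
  proof -
    have "\<forall>\<^sub>F x in at_top. real n < r x" using r_top by (simp add: filterlim_at_top_dense)
    then have "\<forall>\<^sub>F x in at_top. 1 \<le> x \<and> real n < r x" using eventually_ge_at_top[of 1] by eventually_elim auto
    then show ?thesis using eventually_happens'[OF trivial_limit_at_top_linorder] by blast
  qed
  have bdd: "bdd_below (?S n)" for n by (rule bdd_belowI[of _ 1]) auto
  have ge: "1 \<le> ?a n" for n
    unfolding rinv_def by (intro cInf_greatest ne) auto
  have mono: "?a m \<le> ?a n" if "m \<le> n" for m n
    unfolding rinv_def using that by (intro cInf_superset_mono ne bdd) auto
  have dist: "real_distribution (distr (conv_pow F n) borel (\<lambda>x. x / ?a n))" for n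
    by (intro N.real_distribution_distr) simp
  have "char (distr (conv_pow F n) borel (\<lambda>x. x / ?a n)) s = char F (s / ?a n) ^ n" for n s
    using char_walk[of n "s / ?a n"]
    by (simp add: char_def integral_distr)
  with levy_continuity1[OF dist G stable]
  have lim: "(\<lambda>n. char F (s / ?a n) ^ n) \<longlonglongrightarrow> char G s" for s by simp
  have top: "filterlim ?a at_top sequentially"
    by (rule scale_at_top[OF mono ge G lim])
  have "(\<lambda>n. A (?a n) / real n) \<longlonglongrightarrow> 1"
  proof (rule scale_ratio[OF top r])
    show "r t \<le> real n" if "1 \<le> t" "t < ?a n" for n t
    proof (rule ccontr)
      assume "\<not> r t \<le> real n"
      then have "?a n \<le> t" unfolding rinv_def using that by (intro cInf_lower bdd) auto
      then show False using that by simp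
    qed
    show "\<exists>t. ?a n \<le> t \<and> t < s \<and> real n < r t" if "?a n < s" for n s
    proof -
      from that obtain t where t: "t \<in> ?S n" "t < s"
        unfolding rinv_def using cInf_lessD[OF ne] by blast
      moreover from t(1) have "?a n \<le> t" unfolding rinv_def by (intro cInf_lower bdd)
      ultimately show ?thesis by blast
    qed
  qed
  then show ?thesis
    using mono ge top G lim heavy_tail_axioms
    by (intro stable_domain.intro stable_domain_axioms.intro) auto
qed

end

section \<open>From the tail conditions to the renewal limit\<close>

lemma heavy_tailI:
  assumes F: "real_distribution F" and \<alpha>: "1/2 < \<alpha>" "\<alpha> < 1" and r: "regvar \<alpha> r"
    and tail: "(\<lambda>x. Fbar F x) \<sim>[at_top] (\<lambda>x. 1 / r x)"
  shows "heavy_tail F \<alpha>" and "((\<lambda>x. r x * Fbar F x) \<longlongrightarrow> 1) at_top"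
proof -
  interpret real_distribution F by fact
  have r_pos: "\<forall>\<^sub>F x in at_top. 0 < r x"
    using eventually_gt_at_top[of 0] by eventually_elim (use r in \<open>auto simp: regvar_def\<close>)
  have "((\<lambda>x. Fbar F x / (1 / r x)) \<longlongrightarrow> 1) at_top"
    by (rule asymp_equivD_strong[OF tail]) (use r_pos in \<open>auto elim!: eventually_mono\<close>)
  then show lim: "((\<lambda>x. r x * Fbar F x) \<longlongrightarrow> 1) at_top" by (simp add: mult.commute)
  have Fbar_anti: "Fbar F y \<le> Fbar F x" if "x \<le> y" for x y
    unfolding Fbar_def using that by (auto intro!: finite_measure_mono)
  have "\<forall>\<^sub>F x in at_top. 0 < r x * Fbar F x"
    using order_tendstoD(1)[OF lim, of 0] by simp
  with r_pos have ev_pos: "\<forall>\<^sub>F x in at_top. 0 < Fbar F x"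
    by eventually_elim (simp add: zero_less_mult_iff)
  \<comment> \<open>Positivity for large arguments spreads to the left by monotonicity of the
    tail.\<close>
  have pos: "0 < Fbar F x" for x
  proof -
    have "\<forall>\<^sub>F y in at_top. 0 < Fbar F y \<and> x \<le> y"
      using ev_pos eventually_ge_at_top[of x] by eventually_elim auto
    then obtain y where "0 < Fbar F y" "x \<le> y"
      using eventually_happens'[OF trivial_limit_at_top_linorder] by blast
    then show ?thesis using Fbar_anti[of x y] by linarith
  qed
  have "((\<lambda>x. Fbar F (c * x) / Fbar F x) \<longlongrightarrow> c powr - \<alpha>) at_top" if c: "0 < c" for c
  proof -
    have cx: "filterlim (\<lambda>x. c * x) at_top at_top"
      by (rule filterlim_tendsto_pos_mult_at_top[OF tendsto_const c filterlim_ident])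
    have "((\<lambda>x. r (c * x) / r x) \<longlongrightarrow> c powr \<alpha>) at_top" using r c by (simp add: regvar_def)
    then have "((\<lambda>x. (r (c * x) * Fbar F (c * x)) / (r x * Fbar F x) * inverse (r (c * x) / r x)) \<longlongrightarrow>
        1 / 1 * inverse (c powr \<alpha>)) at_top"
      using c by (intro tendsto_mult tendsto_divide tendsto_inverse lim filterlim_compose[OF lim cx]) auto
    moreover have "\<forall>\<^sub>F x in at_top. (r (c * x) * Fbar F (c * x)) / (r x * Fbar F x) * inverse (r (c * x) / r x) = Fbar F (c * x) / Fbar F x"
      using r_pos eventually_compose_filterlim[OF r_pos cx]
      by eventually_elim (simp add: field_simps)
    ultimately show ?thesis
      by (simp add: powr_minus Lim_transform_eventually)
  qed
  with pos show "heavy_tail F \<alpha>"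
    using \<alpha> F by (intro heavy_tail.intro heavy_tail_axioms.intro) auto
qed

theorem theorem1p2:
  fixes F :: "real measure" and \<alpha> h :: real and r g :: "real \<Rightarrow> real"
  assumes F: "real_distribution F"
    and \<alpha>: "1/2 < \<alpha>" "\<alpha> < 1"
    and r: "regvar \<alpha> r"
    and tail_i: "(\<lambda>x. Fbar F x) \<sim>[at_top] (\<lambda>x. 1 / r x)"
    and tail_ii: "\<exists>c. ((\<lambda>x. measure F {..-x} / Fbar F x) \<longlongrightarrow> c) at_top"
    and h: "h > 0" "arithmetic F \<longrightarrow> h = span F"
    and g_meas: "g \<in> borel_measurable borel" and g_nonneg: "\<And>x. g x \<ge> 0"
    and g_dist: "real_distribution (density lborel (\<lambda>x. ennreal (g x)))"
    and stable: "weak_conv_m (\<lambda>n. distr (conv_pow F n) borel (\<lambda>x. x / rinv r (real n)))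
                   (density lborel (\<lambda>x. ennreal (g x)))"
  shows "((\<lambda>x. ennreal (x * Fbar F x) * renewal F {x<..x+h}) \<longlongrightarrow>
            ennreal (\<alpha> * h) * (\<integral>\<^sup>+ x\<in>{0<..}. ennreal (x powr (-\<alpha>) * g x) \<partial>lborel)) at_top"
proof -
  interpret heavy_tail F \<alpha> by (rule heavy_tailI[OF F \<alpha> r tail_i])
  have "((\<lambda>x. r x / A x) \<longlongrightarrow> 1) at_top"
    using heavy_tailI(2)[OF F \<alpha> r tail_i] by (simp add: A_def)
  then interpret stable_domain F \<alpha> "\<lambda>n. rinv r (real n)" "density lborel (\<lambda>x. ennreal (g x))"
    by (rule stable_domain_rinv[OF _ g_dist stable])
  show ?thesis
  proof (rule renewal_limit[OF h(1) g_meas g_nonneg refl])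
    fix \<delta> K :: real assume \<delta>K: "0 < \<delta>" "\<delta> < K"
    show "((\<lambda>x. complex_of_real (block_hits h \<delta> K x)) \<longlongrightarrow> h / (2 * pi) * middle \<delta> K) at_top"
    proof (cases "arithmetic F")
      case True
      note span = lattice_on_span[OF True]
      have hs: "h = span F" using True h by simp
      have "char F (2 * pi / h) = 1"
        using span(1) lattice_on_iff[OF F h(1)] by (simp add: hs)
      \<comment> \<open>A zero of \<open>1 - char F\<close> with \<bar>t\<bar> \<le> pi / h would
        produce a lattice of step at least \<open>2 * h\<close>, beyond the span.\<close>
      moreover have "char F t \<noteq> 1" if t: "0 < \<bar>t\<bar>" "\<bar>t\<bar> \<le> pi / h" for t
      proof
        assume "char F t = 1"
        then have "2 * pi / \<bar>t\<bar> \<le> h"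
          using span(2)[OF char_eq_1_imp_lattice] t hs by simp
        then have "2 * pi \<le> h * \<bar>t\<bar>" using t by (simp add: field_simps)
        also have "\<dots> \<le> pi" using t h by (simp add: field_simps)
        finally show False by simp
      qed
      ultimately show ?thesis by (intro block_hits_lattice h \<delta>K)
    next
      case False
      then have "char F t \<noteq> 1" if "t \<noteq> 0" for t
        using char_eq_1_imp_lattice[OF that] by (auto simp: arithmetic_def)
      then show ?thesis by (intro block_hits_nonlattice h \<delta>K)
    qed
  qed
qed

end
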